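(* Let $d=2$, let $E\subset\mathbb{R}^2$ be an ellipse (the closed region bounded by it, with the origin in its interior), and let $p\ge1$. Then there exists a constant $C$ such that for every $R\ge2$, $$\left\{\int_R^{R+1}\int_{\mathbb{T}^2}\left|r^{-1/2}\mathcal{D}(E,r,x)\right|^p dx\,dr\right\}^{1/p}\le\begin{cases}C&\text{if }p<6,\\ C\log^{2/3}(R)&\text{if }p=6.\end{cases}$$
   Context: The discrepancy is $\mathcal{D}(E,r,x)=\sum_{k\in\mathbb{Z}^2}\chi_{rE-x}(k)-r^2|E|$, where $\chi_A$ is the characteristic function of $A$ and $|E|$ is the Lebesgue measure of $E$; it is $\mathbb{Z}^2$-periodic in $x$. $\mathbb{T}^2=\mathbb{R}^2/\mathbb{Z}^2$. $\log^a(t)$ means $(\log t)^a$. *)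

theory Defs
  imports "HOL-Analysis.Analysis"
begin

text \<open>
  The closed plane region bounded by an ellipse (circles included) with centre \<open>c\<close>,
  orthonormal axis directions \<open>u\<close>, \<open>v\<close> and semi-axes \<open>a\<close>, \<open>b\<close>. The axes may point in any
  direction and the centre need not be the origin.
\<close>
definition is_ellipse :: "(real^2) set \<Rightarrow> bool" where
  "is_ellipse E \<longleftrightarrow>
     (\<exists>c u v a b. norm u = 1 \<and> norm v = 1 \<and> u \<bullet> v = 0 \<and> 0 < a \<and> 0 < b \<and>
        E = {x. (((x - c) \<bullet> u) / a)\<^sup>2 + (((x - c) \<bullet> v) / b)\<^sup>2 \<le> 1})"

definition int_lattice :: "(real^2) set" where
  "int_lattice = {k. \<forall>i. k $ i \<in> \<int>}"

text \<open>
  For bounded \<open>E\<close> only finitely many terms of the sum are nonzero, so the infinite sum is the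
  number of lattice points in \<open>rE - x\<close>.
\<close>
definition discrepancy :: "(real^2) set \<Rightarrow> real \<Rightarrow> real^2 \<Rightarrow> real" where
  "discrepancy E r x =
     (\<Sum>\<^sub>\<infinity>k\<in>int_lattice. indicat_real ((\<lambda>y. r *\<^sub>R y - x) ` E) k) - r\<^sup>2 * measure lebesgue E"

text \<open>
  A fundamental domain for \<open>\<real>\<^sup>2/\<int>\<^sup>2\<close>: integrating a \<open>\<int>\<^sup>2\<close>-periodic function over the torus
  means integrating it over this unit square.
\<close>
definition torus_domain :: "(real^2) set" where
  "torus_domain = {x. \<forall>i. 0 \<le> x $ i \<and> x $ i < 1}"

definition discrepancy_mean :: "(real^2) set \<Rightarrow> real \<Rightarrow> real \<Rightarrow> real" where
  "discrepancy_mean E p R =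
     (LINT r:{R..R+1}|lebesgue. LINT x:torus_domain|lebesgue.
        \<bar>r powr (- 1 / 2) * discrepancy E r x\<bar> powr p) powr (1 / p)"

end

theory Submission
  imports Defs
begin

text \<open>
  A linear change of variables turns the ellipse into a disc and the integer lattice into a general
  lattice. Writing \<open>\<rho>(k)\<close> for the length of the frequency \<open>k\<close> in the new coordinates (the norm of
  \<open>freq k\<close>), the Fourier coefficient at \<open>k\<close> of the lattice point count in the dilate of size \<open>r\<close> is
  a radial function whose leading term is \<open>r powr (1/2) * \<rho> powr (-3/2)\<close> times a combination of
  \<open>cos (r \<rho>)\<close> and \<open>sin (r \<rho>)\<close>; this comes from Bessel's differential equation
  (\<open>semicircle_ft_asymptotics\<close>). Averaging the count over a copy of the ellipse of size
  \<open>R powr (-1/2)\<close> squeezes it between two counts whose main terms differ by \<open>O(sqrt R)\<close>, which is the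
  size the theorem allows, and makes the Fourier series absolutely convergent with the frequencies
  \<open>\<rho> > R\<close> contributing again \<open>O(sqrt R)\<close>. So \<open>r powr (-1/2)\<close> times the discrepancy is at most a
  constant times one plus the moduli of four wave packets
  \<open>\<Sum> c\<^sub>k exp(\<plusminus>i r \<rho>(k)) e(k \<bullet> x)\<close> with \<open>\<bar>c\<^sub>k\<bar> = O(\<rho> powr (-3/2))\<close> and frequencies \<open>\<rho> = O(R)\<close>
  (\<open>discrepancy_packets\<close>).

  Such packets solve half-wave equations on a two-dimensional torus, and what is needed is the
  endpoint Strichartz inequality with exponent 6. The sixth power of a packet is the squared modulus
  of its cube. Integration over the torus keeps only the pairs of triples of frequencies with equal
  sums, and integration over a unit range of \<open>r\<close> damps those pairs whose total lengths differ. The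
  Schur test with weights \<open>\<Prod>(1 + \<rho>(k\<^sub>i))\<close> then reduces everything to a uniform bound for the number
  of triples with prescribed sum and prescribed total length, counted with the weight
  \<open>\<Prod> 1/(1 + \<rho>(k\<^sub>i))\<close> (\<open>cone_convolution_bound\<close>). In the continuum this is the statement that the
  threefold convolution of the invariant measure of the light cone in dimension 2 + 1 is constant
  inside the cone; the discrete version follows by applying twice an estimate for lattice points
  between two confocal ellipses (\<open>layer_sum\<close>), which is elementary in parabolic coordinates.

  The outcome is that the sixth moment of a packet is \<open>O((\<Sum> \<bar>c\<^sub>k\<bar>\<^sup>2 (1 + \<rho>(k)))^3)\<close>. Each dyadic shell
  of frequencies contributes a bounded amount to the inner sum, so that the sixth moment is
  \<open>O((ln R)^3)\<close>, and its sixth root is \<open>O((ln R) powr (1/2))\<close>, which is at most a constant times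
  \<open>(ln R) powr (2/3)\<close>. If \<open>p < 6\<close>, the shell at height \<open>2^j\<close> has second moment \<open>O(2^(-j))\<close> and bounded
  sixth moment; interpolating between the two gives a \<open>p\<close>-th moment that decays geometrically in \<open>j\<close>,
  and the shells can be added up.
\<close>

section \<open>Lattice points near light cones\<close>

definition separated :: "real \<Rightarrow> complex set \<Rightarrow> bool" where
  "separated d S \<longleftrightarrow> (\<forall>x\<in>S. \<forall>y\<in>S. x \<noteq> y \<longrightarrow> d \<le> norm (x - y))"

lemma separated_subset: "separated d S \<Longrightarrow> T \<subseteq> S \<Longrightarrow> separated d T"
  by (auto simp: separated_def)

text \<open>
  Two points of a square of side \<open>d / 2\<close> are closer than \<open>d\<close>, so a separated set has at most one point
  in each cell of such a grid. Multiplication by the unit number \<open>w\<close> lets the rectangle point in any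
  direction.
\<close>
lemma card_separated_rectangle:
  fixes S :: "complex set"
  assumes d: "0 < d" and sep: "separated d S" and w: "norm w = 1" and L: "0 \<le> L" "0 \<le> W"
    and x: "\<And>z. z \<in> S \<Longrightarrow> x0 \<le> Re (z * w) \<and> Re (z * w) \<le> x0 + L"
    and y: "\<And>z. z \<in> S \<Longrightarrow> y0 \<le> Im (z * w) \<and> Im (z * w) \<le> y0 + W"
  shows "finite S" "real (card S) \<le> (2 / d + 1)\<^sup>2 * ((1 + L) * (1 + W))"
proof -
  define f where "f z = (\<lfloor>(Re (z * w) - x0) * (2 / d)\<rfloor>, \<lfloor>(Im (z * w) - y0) * (2 / d)\<rfloor>)" for z
  define N where "N X = {0..\<lfloor>X * (2 / d)\<rfloor>}" for X :: real
  have inj: "inj_on f S"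
  proof (rule inj_onI, rule ccontr)
    fix z z' assume z: "z \<in> S" "z' \<in> S" "f z = f z'" "z \<noteq> z'"
    let ?a = "Re (z * w) - Re (z' * w)" and ?b = "Im (z * w) - Im (z' * w)"
    have fl: "\<bar>s - t\<bar> < d / 2" if "\<lfloor>(s - r) * (2 / d)\<rfloor> = \<lfloor>(t - r) * (2 / d)\<rfloor>" for r s t :: real
    proof -
      have "\<bar>(s - r) * (2 / d) - (t - r) * (2 / d)\<bar> < 1" using that by linarith
      also have "(s - r) * (2 / d) - (t - r) * (2 / d) = (s - t) * (2 / d)" by algebra
      finally have "\<bar>s - t\<bar> * (2 / d) < 1" unfolding abs_mult using d by simp
      then show ?thesis using d by (simp add: field_simps)
    qed
    have a: "\<bar>?a\<bar> < d / 2" and b: "\<bar>?b\<bar> < d / 2"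
      using fl[of "Re (z * w)" x0 "Re (z' * w)"] fl[of "Im (z * w)" y0 "Im (z' * w)"] z(3)
      unfolding f_def prod.inject by blast+
    have "norm (z - z') = norm ((z - z') * w)" using w by (simp add: norm_mult)
    also have "\<dots> \<le> \<bar>Re ((z - z') * w)\<bar> + \<bar>Im ((z - z') * w)\<bar>" by (rule cmod_le)
    also have "\<dots> = \<bar>?a\<bar> + \<bar>?b\<bar>" by (simp add: left_diff_distrib)
    also have "\<dots> < d" using a b by linarith
    finally show False using sep z unfolding separated_def by (metis not_less)
  qed
  have sub: "f ` S \<subseteq> N L \<times> N W"
  proof safe
    fix z a b assume z: "z \<in> S" "(a, b) = f z"
    have "(Re (z * w) - x0) * (2 / d) \<le> L * (2 / d)" "(Im (z * w) - y0) * (2 / d) \<le> W * (2 / d)"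
      using d x[OF z(1)] y[OF z(1)] by (intro mult_right_mono; simp del: times_complex.simps)+
    moreover have "0 \<le> (Re (z * w) - x0) * (2 / d)" "0 \<le> (Im (z * w) - y0) * (2 / d)"
      using d x[OF z(1)] y[OF z(1)] by auto
    ultimately show "a \<in> N L" "b \<in> N W"
      using z(2) by (auto simp: f_def N_def floor_mono)
  qed
  have fin: "finite (N L \<times> N W)" by (simp add: N_def)
  show "finite S" using inj sub fin finite_subset inj_on_finite by blast
  have cN: "real (card (N X)) \<le> (2 / d + 1) * (1 + X)" if "0 \<le> X" for X
  proof -
    have "0 \<le> X * (2 / d)" using that d by simp
    then have "real (card (N X)) = of_int \<lfloor>X * (2 / d)\<rfloor> + 1"
      unfolding N_def by (simp add: of_nat_nat)
    also have "\<dots> \<le> X * (2 / d) + 1" by simp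
    also have "\<dots> \<le> (2 / d + 1) * (1 + X)" using that d by (simp add: field_simps)
    finally show ?thesis .
  qed
  have "real (card S) \<le> real (card (N L \<times> N W))"
    using card_inj_on_le[OF inj sub fin] by simp
  also have "\<dots> = real (card (N L)) * real (card (N W))" by (simp add: card_cartesian_product)
  also have "\<dots> \<le> ((2 / d + 1) * (1 + L)) * ((2 / d + 1) * (1 + W))"
    using cN L d by (intro mult_mono) auto
  finally show "real (card S) \<le> (2 / d + 1)\<^sup>2 * ((1 + L) * (1 + W))"
    by (simp only: power2_eq_square mult_ac)
qed

text \<open>
  The numbers \<open>\<bar>z\<bar> \<mp> x\<close> are the parabolic coordinates of \<open>z\<close> with axis \<open>cnj w\<close>; their product is the
  square of the distance from the axis because \<open>\<bar>z\<bar>\<^sup>2 = x\<^sup>2 + y\<^sup>2\<close>.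
\<close>
lemma parabolic_identities:
  fixes z w :: complex assumes "norm w = 1"
  defines "\<alpha> \<equiv> norm z - Re (z * w)" and "\<beta> \<equiv> norm z + Re (z * w)"
  shows "0 \<le> \<alpha>" "0 \<le> \<beta>" "\<alpha> * \<beta> = (Im (z * w))\<^sup>2"
proof -
  have n: "norm (z * w) = norm z" using assms by (simp add: norm_mult)
  have "\<bar>Re (z * w)\<bar> \<le> norm z" using abs_Re_le_cmod[of "z * w"] n by simp
  then show "0 \<le> \<alpha>" "0 \<le> \<beta>" unfolding \<alpha>_def \<beta>_def by linarith+
  have "(norm z)\<^sup>2 = (Re (z * w))\<^sup>2 + (Im (z * w))\<^sup>2"
    using cmod_power2[of "z * w"] n by simp
  then show "\<alpha> * \<beta> = (Im (z * w))\<^sup>2" unfolding \<alpha>_def \<beta>_def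
    by (simp add: power2_eq_square algebra_simps)
qed

text \<open>
  Confining both parabolic coordinates to bounded intervals confines \<open>x\<close>, half their difference, to a
  bounded interval and \<open>\<bar>y\<bar>\<close>, the square root of their product, to an interval of length
  \<open>O((1 + a + b) / sqrt ((1 + a) * (1 + b)))\<close>. The part above the axis and the part below it are
  therefore contained in one rectangle each.
\<close>
lemma card_separated_parabolic_box:
  fixes S :: "complex set"
  assumes d: "0 < d" and sep: "separated d S" and w: "norm w = 1" and ab: "0 \<le> a" "0 \<le> b"
    and al: "\<And>z. z \<in> S \<Longrightarrow> a \<le> norm z - Re (z * w) \<and> norm z - Re (z * w) \<le> a + 4"
    and be: "\<And>z. z \<in> S \<Longrightarrow> b \<le> norm z + Re (z * w) \<and> norm z + Re (z * w) \<le> b + 1"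
  shows "real (card S) \<le> 36 * (2 / d + 1)\<^sup>2 * ((1 + a) + (1 + b)) / sqrt ((1 + a) * (1 + b))"
proof -
  define Y0 where "Y0 = sqrt (a * b)"
  define Y1 where "Y1 = sqrt ((a + 4) * (b + 1))"
  define W where "W = Y1 - Y0"
  define s where "s = sqrt ((1 + a) * (1 + b))"
  have spos: "0 < s" using ab by (simp add: s_def)
  have sY: "s \<le> Y1" using ab unfolding s_def Y1_def by (intro real_sqrt_le_mono mult_mono) auto
  have Y0: "0 \<le> Y0" "Y0 \<le> Y1" using ab unfolding Y0_def Y1_def
    by (auto intro!: real_sqrt_le_mono mult_mono)
  have "Y1 * W \<le> (Y1 + Y0) * W" using Y0 by (intro mult_right_mono) (auto simp: W_def)
  also have "\<dots> = Y1\<^sup>2 - Y0\<^sup>2" by (simp add: W_def power2_eq_square algebra_simps)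
  also have "\<dots> = (a + 4) * (b + 1) - a * b" using ab by (simp add: Y0_def Y1_def)
  also have "\<dots> \<le> 4 * ((1 + a) + (1 + b))" using ab by (simp add: algebra_simps)
  finally have "s * W \<le> 4 * ((1 + a) + (1 + b))"
    using mult_right_mono[OF sY, of W] Y0 by (simp add: W_def)
  then have W: "W \<le> 4 * ((1 + a) + (1 + b)) / s" using spos by (simp add: field_simps)
  have one: "1 \<le> ((1 + a) + (1 + b)) / s"
    using arith_geo_mean_sqrt[of "1 + a" "1 + b"] ab spos by (simp add: s_def field_simps)
  have Wpos: "0 \<le> W" using Y0 by (simp add: W_def)
  have x: "(b - a - 4) / 2 \<le> Re (z * w) \<and> Re (z * w) \<le> (b - a - 4) / 2 + 5 / 2" if "z \<in> S" for z
    using al[OF that] be[OF that] by (simp add: field_simps)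
  have y: "Y0 \<le> \<bar>Im (z * w)\<bar> \<and> \<bar>Im (z * w)\<bar> \<le> Y1" if "z \<in> S" for z
  proof -
    note p = parabolic_identities[OF w, of z]
    have "a * b \<le> (norm z - Re (z * w)) * (norm z + Re (z * w))"
      using al[OF that] be[OF that] ab by (intro mult_mono) linarith+
    moreover have "(norm z - Re (z * w)) * (norm z + Re (z * w)) \<le> (a + 4) * (b + 1)"
      using al[OF that] be[OF that] ab p(1,2) by (intro mult_mono) linarith+
    ultimately have "sqrt (a * b) \<le> sqrt ((Im (z * w))\<^sup>2)" "sqrt ((Im (z * w))\<^sup>2) \<le> sqrt ((a + 4) * (b + 1))"
      unfolding p(3) real_sqrt_le_iff by simp_all
    then show ?thesis by (simp add: Y0_def Y1_def del: times_complex.simps)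
  qed
  define S1 where "S1 = {z \<in> S. 0 \<le> Im (z * w)}"
  define S2 where "S2 = {z \<in> S. Im (z * w) < 0}"
  have "real (card S1) \<le> (2 / d + 1)\<^sup>2 * ((1 + 5 / 2) * (1 + W))"
    using d separated_subset[OF sep, of S1] w Wpos x y
    by (intro card_separated_rectangle[of d S1 w _ _ "(b - a - 4) / 2" Y0])
      (force simp: S1_def W_def)+
  moreover have "real (card S2) \<le> (2 / d + 1)\<^sup>2 * ((1 + 5 / 2) * (1 + W))"
    using d separated_subset[OF sep, of S2] w Wpos x y
    by (intro card_separated_rectangle[of d S2 w _ _ "(b - a - 4) / 2" "- Y1"])
      (force simp: S2_def W_def)+
  moreover have "card S \<le> card S1 + card S2"
  proof -
    have "S = S1 \<union> S2" by (auto simp: S1_def S2_def)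
    then show ?thesis using card_Un_le by metis
  qed
  ultimately have "real (card S) \<le> 2 * ((2 / d + 1)\<^sup>2 * ((1 + 5 / 2) * (1 + W)))"
    by linarith
  also have "\<dots> = 7 * (2 / d + 1)\<^sup>2 * (1 + W)" by simp
  also have "\<dots> \<le> 7 * (2 / d + 1)\<^sup>2 * (5 * (((1 + a) + (1 + b)) / s))"
  proof (rule mult_left_mono)
    show "1 + W \<le> 5 * (((1 + a) + (1 + b)) / s)"
      using W one unfolding times_divide_eq_right[symmetric] by linarith
  qed simp
  also have "\<dots> = 35 * ((2 / d + 1)\<^sup>2 * (((1 + a) + (1 + b)) / s))" by simp
  also have "\<dots> \<le> 36 * ((2 / d + 1)\<^sup>2 * (((1 + a) + (1 + b)) / s))"
    using ab spos by (intro mult_right_mono) auto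
  finally show ?thesis by (simp add: s_def)
qed


text \<open>
  On the ellipse \<open>\<bar>z\<bar> + \<bar>n - z\<bar> = u\<close> with \<open>\<bar>n\<bar> = m\<close> the parabolic coordinates along \<open>n\<close> satisfy the
  linear equation \<open>\<alpha> / (u - m) + \<beta> / (u + m) = 1\<close>. Its solution \<open>\<alpha>\<close> has partial derivatives of
  absolute value at most 1 in \<open>u\<close> and in \<open>\<beta>\<close>, so it moves by at most 2 when both move by at most 1.
\<close>
lemma layer_window:
  fixes m u u' \<alpha> \<alpha>' \<beta> \<beta>' :: real
  assumes "0 \<le> m" "m \<le> u" "u \<le> u'" "u' \<le> u + 1" "0 \<le> \<beta>" "\<beta> \<le> u" "\<bar>\<beta> - \<beta>'\<bar> \<le> 1"
    and "0 \<le> \<alpha>" "0 \<le> \<alpha>'" "\<alpha> \<le> u" "\<alpha>' \<le> u'"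
    and e: "(u + m) * \<alpha> + (u - m) * \<beta> = (u - m) * (u + m)"
    and e': "(u' + m) * \<alpha>' + (u' - m) * \<beta>' = (u' - m) * (u' + m)"
  shows "\<bar>\<alpha> - \<alpha>'\<bar> \<le> 2"
proof (cases "u + m = 0")
  case True
  then show ?thesis using assms by auto
next
  case False
  then have p: "0 < u + m" "0 < u' + m" using assms by auto
  define t where "t = (u - m) / (u + m)"
  define t' where "t' = (u' - m) / (u' + m)"
  have a: "\<alpha> = (u - m) - t * \<beta>" using e p by (simp add: t_def field_simps)
  have a': "\<alpha>' = (u' - m) - t' * \<beta>'" using e' p by (simp add: t'_def field_simps)
  have t': "0 \<le> t'" "t' \<le> 1" using assms p by (auto simp: t'_def)
  have "\<bar>t' * (\<beta>' - \<beta>)\<bar> \<le> 1 * 1" unfolding abs_mult using t' assms by (intro mult_mono) auto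
  then have *: "\<bar>t' * (\<beta>' - \<beta>)\<bar> \<le> 1" by simp
  have d: "t' - t = (u' - u) * (2 * m) / ((u + m) * (u' + m))"
    using p by (simp add: t_def t'_def field_simps)
  have d0: "0 \<le> t' - t" unfolding d using assms p by auto
  have "(t' - t) * \<beta> \<le> (t' - t) * (u + m)" using d0 assms by (intro mult_left_mono) auto
  also have "\<dots> = (u' - u) * (2 * m / (u' + m))" unfolding d using p by simp
  also have "\<dots> \<le> (u' - u) * 1" using assms p by (intro mult_left_mono) auto
  finally have "(t' - t) * \<beta> \<le> u' - u" by simp
  moreover have "0 \<le> (t' - t) * \<beta>" using d0 assms by auto
  moreover have "\<alpha>' - \<alpha> = (u' - u) - t' * (\<beta>' - \<beta>) - (t' - t) * \<beta>"
    unfolding a a' by (simp add: algebra_simps)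
  ultimately show ?thesis using assms * by linarith
qed

lemma sum_inverse_sqrt_le: "(\<Sum>j\<le>N. 1 / sqrt (1 + real j)) \<le> 2 * sqrt (1 + real N)"
proof (induction N)
  case (Suc N)
  define x where "x = sqrt (1 + real N)"
  define y where "y = sqrt (2 + real N)"
  have xy: "0 < x" "x \<le> y" "y\<^sup>2 = x\<^sup>2 + 1" unfolding x_def y_def by auto
  have "1 = (y - x) * (y + x)" using xy by (simp add: power2_eq_square algebra_simps)
  also have "\<dots> \<le> (y - x) * (2 * y)" using xy by (intro mult_left_mono) auto
  finally have "1 / y \<le> 2 * (y - x)" using xy by (simp add: field_simps)
  then show ?case using Suc by (simp add: x_def y_def algebra_simps)
qed simp

text \<open>
  The assumption \<open>half\<close> selects the half of the elliptic ring that is closer to the focus \<open>0\<close>. There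
  \<open>\<alpha>\<close> is at least half of its maximal value \<open>u - m\<close>, so \<open>\<alpha>\<close> is at least of order \<open>h = \<tau> - m\<close>. Cut the
  half ring into pieces on which \<open>\<beta>\<close> varies by at most 1, say \<open>\<beta> \<approx> j\<close>. By \<open>layer_window\<close> each of them is
  contained in a parabolic box, and since \<open>\<bar>k\<bar> = (\<alpha> + \<beta>) / 2\<close> the box contributes a multiple of
  \<open>1 / sqrt ((1 + h) * (1 + j))\<close>. Summation over \<open>j \<le> \<tau> + 1\<close> gives the bound.
\<close>
lemma half_layer_sum:
  fixes S :: "complex set" and n w :: complex and \<tau> m d :: real
  assumes S: "finite S" "0 < d" "separated d S" and \<tau>: "0 \<le> \<tau>"
    and w: "norm w = 1" "n * w = of_real m" "0 \<le> m"
    and layer: "\<And>k. k \<in> S \<Longrightarrow> \<tau> \<le> norm k + norm (n - k) \<and> norm k + norm (n - k) < \<tau> + 1"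
    and half: "\<And>k. k \<in> S \<Longrightarrow> 2 * Re (k * w) \<le> m"
  shows "(\<Sum>k\<in>S. 1 / (1 + norm k)) \<le> 864 * (2 / d + 1)\<^sup>2 * sqrt ((1 + \<tau>) / (1 + max 0 (\<tau> - m)))"
proof -
  define \<alpha> where "\<alpha> k = norm k - Re (k * w)" for k
  define \<beta> where "\<beta> k = norm k + Re (k * w)" for k
  define u where "u k = norm k + norm (n - k)" for k
  define h where "h = max 0 (\<tau> - m)"
  define D where "D = (2 / d + 1)\<^sup>2"
  define jj where "jj k = nat \<lfloor>\<beta> k\<rfloor>" for k
  define N where "N = nat \<lfloor>\<tau> + 1\<rfloor>"
  have nm: "norm n = m" using w by (metis abs_of_nonneg mult.right_neutral norm_mult norm_of_real)
  have pos: "0 \<le> \<alpha> k" "0 \<le> \<beta> k" for k using parabolic_identities[OF w(1), of k] by (auto simp: \<alpha>_def \<beta>_def)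
  have mu: "m \<le> u k" for k using norm_triangle_ineq[of k "n - k"] nm by (simp add: u_def)
  have ell: "(u k + m) * \<alpha> k + (u k - m) * \<beta> k = (u k - m) * (u k + m)" for k
  proof -
    have "(norm (n - k))\<^sup>2 = (norm ((n - k) * w))\<^sup>2" using w by (simp add: norm_mult)
    also have "\<dots> = (m - Re (k * w))\<^sup>2 + (Im (k * w))\<^sup>2"
      by (simp add: cmod_power2 left_diff_distrib w(2) del: times_complex.simps)
    also have "\<dots> = m\<^sup>2 - 2 * m * Re (k * w) + (norm (k * w))\<^sup>2"
      unfolding cmod_power2 by (simp add: power2_eq_square algebra_simps)
    finally have "(u k - norm k)\<^sup>2 = m\<^sup>2 - 2 * m * Re (k * w) + (norm k)\<^sup>2"
      using w by (simp add: norm_mult u_def del: times_complex.simps)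
    then show ?thesis unfolding \<alpha>_def \<beta>_def by (simp add: power2_eq_square algebra_simps)
  qed
  have nk: "norm k = (\<alpha> k + \<beta> k) / 2" for k by (simp add: \<alpha>_def \<beta>_def)
  have ub: "\<tau> \<le> u k" "u k < \<tau> + 1" if "k \<in> S" for k using layer[OF that] by (auto simp: u_def)
  have bm: "\<beta> k \<le> m + \<alpha> k" if "k \<in> S" for k using half[OF that] by (simp add: \<alpha>_def \<beta>_def)
  have al: "(u k - m) / 2 \<le> \<alpha> k" if "k \<in> S" for k
  proof (cases "u k = 0")
    case True
    then show ?thesis using mu[of k] w pos(1)[of k] by simp
  next
    case False
    then have up: "0 < u k" using mu[of k] w by linarith
    have "(u k - m) * \<beta> k \<le> (u k - m) * (m + \<alpha> k)"
      using bm[OF that] mu[of k] by (intro mult_left_mono) auto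
    then have "u k * (u k - m) \<le> u k * (2 * \<alpha> k)" using ell[of k] by (simp add: algebra_simps)
    then show ?thesis using up by simp
  qed
  have kn: "2 * norm k \<le> u k" if "k \<in> S" for k
  proof (rule ccontr)
    assume "\<not> 2 * norm k \<le> u k"
    then have g: "u k < \<alpha> k + \<beta> k" by (simp add: nk)
    have "\<beta> k - \<alpha> k \<le> m" using bm[OF that] by simp
    have "u k * u k - m * m = u k * (\<alpha> k + \<beta> k) - m * (\<beta> k - \<alpha> k)"
      using ell[of k] by (simp add: algebra_simps)
    moreover have "m * (\<beta> k - \<alpha> k) \<le> m * m" using bm[OF that] w by (intro mult_left_mono) auto
    ultimately have "u k * (\<alpha> k + \<beta> k) \<le> u k * u k" by linarith
    moreover have "norm k \<le> u k" by (simp add: u_def)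
    ultimately show False using g mu[of k] w by (cases "u k = 0") (auto simp: nk)
  qed
  have ab: "\<alpha> k \<le> u k" "\<beta> k \<le> u k" if "k \<in> S" for k
    using kn[OF that] pos[of k] by (auto simp: nk)
  have jb: "real (jj k) \<le> \<beta> k" "\<beta> k \<le> real (jj k) + 1" for k
    using pos(2)[of k] unfolding jj_def by linarith+
  have jN: "jj ` S \<subseteq> {..N}"
  proof safe
    fix k assume "k \<in> S"
    then have "\<beta> k \<le> \<tau> + 1" using ab ub by (meson less_eq_real_def order_trans)
    then show "jj k \<le> N" unfolding jj_def N_def by (intro nat_mono floor_mono)
  qed
  have inner: "(\<Sum>k\<in>{k\<in>S. jj k = j}. 1 / (1 + norm k)) \<le> 288 * D / sqrt (1 + h) * (1 / sqrt (1 + real j))" for j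
  proof (cases "{k\<in>S. jj k = j} = {}")
    case True
    have "0 \<le> h" "0 \<le> D" by (auto simp: h_def D_def)
    then show ?thesis unfolding True by simp
  next
    case False
    then obtain k0 where k0: "k0 \<in> S" "jj k0 = j" by auto
    define a where "a = max 0 (\<alpha> k0 - 2)"
    \<comment> \<open>One point of the group serves as reference; all others have \<open>\<alpha>\<close> within distance 2 of it.\<close>
    have win: "a \<le> \<alpha> k \<and> \<alpha> k \<le> a + 4" if k: "k \<in> {k\<in>S. jj k = j}" for k
    proof -
      have bb: "\<bar>\<beta> k - \<beta> k0\<bar> \<le> 1" using jb[of k] jb[of k0] k k0 by simp
      have kS: "k \<in> S" using k by simp
      have "\<bar>\<alpha> k - \<alpha> k0\<bar> \<le> 2"
      proof (cases "u k \<le> u k0")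
        case True
        show ?thesis
          by (rule layer_window[of m "u k" "u k0" "\<beta> k" "\<beta> k0"])
             (use True bb w mu[of k] ub[OF kS] ub[OF k0(1)] pos ab[OF kS] ab[OF k0(1)] ell[of k] ell[of k0] in auto)
      next
        case False
        have "\<bar>\<alpha> k0 - \<alpha> k\<bar> \<le> 2"
          by (rule layer_window[of m "u k0" "u k" "\<beta> k0" "\<beta> k"])
             (use False bb w mu[of k0] ub[OF kS] ub[OF k0(1)] pos ab[OF kS] ab[OF k0(1)] ell[of k] ell[of k0] in auto)
        then show ?thesis by linarith
      qed
      then show ?thesis using pos(1)[of k] pos(1)[of k0] by (auto simp: a_def)
    qed
    have a0: "0 \<le> a" by (simp add: a_def)
    have card: "real (card {k\<in>S. jj k = j}) \<le> 36 * D * ((1 + a) + (1 + real j)) / sqrt ((1 + a) * (1 + real j))"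
      unfolding D_def
    proof (rule card_separated_parabolic_box[OF S(2) _ w(1) a0])
      show "separated d {k \<in> S. jj k = j}" using S(3) by (rule separated_subset) auto
      show "a \<le> norm z - Re (z * w) \<and> norm z - Re (z * w) \<le> a + 4" if "z \<in> {k\<in>S. jj k = j}" for z
        using win[OF that] by (simp add: \<alpha>_def)
      show "real j \<le> norm z + Re (z * w) \<and> norm z + Re (z * w) \<le> real j + 1" if "z \<in> {k\<in>S. jj k = j}" for z
        using jb[of z] that by (simp add: \<beta>_def)
    qed simp
    have h: "(1 + h) / 10 \<le> 1 + a"
      using al[OF k0(1)] ub[OF k0(1)] a0 unfolding a_def h_def by (auto simp: max_def split: if_splits)
    have "(\<Sum>k\<in>{k\<in>S. jj k = j}. 1 / (1 + norm k)) \<le> real (card {k\<in>S. jj k = j}) * (2 / ((1 + a) + (1 + real j)))"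
    proof (rule sum_bounded_above)
      fix k assume k: "k \<in> {k\<in>S. jj k = j}"
      have "((1 + a) + (1 + real j)) / 2 \<le> 1 + norm k" using win[OF k] jb[of k] k by (simp add: nk field_simps)
      then show "1 / (1 + norm k) \<le> 2 / ((1 + a) + (1 + real j))"
        using a0 by (simp add: field_simps)
    qed
    also have "\<dots> \<le> 36 * D * ((1 + a) + (1 + real j)) / sqrt ((1 + a) * (1 + real j)) * (2 / ((1 + a) + (1 + real j)))"
      using card a0 by (intro mult_right_mono) auto
    also have "\<dots> = 72 * D / sqrt (1 + a) * (1 / sqrt (1 + real j))"
    proof -
      have "36 * D * t / s * (2 / t) = 72 * D / s" if "t > 0" for s t :: real using that by simp
      moreover have "(1 + a) + (1 + real j) > 0" using a0 by simp
      ultimately show ?thesis by (simp only: real_sqrt_mult) simp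
    qed
    also have "\<dots> \<le> 288 * D / sqrt (1 + h) * (1 / sqrt (1 + real j))"
    proof (rule mult_right_mono)
      have "1 + h \<le> 16 * (1 + a)" using h a0 by simp
      then have "sqrt (1 + h) \<le> sqrt (16 * (1 + a))" by (rule real_sqrt_le_mono)
      then have "sqrt (1 + h) \<le> 4 * sqrt (1 + a)" unfolding real_sqrt_mult by simp
      moreover have "0 < sqrt (1 + h)" "0 < sqrt (1 + a)" using a0 by (auto simp: h_def)
      moreover have "0 \<le> D" by (simp add: D_def)
      ultimately have "72 * D * sqrt (1 + h) \<le> 72 * D * (4 * sqrt (1 + a))"
        by (intro mult_left_mono) auto
      then show "72 * D / sqrt (1 + a) \<le> 288 * D / sqrt (1 + h)"
        using \<open>0 < sqrt (1 + h)\<close> \<open>0 < sqrt (1 + a)\<close> by (simp add: field_simps)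
    qed simp
    finally show ?thesis .
  qed
  have hD: "0 \<le> h" "0 \<le> D" by (auto simp: h_def D_def)
  have "(\<Sum>k\<in>S. 1 / (1 + norm k)) = (\<Sum>j\<in>{..N}. \<Sum>k\<in>{k\<in>S. jj k = j}. 1 / (1 + norm k))"
    by (rule sum.group[symmetric, OF S(1) _ jN]) simp
  also have "\<dots> \<le> (\<Sum>j\<le>N. 288 * D / sqrt (1 + h) * (1 / sqrt (1 + real j)))"
    by (intro sum_mono inner)
  also have "\<dots> = 288 * D / sqrt (1 + h) * (\<Sum>j\<le>N. 1 / sqrt (1 + real j))"
    by (simp add: sum_distrib_left)
  also have "\<dots> \<le> 288 * D / sqrt (1 + h) * (3 * sqrt (1 + \<tau>))"
  proof (rule mult_left_mono)
    have "real N \<le> \<tau> + 1" using \<tau> by (simp add: N_def)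
    then have "2 * sqrt (1 + real N) \<le> sqrt (9 * (1 + \<tau>))"
      using \<tau> by (intro real_le_rsqrt) (simp add: power_mult_distrib)
    then show "(\<Sum>j\<le>N. 1 / sqrt (1 + real j)) \<le> 3 * sqrt (1 + \<tau>)"
      using sum_inverse_sqrt_le[of N] unfolding real_sqrt_mult by simp
    show "0 \<le> 288 * D / sqrt (1 + h)" using hD by simp
  qed
  also have "\<dots> = 864 * D * sqrt ((1 + \<tau>) / (1 + h))" by (simp add: real_sqrt_divide)
  finally show ?thesis by (simp add: D_def h_def)
qed

text \<open>
  The invariant measure \<open>dk / \<bar>k\<bar>\<close> of the light cone convolved with itself has the density
  \<open>const / sqrt (\<tau>\<^sup>2 - \<bar>n\<bar>\<^sup>2)\<close> by Lorentz invariance, and this is the corresponding bound for separated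
  points. The reflection \<open>k \<mapsto> n - k\<close> exchanges the two foci, so each half of the ring is covered by
  \<open>half_layer_sum\<close>; the distance to the far focus is at least \<open>\<tau> / 2\<close>.
\<close>
lemma layer_sum:
  fixes S :: "complex set" and n :: complex and \<tau> d :: real
  assumes S: "finite S" "0 < d" "separated d S" and \<tau>: "0 \<le> \<tau>"
    and layer: "\<And>k. k \<in> S \<Longrightarrow> \<tau> \<le> norm k + norm (n - k) \<and> norm k + norm (n - k) < \<tau> + 1"
  shows "(\<Sum>k\<in>S. 1 / ((1 + norm k) * (1 + norm (n - k))))
     \<le> 3456 * (2 / d + 1)\<^sup>2 / sqrt ((1 + \<tau>) * (1 + max 0 (\<tau> - norm n)))"
proof -
  define m where "m = norm n"
  \<comment> \<open>Multiplication by \<open>w\<close> rotates \<open>n\<close> to the positive real axis.\<close>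
  define w where "w = (if n = 0 then 1 else cnj n / of_real m)"
  have w: "norm w = 1" "n * w = of_real m" "0 \<le> m"
    by (auto simp: w_def m_def norm_divide complex_norm_square[symmetric] power2_eq_square)
  define h where "h = max 0 (\<tau> - m)"
  have h0: "0 \<le> h" by (simp add: h_def)
  define D where "D = (2 / d + 1)\<^sup>2"
  have half: "(\<Sum>k\<in>T. 1 / ((1 + norm k) * (1 + norm (n - k)))) \<le> 1728 * D / sqrt ((1 + \<tau>) * (1 + h))"
    if T: "finite T" "separated d T" "\<And>k. k \<in> T \<Longrightarrow> \<tau> \<le> norm k + norm (n - k) \<and> norm k + norm (n - k) < \<tau> + 1"
      "\<And>k. k \<in> T \<Longrightarrow> 2 * Re (k * w) \<le> m" for T
  proof -
    have "norm k \<le> norm (n - k)" if "k \<in> T" for k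
    proof -
      have "(norm ((n - k) * w))\<^sup>2 = (m - Re (k * w))\<^sup>2 + (Im (k * w))\<^sup>2"
        by (simp add: cmod_power2 left_diff_distrib w(2) del: times_complex.simps)
      also have "\<dots> = m * (m - 2 * Re (k * w)) + (norm (k * w))\<^sup>2"
        unfolding cmod_power2 by (simp add: power2_eq_square algebra_simps)
      also have "\<dots> \<ge> (norm (k * w))\<^sup>2" using T(4)[OF that] w by simp
      finally show ?thesis using w(1) by (simp add: norm_mult)
    qed
    then have "(\<Sum>k\<in>T. 1 / ((1 + norm k) * (1 + norm (n - k)))) \<le> (\<Sum>k\<in>T. 2 / (1 + \<tau>) * (1 / (1 + norm k)))"
    proof (intro sum_mono)
      fix k assume k: "k \<in> T" and le: "\<And>k. k \<in> T \<Longrightarrow> norm k \<le> norm (n - k)"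
      have "(1 + \<tau>) / 2 \<le> 1 + norm (n - k)" using T(3)[OF k] le[OF k] by simp
      then have "1 / (1 + norm (n - k)) \<le> 2 / (1 + \<tau>)" using \<tau> by (simp add: field_simps)
      then have "1 / (1 + norm (n - k)) * (1 / (1 + norm k)) \<le> 2 / (1 + \<tau>) * (1 / (1 + norm k))"
        by (rule mult_right_mono) simp
      then show "1 / ((1 + norm k) * (1 + norm (n - k))) \<le> 2 / (1 + \<tau>) * (1 / (1 + norm k))"
        by (simp add: mult.commute)
    qed
    also have "\<dots> = 2 / (1 + \<tau>) * (\<Sum>k\<in>T. 1 / (1 + norm k))" by (simp add: sum_distrib_left)
    also have "\<dots> \<le> 2 / (1 + \<tau>) * (864 * D * sqrt ((1 + \<tau>) / (1 + h)))"
      unfolding D_def h_def using T \<tau> w S(2)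
      by (intro mult_left_mono half_layer_sum[of T d \<tau> w n m]) auto
    also have "\<dots> = 1728 * D / sqrt ((1 + \<tau>) * (1 + h))"
    proof -
      define x where "x = sqrt (1 + \<tau>)"
      define y where "y = sqrt (1 + h)"
      have x: "x > 0" "1 + \<tau> = x * x" and y: "y > 0" using \<tau> h0 by (auto simp: x_def y_def)
      have "2 / (x * x) * (864 * D * (x / y)) = 1728 * D / (x * y)" using x y by (simp add: field_simps)
      then show ?thesis unfolding real_sqrt_divide real_sqrt_mult x_def[symmetric] y_def[symmetric]
        by (simp only: x(2))
    qed
    finally show ?thesis .
  qed
  define S1 where "S1 = {k\<in>S. 2 * Re (k * w) \<le> m}"
  define S2 where "S2 = {k\<in>S. \<not> 2 * Re (k * w) \<le> m}"
  have "(\<Sum>k\<in>S. 1 / ((1 + norm k) * (1 + norm (n - k)))) =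
    (\<Sum>k\<in>S1. 1 / ((1 + norm k) * (1 + norm (n - k)))) + (\<Sum>k\<in>S2. 1 / ((1 + norm k) * (1 + norm (n - k))))"
    unfolding S1_def S2_def using S(1)
    by (subst sum.union_disjoint[symmetric]) (auto intro!: sum.cong)
  also have "(\<Sum>k\<in>S2. 1 / ((1 + norm k) * (1 + norm (n - k)))) =
      (\<Sum>k\<in>(\<lambda>k. n - k) ` S2. 1 / ((1 + norm k) * (1 + norm (n - k))))"
    by (subst sum.reindex) (auto intro: inj_onI simp: mult.commute)
  also have "\<dots> \<le> 1728 * D / sqrt ((1 + \<tau>) * (1 + h))"
  proof (rule half)
    show "finite ((\<lambda>k. n - k) ` S2)" using S(1) by (simp add: S2_def)
    show "separated d ((\<lambda>k. n - k) ` S2)"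
      using S(3) by (auto simp: separated_def S2_def norm_minus_commute)
    fix k assume "k \<in> (\<lambda>k. n - k) ` S2"
    then obtain k' where k': "k' \<in> S2" "k = n - k'" by auto
    show "\<tau> \<le> norm k + norm (n - k) \<and> norm k + norm (n - k) < \<tau> + 1"
      using layer[of k'] k' by (simp add: S2_def add.commute)
    have "Re (k * w) = m - Re (k' * w)" by (simp add: k'(2) left_diff_distrib w(2) del: times_complex.simps)
    then show "2 * Re (k * w) \<le> m" using k'(1) by (simp add: S2_def)
  qed
  also have "(\<Sum>k\<in>S1. 1 / ((1 + norm k) * (1 + norm (n - k)))) \<le> 1728 * D / sqrt ((1 + \<tau>) * (1 + h))"
    using S layer by (intro half) (auto simp: S1_def intro: separated_subset)
  finally show ?thesis by (simp add: D_def h_def m_def)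
qed


text \<open>
  A discrete Beta integral with both exponents equal to one half. In each term one of the two factors
  is at least half of their constant sum, and the other one is summed by \<open>sum_inverse_sqrt_le\<close>.
\<close>
lemma sum_inverse_sqrt_product_le:
  "(\<Sum>i\<in>{M..N}. 1 / sqrt ((1 + real (N - i)) * (1 + real (i - M)))) \<le> 6"
proof (cases "M \<le> N")
  case True
  define L where "L = N - M"
  have sq: "1 / sqrt (x * y) \<le> sqrt (2 / (real L + 2)) * (1 / sqrt x + 1 / sqrt y)"
    if "1 \<le> x" "1 \<le> y" "x + y = real L + 2" for x y :: real
  proof -
    have aux: "1 / sqrt (x * y) \<le> sqrt (2 / (real L + 2)) * (1 / sqrt y)"
      if "1 \<le> x" "1 \<le> y" "x + y = real L + 2" "y \<le> x" for x y :: real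
    proof -
      have "1 / x \<le> 2 / (real L + 2)" using that by (simp add: field_simps)
      then have "sqrt (1 / x) \<le> sqrt (2 / (real L + 2))" by (rule real_sqrt_le_mono)
      then have "sqrt (1 / x) * (1 / sqrt y) \<le> sqrt (2 / (real L + 2)) * (1 / sqrt y)"
        using that by (intro mult_right_mono) auto
      then show ?thesis by (simp add: real_sqrt_mult real_sqrt_divide)
    qed
    have p: "0 \<le> sqrt (2 / (real L + 2)) * (1 / sqrt x)" "0 \<le> sqrt (2 / (real L + 2)) * (1 / sqrt y)"
      using that by auto
    show ?thesis
    proof (cases "y \<le> x")
      case True then show ?thesis using aux[of x y] that p unfolding distrib_left by linarith
    next
      case False then show ?thesis using aux[of y x] that p unfolding distrib_left mult.commute[of y x] by linarith
    qed
  qed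
  have "(\<Sum>i\<in>{M..N}. 1 / sqrt ((1 + real (N - i)) * (1 + real (i - M))))
     \<le> (\<Sum>i\<in>{M..N}. sqrt (2 / (real L + 2)) * (1 / sqrt (1 + real (N - i)) + 1 / sqrt (1 + real (i - M))))"
    by (intro sum_mono sq) (auto simp: L_def)
  also have "\<dots> = sqrt (2 / (real L + 2)) * ((\<Sum>i\<in>{M..N}. 1 / sqrt (1 + real (N - i))) + (\<Sum>i\<in>{M..N}. 1 / sqrt (1 + real (i - M))))"
    by (simp only: sum_distrib_left sum.distrib[symmetric])
  also have "(\<Sum>i\<in>{M..N}. 1 / sqrt (1 + real (N - i))) = (\<Sum>i\<le>L. 1 / sqrt (1 + real i))"
    by (rule sum.reindex_bij_witness[of _ "\<lambda>i. N - i" "\<lambda>i. N - i"]) (use True in \<open>auto simp: L_def\<close>)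
  also have "(\<Sum>i\<in>{M..N}. 1 / sqrt (1 + real (i - M))) = (\<Sum>i\<le>L. 1 / sqrt (1 + real i))"
    by (rule sum.reindex_bij_witness[of _ "\<lambda>i. i + M" "\<lambda>i. i - M"]) (use True in \<open>auto simp: L_def\<close>)
  also have "sqrt (2 / (real L + 2)) * ((\<Sum>i\<le>L. 1 / sqrt (1 + real i)) + (\<Sum>i\<le>L. 1 / sqrt (1 + real i)))
     \<le> sqrt (2 / (real L + 2)) * (4 * sqrt (1 + real L))"
    using sum_inverse_sqrt_le[of L] by (intro mult_left_mono) auto
  also have "\<dots> = sqrt (32 * ((1 + real L) / (real L + 2)))"
  proof -
    have "sqrt 32 = 4 * sqrt (2::real)" using real_sqrt_mult[of 16 2] by simp
    then show ?thesis unfolding real_sqrt_mult real_sqrt_divide by simp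
  qed
  also have "\<dots> \<le> sqrt 36" by (rule real_sqrt_le_mono) (simp add: field_simps)
  finally show ?thesis by simp
qed simp

text \<open>
  For fixed \<open>k\<close> the pairs \<open>(l, n - k - l)\<close> lie in an elliptic ring, and \<open>layer_sum\<close> bounds their
  contribution by \<open>1 / sqrt ((1 + \<bar>n - k\<bar>) * (1 + \<tau> - u))\<close> with \<open>u = \<bar>k\<bar> + \<bar>n - k\<bar>\<close>. Grouping the \<open>k\<close> by
  the integer part \<open>j\<close> of \<open>u\<close> and applying \<open>layer_sum\<close> again to each group leaves the sum over \<open>j\<close> of
  \<open>1 / sqrt ((1 + \<tau> - j) * (1 + j - \<bar>n\<bar>))\<close>, which is bounded. The constant depends on the separation
  only.
\<close>
lemma cone_convolution_bound:
  fixes S :: "complex set" and n :: complex and \<tau> d :: real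
  assumes S: "finite S" "0 < d" "separated d S"
  shows "(\<Sum>k\<in>S. \<Sum>l\<in>{l\<in>S. n - k - l \<in> S \<and> \<tau> \<le> norm k + norm l + norm (n - k - l) \<and> norm k + norm l + norm (n - k - l) < \<tau> + 1}.
      1 / ((1 + norm k) * (1 + norm l) * (1 + norm (n - k - l)))) \<le> 30 * (3456 * (2 / d + 1)\<^sup>2)\<^sup>2"
proof -
  define D where "D = 3456 * (2 / d + 1)\<^sup>2"
  have D0: "0 \<le> D" by (simp add: D_def)
  define m where "m = norm n"
  define u where "u k = norm k + norm (n - k)" for k
  define T where "T k = {l\<in>S. n - k - l \<in> S \<and> \<tau> \<le> norm k + norm l + norm (n - k - l) \<and> norm k + norm l + norm (n - k - l) < \<tau> + 1}" for k
  define I where "I k = (\<Sum>l\<in>T k. 1 / ((1 + norm k) * (1 + norm l) * (1 + norm (n - k - l))))" for k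
  define S' where "S' = {k\<in>S. u k \<le> \<tau> + 1}"
  define M where "M = nat \<lfloor>m\<rfloor>"
  define N where "N = nat \<lfloor>\<tau> + 1\<rfloor>"
  define jj where "jj k = nat \<lfloor>u k\<rfloor>" for k
  have u0: "0 \<le> u k" "m \<le> u k" for k using norm_triangle_ineq[of k "n - k"] by (auto simp: u_def m_def)
  have jb: "real (jj k) \<le> u k" "u k < real (jj k) + 1" for k
    using u0(1)[of k] unfolding jj_def by linarith+
  have Tempty: "T k = {}" if "k \<in> S - S'" for k
  proof -
    have "l \<notin> T k" for l
      using norm_triangle_ineq[of l "n - k - l"] that by (auto simp: T_def S'_def u_def)
    then show ?thesis by blast
  qed
  have I: "I k \<le> D * (sqrt 2 / ((1 + norm k) * sqrt (1 + norm (n - k)) * sqrt (1 + max 0 (\<tau> - u k))))" if k: "k \<in> S'" for k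
  proof -
    define t where "t = max 0 (\<tau> - norm k)"
    have "I k = (1 / (1 + norm k)) * (\<Sum>l\<in>T k. 1 / ((1 + norm l) * (1 + norm (n - k - l))))"
      by (simp add: I_def sum_distrib_left mult.assoc)
    also have "\<dots> \<le> (1 / (1 + norm k)) * (D / sqrt ((1 + t) * (1 + max 0 (t - norm (n - k)))))"
      unfolding D_def using S
      by (intro mult_left_mono layer_sum) (auto simp: T_def t_def intro: separated_subset)
    finally have 1: "I k \<le> (1 / (1 + norm k)) * (D / sqrt ((1 + t) * (1 + max 0 (t - norm (n - k)))))" .
    have "D / sqrt ((1 + t) * (1 + max 0 (t - norm (n - k)))) \<le> D / (sqrt ((1 + norm (n - k)) / 2) * sqrt (1 + max 0 (\<tau> - u k)))"
    proof (rule divide_left_mono[OF _ D0])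
      have "norm (n - k) \<le> t + 1" using k by (auto simp: S'_def u_def t_def)
      moreover have "0 \<le> t" by (simp add: t_def)
      ultimately have "(1 + norm (n - k)) / 2 \<le> 1 + t" by simp
      moreover have "1 + max 0 (\<tau> - u k) \<le> 1 + max 0 (t - norm (n - k))" by (auto simp: t_def u_def)
      ultimately show "sqrt ((1 + norm (n - k)) / 2) * sqrt (1 + max 0 (\<tau> - u k)) \<le> sqrt ((1 + t) * (1 + max 0 (t - norm (n - k))))"
        unfolding real_sqrt_mult by (intro mult_mono real_sqrt_le_mono) (auto simp: t_def add_nonneg_nonneg)
      have "1 + norm (n - k) > 0" using norm_ge_zero[of "n - k"] by linarith
      then show "0 < sqrt ((1 + t) * (1 + max 0 (t - norm (n - k)))) * (sqrt ((1 + norm (n - k)) / 2) * sqrt (1 + max 0 (\<tau> - u k)))"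
        by (auto intro!: mult_pos_pos simp: t_def add_pos_nonneg)
    qed
    then have "I k \<le> (1 / (1 + norm k)) * (D / (sqrt ((1 + norm (n - k)) / 2) * sqrt (1 + max 0 (\<tau> - u k))))"
      by (intro order.trans[OF 1] mult_left_mono) auto
    then show ?thesis by (simp add: real_sqrt_divide mult.assoc)
  qed
  have group: "(\<Sum>k\<in>{k\<in>S'. jj k = j}. I k) \<le> 5 * D\<^sup>2 * (1 / sqrt ((1 + real (N - j)) * (1 + real (j - M))))" if j: "j \<in> {M..N}" for j
  proof -
    define Dn where "Dn = 1 + real (N - j)"
    define Dm where "Dm = 1 + real (j - M)"
    have Dp: "0 < Dn" "0 < Dm" by (auto simp: Dn_def Dm_def)
    have NM: "real N \<le> max 0 (\<tau> + 1)" "m < real M + 1" unfolding N_def M_def m_def by (auto simp: max_def) linarith+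
    have "(\<Sum>k\<in>{k\<in>S'. jj k = j}. I k) \<le> (\<Sum>k\<in>{k\<in>S'. jj k = j}. D * (sqrt 2 * sqrt (2 * (1 + real j)) / sqrt (Dn / 3)) * (1 / ((1 + norm k) * (1 + norm (n - k)))))"
    proof (rule sum_mono)
      fix k assume k: "k \<in> {k\<in>S'. jj k = j}"
      then have kS: "k \<in> S'" and kj: "jj k = j" by auto
      define X where "X = 1 + norm (n - k)"
      have "norm (n - k) \<le> u k" by (simp add: u_def)
      then have X: "0 < X" "X \<le> 2 * (1 + real j)" using jb(2)[of k] kj by (auto simp: X_def add_pos_nonneg)
      have Z: "Dn / 3 \<le> 1 + max 0 (\<tau> - u k)"
        using NM(1) j jb[of k] kj kS by (auto simp: Dn_def S'_def max_def of_nat_diff split: if_splits)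
      have "1 / sqrt X = sqrt X / X" using X by (simp add: real_div_sqrt[of X] field_simps)
      also have "\<dots> \<le> sqrt (2 * (1 + real j)) / X" using X by (intro divide_right_mono real_sqrt_le_mono) auto
      finally have a: "1 / sqrt X \<le> sqrt (2 * (1 + real j)) / X" .
      have b: "1 / sqrt (1 + max 0 (\<tau> - u k)) \<le> 1 / sqrt (Dn / 3)"
        using Z Dp by (intro divide_left_mono real_sqrt_le_mono) auto
      have "I k \<le> D * sqrt 2 / (1 + norm k) * ((1 / sqrt X) * (1 / sqrt (1 + max 0 (\<tau> - u k))))"
        using I[OF kS] by (simp add: X_def mult.assoc)
      also have "\<dots> \<le> D * sqrt 2 / (1 + norm k) * ((sqrt (2 * (1 + real j)) / X) * (1 / sqrt (Dn / 3)))"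
        using a b D0 X Dp by (intro mult_left_mono mult_mono) auto
      finally show "I k \<le> D * (sqrt 2 * sqrt (2 * (1 + real j)) / sqrt (Dn / 3)) * (1 / ((1 + norm k) * (1 + norm (n - k))))"
        by (simp add: X_def mult.commute mult.left_commute)
    qed
    also have "\<dots> = D * (sqrt 2 * sqrt (2 * (1 + real j)) / sqrt (Dn / 3)) * (\<Sum>k\<in>{k\<in>S'. jj k = j}. 1 / ((1 + norm k) * (1 + norm (n - k))))"
      by (simp add: sum_distrib_left)
    also have "\<dots> \<le> D * (sqrt 2 * sqrt (2 * (1 + real j)) / sqrt (Dn / 3)) * (D / sqrt ((1 + real j) * (1 + max 0 (real j - norm n))))"
      unfolding D_def using S jb Dp
      by (intro mult_left_mono layer_sum) (auto simp: S'_def u_def intro: separated_subset)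
    also have "\<dots> \<le> D * (sqrt 2 * sqrt (2 * (1 + real j)) / sqrt (Dn / 3)) * (D / sqrt ((1 + real j) * (Dm / 2)))"
    proof (intro mult_left_mono divide_left_mono real_sqrt_le_mono D0)
      show "Dm / 2 \<le> 1 + max 0 (real j - norm n)" using NM(2) j by (auto simp: Dm_def m_def max_def of_nat_diff)
    qed (use Dp D0 in auto)
    also have "\<dots> = sqrt 24 * D\<^sup>2 * (1 / sqrt (Dn * Dm))"
    proof -
      have "sqrt (2 * 2 * 3 * 2) = sqrt 2 * sqrt 2 * sqrt 3 * sqrt (2::real)" by (simp only: real_sqrt_mult)
      then have s24: "sqrt 24 = sqrt 2 * sqrt 2 * sqrt 3 * sqrt (2::real)" by simp
      have "D * (s2 * (s2 * x) / (a / s3)) * (D / (x * (b / s2))) = (s2 * s2 * s3 * s2) * (D * D) * (1 / (a * b))"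
        if "x > 0" "a > 0" "b > 0" "s2 > 0" "s3 > 0" for x a b s2 s3 :: real
        using that by (simp add: field_simps)
      from this[of "sqrt (1 + real j)" "sqrt Dn" "sqrt Dm" "sqrt 2" "sqrt 3"] s24
      show ?thesis using Dp unfolding real_sqrt_mult real_sqrt_divide power2_eq_square by simp
    qed
    also have "\<dots> \<le> sqrt 25 * D\<^sup>2 * (1 / sqrt (Dn * Dm))"
      using Dp by (intro mult_right_mono real_sqrt_le_mono) auto
    finally show ?thesis by (simp add: Dn_def Dm_def)
  qed
  have jN: "jj ` S' \<subseteq> {M..N}"
  proof safe
    fix k assume "k \<in> S'"
    then have "u k \<le> \<tau> + 1" by (simp add: S'_def)
    then show "jj k \<in> {M..N}" using u0(2)[of k] unfolding jj_def M_def N_def atLeastAtMost_iff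
      by (intro conjI nat_mono floor_mono)
  qed
  have "(\<Sum>k\<in>S. I k) = (\<Sum>k\<in>S'. I k)"
    by (rule sum.mono_neutral_right) (use S Tempty in \<open>auto simp: S'_def I_def\<close>)
  also have "\<dots> = (\<Sum>j\<in>{M..N}. \<Sum>k\<in>{k\<in>S'. jj k = j}. I k)"
    by (rule sum.group[symmetric, OF _ _ jN]) (use S in \<open>auto simp: S'_def\<close>)
  also have "\<dots> \<le> (\<Sum>j\<in>{M..N}. 5 * D\<^sup>2 * (1 / sqrt ((1 + real (N - j)) * (1 + real (j - M)))))"
    by (intro sum_mono group)
  also have "\<dots> = 5 * D\<^sup>2 * (\<Sum>j\<in>{M..N}. 1 / sqrt ((1 + real (N - j)) * (1 + real (j - M))))"
    by (simp only: sum_distrib_left)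
  also have "\<dots> \<le> 5 * D\<^sup>2 * 6" by (intro mult_left_mono sum_inverse_sqrt_product_le) simp
  finally show ?thesis by (simp add: I_def T_def D_def)
qed

lemma sum_inverse_one_plus_square_int: "finite J \<Longrightarrow> (\<Sum>j\<in>J. 1 / (1 + (real_of_int j)\<^sup>2)) \<le> 5"
proof -
  assume J: "finite J"
  have one: "(\<Sum>j\<in>{1..N}. 1 / (1 + (real j)\<^sup>2)) \<le> 2 - 2 / (real N + 1)" for N
  proof (induction N)
    case (Suc N)
    define x where "x = real N"
    have "1 / (1 + (x + 1)\<^sup>2) \<le> 2 / ((x + 1) * (x + 2))"
      by (simp add: x_def divide_simps power2_eq_square algebra_simps)
    also have "\<dots> = 2 / (x + 1) - 2 / (x + 2)" by (simp add: x_def field_simps)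
    finally show ?case using Suc by (simp add: x_def add.commute)
  qed simp
  obtain N where N: "\<And>j. j \<in> J \<Longrightarrow> \<bar>j\<bar> \<le> int N"
  proof -
    have "\<bar>j\<bar> \<le> int (\<Sum>j\<in>J. nat \<bar>j\<bar>)" if "j \<in> J" for j
      using member_le_sum[of j J "\<lambda>j. nat \<bar>j\<bar>"] that J by linarith
    then show ?thesis using that by blast
  qed
  have sub: "J \<subseteq> {0} \<union> int ` {1..N} \<union> (\<lambda>i. - int i) ` {1..N}"
  proof
    fix j assume "j \<in> J"
    then have b: "\<bar>j\<bar> \<le> int N" by (rule N)
    have "j = 0 \<or> j = int (nat j) \<and> nat j \<in> {1..N} \<or> j = - int (nat (- j)) \<and> nat (- j) \<in> {1..N}"
      using b by auto
    then show "j \<in> {0} \<union> int ` {1..N} \<union> (\<lambda>i. - int i) ` {1..N}" by blast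
  qed
  let ?f = "\<lambda>j. 1 / (1 + (real_of_int j)\<^sup>2)"
  have "sum ?f J \<le> sum ?f ({0} \<union> int ` {1..N} \<union> (\<lambda>i. - int i) ` {1..N})"
    by (rule sum_mono2[OF _ sub]) auto
  also have "\<dots> \<le> sum ?f ({0} \<union> int ` {1..N}) + sum ?f ((\<lambda>i. - int i) ` {1..N})"
    by (subst sum_Un) (auto intro!: sum_nonneg)
  also have "sum ?f ({0} \<union> int ` {1..N}) \<le> sum ?f {0} + sum ?f (int ` {1..N})"
    by (subst sum_Un) (auto intro!: sum_nonneg)
  also have "sum ?f (int ` {1..N}) = (\<Sum>j\<in>{1..N}. 1 / (1 + (real j)\<^sup>2))"
    by (subst sum.reindex) auto
  also have "sum ?f ((\<lambda>i. - int i) ` {1..N}) = (\<Sum>j\<in>{1..N}. 1 / (1 + (real j)\<^sup>2))"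
    by (subst sum.reindex) (auto intro: inj_onI)
  finally have "sum ?f J \<le> 1 + (\<Sum>j\<in>{1..N}. 1 / (1 + (real j)\<^sup>2)) + (\<Sum>j\<in>{1..N}. 1 / (1 + (real j)\<^sup>2))"
    by simp
  moreover have "0 \<le> 2 / (real N + 1)" by simp
  ultimately show "sum ?f J \<le> 5" using one[of N] by linarith
qed


text \<open>
  The Schur test. Write \<open>\<omega>\<close> for the product of the \<open>1 + \<bar>k\<bar>\<close> over a triple. By the inequality between
  arithmetic and geometric mean \<open>b \<kappa> * b \<mu>\<close> is at most the mean of \<open>(b \<kappa>)\<^sup>2 * \<omega> \<kappa> / \<omega> \<mu>\<close> and its
  mirror image, and the sum of \<open>1 / \<omega> \<mu>\<close> over the \<open>\<mu>\<close> with a given sum, damped away from a given total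
  length, is bounded by \<open>cone_convolution_bound\<close> on unit windows. The weight \<open>\<omega>\<close> factorizes, which makes
  the right hand side a cube.
\<close>
lemma cone_sextuple_sum:
  fixes S :: "complex set" and c :: "complex \<Rightarrow> real" and d :: real
  assumes S: "finite S" "0 < d" "separated d S" and c: "\<And>k. 0 \<le> c k"
  defines "s \<equiv> \<lambda>(k::complex, l::complex, m::complex). k + l + m"
    and "\<tau> \<equiv> \<lambda>(k::complex, l::complex, m::complex). norm k + norm l + norm m"
    and "b \<equiv> \<lambda>(k, l, m). c k * c l * c m"
    and "X \<equiv> S \<times> S \<times> S"
  shows "(\<Sum>\<kappa>\<in>X. \<Sum>\<mu>\<in>{\<mu>\<in>X. s \<mu> = s \<kappa>}. b \<kappa> * b \<mu> / (1 + (\<tau> \<kappa> - \<tau> \<mu>)\<^sup>2))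
    \<le> 600 * (3456 * (2 / d + 1)\<^sup>2)\<^sup>2 * (\<Sum>k\<in>S. (c k)\<^sup>2 * (1 + norm k)) ^ 3"
proof -
  define D where "D = 30 * (3456 * (2 / d + 1)\<^sup>2)\<^sup>2"
  define \<omega> where "\<omega> = (\<lambda>(k::complex, l::complex, m::complex). (1 + norm k) * (1 + norm l) * (1 + norm m))"
  have ompos: "0 < \<omega> \<kappa>" for \<kappa>
    by (cases \<kappa>) (auto simp: \<omega>_def add_pos_nonneg intro!: mult_pos_pos)
  have bpos: "0 \<le> b \<kappa>" for \<kappa> using c by (cases \<kappa>) (auto simp: b_def)
  have finX: "finite X" using S by (simp add: X_def)
  have window: "(\<Sum>\<mu>\<in>{\<mu>\<in>X. s \<mu> = n \<and> t \<le> \<tau> \<mu> \<and> \<tau> \<mu> < t + 1}. 1 / \<omega> \<mu>) \<le> D" for n t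
  proof -
    have "(\<Sum>\<mu>\<in>{\<mu>\<in>X. s \<mu> = n \<and> t \<le> \<tau> \<mu> \<and> \<tau> \<mu> < t + 1}. 1 / \<omega> \<mu>) =
      (\<Sum>(k, l)\<in>Sigma S (\<lambda>k. {l\<in>S. n - k - l \<in> S \<and> t \<le> norm k + norm l + norm (n - k - l) \<and> norm k + norm l + norm (n - k - l) < t + 1}).
        1 / ((1 + norm k) * (1 + norm l) * (1 + norm (n - k - l))))"
      by (rule sum.reindex_bij_witness[of _ "\<lambda>(k, l). (k, l, n - k - l)" "\<lambda>(k, l, m). (k, l)"])
         (auto simp: s_def \<tau>_def \<omega>_def X_def)
    also have "\<dots> = (\<Sum>k\<in>S. \<Sum>l\<in>{l\<in>S. n - k - l \<in> S \<and> t \<le> norm k + norm l + norm (n - k - l) \<and> norm k + norm l + norm (n - k - l) < t + 1}.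
        1 / ((1 + norm k) * (1 + norm l) * (1 + norm (n - k - l))))"
      using S by (subst sum.Sigma) auto
    also have "\<dots> \<le> D" unfolding D_def by (rule cone_convolution_bound[OF S])
    finally show ?thesis .
  qed
  have row: "(\<Sum>\<mu>\<in>{\<mu>\<in>X. s \<mu> = s \<kappa>}. 1 / \<omega> \<mu> / (1 + (\<tau> \<kappa> - \<tau> \<mu>)\<^sup>2)) \<le> 20 * D" for \<kappa>
  proof -
    define Y where "Y = {\<mu>\<in>X. s \<mu> = s \<kappa>}"
    define j where "j \<mu> = \<lfloor>\<tau> \<mu> - \<tau> \<kappa>\<rfloor>" for \<mu>
    have finY: "finite Y" using finX by (simp add: Y_def)
    have "(\<Sum>\<mu>\<in>Y. 1 / \<omega> \<mu> / (1 + (\<tau> \<kappa> - \<tau> \<mu>)\<^sup>2)) = (\<Sum>i\<in>j ` Y. \<Sum>\<mu>\<in>{\<mu>\<in>Y. j \<mu> = i}. 1 / \<omega> \<mu> / (1 + (\<tau> \<kappa> - \<tau> \<mu>)\<^sup>2))"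
      using finY by (rule sum.image_gen)
    also have "\<dots> \<le> (\<Sum>i\<in>j ` Y. 4 * D * (1 / (1 + (real_of_int i)\<^sup>2)))"
    proof (rule sum_mono)
      fix i assume "i \<in> j ` Y"
      have "(\<Sum>\<mu>\<in>{\<mu>\<in>Y. j \<mu> = i}. 1 / \<omega> \<mu> / (1 + (\<tau> \<kappa> - \<tau> \<mu>)\<^sup>2)) \<le> (\<Sum>\<mu>\<in>{\<mu>\<in>Y. j \<mu> = i}. 4 / (1 + (real_of_int i)\<^sup>2) * (1 / \<omega> \<mu>))"
      proof (rule sum_mono)
        fix \<mu> assume "\<mu> \<in> {\<mu>\<in>Y. j \<mu> = i}"
        then have t: "real_of_int i \<le> \<tau> \<mu> - \<tau> \<kappa>" "\<tau> \<mu> - \<tau> \<kappa> < real_of_int i + 1" by (auto simp: j_def)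
        have "(real_of_int i)\<^sup>2 \<le> (2 * \<bar>\<tau> \<mu> - \<tau> \<kappa>\<bar>)\<^sup>2" if "i \<noteq> -1"
        proof (rule power2_le_iff_abs_le[THEN iffD2])
          show "\<bar>real_of_int i\<bar> \<le> 2 * \<bar>\<tau> \<mu> - \<tau> \<kappa>\<bar>"
          proof (cases "i \<ge> 0")
            case True then show ?thesis using t by simp
          next
            case False
            then have "real_of_int i \<le> -2" using that by linarith
            then show ?thesis using t by (auto simp: abs_if)
          qed
        qed simp
        then have "1 + (real_of_int i)\<^sup>2 \<le> 4 * (1 + (\<tau> \<kappa> - \<tau> \<mu>)\<^sup>2)"
          by (cases "i = -1") (auto simp: power_mult_distrib power2_commute)
        then have "1 / (1 + (\<tau> \<kappa> - \<tau> \<mu>)\<^sup>2) \<le> 4 / (1 + (real_of_int i)\<^sup>2)"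
          by (simp add: divide_simps add_pos_nonneg add_nonneg_eq_0_iff)
        then have "1 / \<omega> \<mu> * (1 / (1 + (\<tau> \<kappa> - \<tau> \<mu>)\<^sup>2)) \<le> 1 / \<omega> \<mu> * (4 / (1 + (real_of_int i)\<^sup>2))"
          using ompos[of \<mu>] by (intro mult_left_mono) auto
        then show "1 / \<omega> \<mu> / (1 + (\<tau> \<kappa> - \<tau> \<mu>)\<^sup>2) \<le> 4 / (1 + (real_of_int i)\<^sup>2) * (1 / \<omega> \<mu>)"
          by (simp add: mult.commute)
      qed
      also have "\<dots> = 4 / (1 + (real_of_int i)\<^sup>2) * (\<Sum>\<mu>\<in>{\<mu>\<in>Y. j \<mu> = i}. 1 / \<omega> \<mu>)"
        by (simp only: sum_distrib_left)
      also have "(\<Sum>\<mu>\<in>{\<mu>\<in>Y. j \<mu> = i}. 1 / \<omega> \<mu>) = (\<Sum>\<mu>\<in>{\<mu>\<in>X. s \<mu> = s \<kappa> \<and> \<tau> \<kappa> + of_int i \<le> \<tau> \<mu> \<and> \<tau> \<mu> < \<tau> \<kappa> + of_int i + 1}. 1 / \<omega> \<mu>)"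
        unfolding Y_def j_def floor_eq_iff by (rule sum.cong) (auto simp: algebra_simps)
      also have "4 / (1 + (real_of_int i)\<^sup>2) * \<dots> \<le> 4 / (1 + (real_of_int i)\<^sup>2) * D"
        by (intro mult_left_mono window) (simp add: add_nonneg_nonneg)
      finally show "(\<Sum>\<mu>\<in>{\<mu>\<in>Y. j \<mu> = i}. 1 / \<omega> \<mu> / (1 + (\<tau> \<kappa> - \<tau> \<mu>)\<^sup>2)) \<le> 4 * D * (1 / (1 + (real_of_int i)\<^sup>2))"
        by simp
    qed
    also have "\<dots> = 4 * D * (\<Sum>i\<in>j ` Y. 1 / (1 + (real_of_int i)\<^sup>2))" by (simp only: sum_distrib_left)
    also have "\<dots> \<le> 4 * D * 5"
      using finY by (intro mult_left_mono sum_inverse_one_plus_square_int) (auto simp: D_def)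
    finally show ?thesis by (simp add: Y_def)
  qed
  define w where "w \<kappa> \<mu> = (b \<kappa>)\<^sup>2 * \<omega> \<kappa> * (1 / \<omega> \<mu> / (1 + (\<tau> \<kappa> - \<tau> \<mu>)\<^sup>2))" for \<kappa> \<mu>
  have amgm: "b \<kappa> * b \<mu> / (1 + (\<tau> \<kappa> - \<tau> \<mu>)\<^sup>2) \<le> (w \<kappa> \<mu> + w \<mu> \<kappa>) / 2" for \<kappa> \<mu>
  proof -
    define y where "y = \<omega> \<kappa> / \<omega> \<mu>"
    have y: "y > 0" using ompos by (simp add: y_def)
    have "0 \<le> (b \<kappa> * y - b \<mu>)\<^sup>2 / y" using y by simp
    also have "\<dots> = (b \<kappa>)\<^sup>2 * y + (b \<mu>)\<^sup>2 / y - 2 * (b \<kappa> * b \<mu>)"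
      using y by (simp add: power2_eq_square field_simps)
    finally have "b \<kappa> * b \<mu> \<le> ((b \<kappa>)\<^sup>2 * y + (b \<mu>)\<^sup>2 / y) / 2" by simp
    then have "b \<kappa> * b \<mu> / (1 + (\<tau> \<kappa> - \<tau> \<mu>)\<^sup>2) \<le> ((b \<kappa>)\<^sup>2 * y + (b \<mu>)\<^sup>2 / y) / 2 / (1 + (\<tau> \<kappa> - \<tau> \<mu>)\<^sup>2)"
      by (rule divide_right_mono) (simp add: add_nonneg_nonneg)
    also have "\<dots> = (w \<kappa> \<mu> + w \<mu> \<kappa>) / 2"
      by (simp add: w_def y_def power2_commute[of "\<tau> \<mu>"] add_divide_distrib mult_ac)
    finally show ?thesis .
  qed
  have swap: "(\<Sum>\<kappa>\<in>X. \<Sum>\<mu>\<in>{\<mu>\<in>X. s \<mu> = s \<kappa>}. w \<mu> \<kappa>) = (\<Sum>\<kappa>\<in>X. \<Sum>\<mu>\<in>{\<mu>\<in>X. s \<mu> = s \<kappa>}. w \<kappa> \<mu>)"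
    using finX by (subst sum.swap_restrict) (auto intro!: sum.cong)
  have "(\<Sum>\<kappa>\<in>X. \<Sum>\<mu>\<in>{\<mu>\<in>X. s \<mu> = s \<kappa>}. b \<kappa> * b \<mu> / (1 + (\<tau> \<kappa> - \<tau> \<mu>)\<^sup>2))
    \<le> (\<Sum>\<kappa>\<in>X. \<Sum>\<mu>\<in>{\<mu>\<in>X. s \<mu> = s \<kappa>}. (w \<kappa> \<mu> + w \<mu> \<kappa>) / 2)"
    by (intro sum_mono amgm)
  also have "\<dots> = ((\<Sum>\<kappa>\<in>X. \<Sum>\<mu>\<in>{\<mu>\<in>X. s \<mu> = s \<kappa>}. w \<kappa> \<mu>) + (\<Sum>\<kappa>\<in>X. \<Sum>\<mu>\<in>{\<mu>\<in>X. s \<mu> = s \<kappa>}. w \<mu> \<kappa>)) / 2"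
    by (simp only: sum.distrib sum_divide_distrib[symmetric])
  also have "\<dots> = (\<Sum>\<kappa>\<in>X. \<Sum>\<mu>\<in>{\<mu>\<in>X. s \<mu> = s \<kappa>}. w \<kappa> \<mu>)" unfolding swap by simp
  also have "\<dots> = (\<Sum>\<kappa>\<in>X. (b \<kappa>)\<^sup>2 * \<omega> \<kappa> * (\<Sum>\<mu>\<in>{\<mu>\<in>X. s \<mu> = s \<kappa>}. 1 / \<omega> \<mu> / (1 + (\<tau> \<kappa> - \<tau> \<mu>)\<^sup>2)))"
    unfolding w_def by (simp only: sum_distrib_left)
  also have "\<dots> \<le> (\<Sum>\<kappa>\<in>X. (b \<kappa>)\<^sup>2 * \<omega> \<kappa> * (20 * D))"
    using ompos by (intro sum_mono mult_left_mono row) (simp add: less_imp_le)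
  also have "\<dots> = 20 * D * (\<Sum>\<kappa>\<in>X. (b \<kappa>)\<^sup>2 * \<omega> \<kappa>)" by (simp add: sum_distrib_left mult.commute)
  also have "(\<Sum>\<kappa>\<in>X. (b \<kappa>)\<^sup>2 * \<omega> \<kappa>) = (\<Sum>k\<in>S. \<Sum>l\<in>S. \<Sum>m\<in>S. (c k)\<^sup>2 * (1 + norm k) * ((c l)\<^sup>2 * (1 + norm l) * ((c m)\<^sup>2 * (1 + norm m))))"
    unfolding X_def sum.cartesian_product
    by (intro sum.cong) (auto simp: b_def \<omega>_def power_mult_distrib)
  also have "\<dots> = (\<Sum>k\<in>S. (c k)\<^sup>2 * (1 + norm k)) ^ 3"
  proof -
    have "(\<Sum>k\<in>S. \<Sum>l\<in>S. \<Sum>m\<in>S. f k * (f l * f m)) = (\<Sum>k\<in>S. f k) ^ 3" for f :: "complex \<Rightarrow> real"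
      by (simp only: sum_distrib_left[symmetric] sum_distrib_right[symmetric] power3_eq_cube mult.assoc)
    from this[of "\<lambda>k. (c k)\<^sup>2 * (1 + norm k)"] show ?thesis .
  qed
  finally show ?thesis by (simp add: D_def)
qed

section \<open>Characters on the torus and space-time means\<close>

text \<open>
  Identifies \<open>\<real> \<times> \<real>\<close> with \<open>\<real>\<^sup>2\<close>, so that Fubini's theorem for product measures becomes available.
\<close>
definition vec2 :: "real \<times> real \<Rightarrow> real^2" where
  "vec2 p = (\<chi> i. if i = 1 then fst p else snd p)"

lemma vec2_nth [simp]: "vec2 p $ 1 = fst p" "vec2 p $ 2 = snd p"
  by (simp_all add: vec2_def)

lemma Basis_real2: "(Basis :: (real^2) set) = {axis 1 1, axis 2 1}"
  by (auto simp: Basis_vec_def UNIV_2)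

lemma axis_real2_neq: "axis 1 (1::real) \<noteq> (axis 2 1 :: real^2)"
  by (simp add: axis_eq_axis)

lemma inner_real2: "x \<bullet> y = x $ 1 * y $ 1 + x $ 2 * y $ (2::2)" for x y :: "real^2"
  by (simp add: inner_vec_def sum_2)

lemma continuous_on_vec2 [continuous_intros]: "continuous_on UNIV vec2"
  unfolding vec2_def
proof (rule continuous_on_vec_lambda)
  show "continuous_on UNIV (\<lambda>p::real \<times> real. if i = 1 then fst p else snd p)" for i :: 2
    by (cases "i = 1") (auto intro!: continuous_intros)
qed

lemma lborel_vec2: "(lborel :: (real^2) measure) = distr lborel borel vec2"
proof (rule lborel_eqI)
  have m: "vec2 \<in> lborel \<rightarrow>\<^sub>M borel" using borel_measurable_continuous_onI[OF continuous_on_vec2] by simp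
  fix l u :: "real^2" assume le: "\<And>b. b \<in> Basis \<Longrightarrow> l \<bullet> b \<le> u \<bullet> b"
  have l: "l $ 1 \<le> u $ 1" "l $ 2 \<le> u $ 2" using le[of "axis 1 1"] le[of "axis 2 1"] by (auto simp: Basis_real2 inner_axis)
  have "emeasure (distr lborel borel vec2) (box l u) = emeasure lborel (vec2 -` box l u)"
    using m by (subst emeasure_distr) auto
  also have "vec2 -` box l u = box (l $ 1) (u $ 1) \<times> box (l $ 2) (u $ 2)"
    by (auto simp: mem_box Basis_real2 inner_axis)
  also have "emeasure lborel \<dots> = emeasure lborel (box (l $ 1) (u $ 1)) * emeasure lborel (box (l $ 2) (u $ 2))"
    by (subst lborel_prod[symmetric], subst lborel.emeasure_pair_measure_Times) auto
  also have "\<dots> = ennreal (\<Prod>b\<in>Basis. (u - l) \<bullet> b)"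
    using l by (simp add: Basis_real2 axis_real2_neq inner_axis ennreal_mult)
  finally show "emeasure (distr lborel borel vec2) (box l u) = ennreal (\<Prod>b\<in>Basis. (u - l) \<bullet> b)" .
qed simp

lemma measurable_vec2 [measurable]: "vec2 \<in> borel_measurable borel"
  by (rule borel_measurable_continuous_onI[OF continuous_on_vec2])

lemma integral_real2_fubini:
  fixes f :: "real^2 \<Rightarrow> 'a::euclidean_space"
  assumes f: "integrable lborel f"
  shows "(\<integral>x. f x \<partial>lborel) = (\<integral>s. (\<integral>t. f (vec2 (s, t)) \<partial>lborel) \<partial>lborel)"
proof -
  have [measurable]: "f \<in> borel_measurable borel" using f by auto
  have i: "integrable lborel (\<lambda>p. f (vec2 p))"
    using f by (subst (asm) lborel_vec2) (simp add: integrable_distr_eq)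
  have "(\<integral>x. f x \<partial>lborel) = (\<integral>p. f (vec2 p) \<partial>lborel)"
    by (subst lborel_vec2) (simp add: integral_distr)
  also have "\<dots> = (\<integral>s. (\<integral>t. f (vec2 (s, t)) \<partial>lborel) \<partial>lborel)"
    using lborel_pair.integral_fst'[of "\<lambda>p. f (vec2 p)"] i by (simp add: lborel_prod)
  finally show ?thesis .
qed

text \<open>
  The character \<open>x \<mapsto> exp (2\<pi>i k \<bullet> x)\<close>.
\<close>
definition echar :: "real^2 \<Rightarrow> real^2 \<Rightarrow> complex" where
  "echar k x = cis (2 * pi * (k \<bullet> x))"

lemma echar_simps: "norm (echar k x) = 1" "echar 0 x = 1" "echar (k + l) x = echar k x * echar l x"
  "echar (- k) x = cnj (echar k x)" "echar (k - l) x = echar k x * cnj (echar l x)"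
  "echar k (x + y) = echar k x * echar k y" "echar k (- x) = cnj (echar k x)"
  by (auto simp: echar_def cis_mult cis_cnj inner_simps algebra_simps)

lemma continuous_on_echar [continuous_intros]:
  "continuous_on A f \<Longrightarrow> continuous_on A (\<lambda>x. echar k (f x))"
  unfolding echar_def by (intro continuous_intros)

lemma measurable_echar [measurable]: "echar k \<in> borel_measurable borel"
  by (intro borel_measurable_continuous_onI continuous_intros)

lemma measurable_cnj_echar [measurable]: "(\<lambda>x. cnj (echar k x)) \<in> borel_measurable borel"
  by (intro borel_measurable_continuous_onI continuous_intros)

lemma int_lattice_group: "k \<in> int_lattice \<Longrightarrow> l \<in> int_lattice \<Longrightarrow> k + l \<in> int_lattice"
  "k \<in> int_lattice \<Longrightarrow> l \<in> int_lattice \<Longrightarrow> k - l \<in> int_lattice"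
  "k \<in> int_lattice \<Longrightarrow> - k \<in> int_lattice" "0 \<in> int_lattice"
  by (auto simp: int_lattice_def)

lemma echar_lattice: "k \<in> int_lattice \<Longrightarrow> l \<in> int_lattice \<Longrightarrow> echar k l = 1"
proof -
  assume "k \<in> int_lattice" "l \<in> int_lattice"
  then have "k \<bullet> l \<in> \<int>" by (auto simp: int_lattice_def inner_real2)
  then obtain m where "k \<bullet> l = of_int m" by (auto elim: Ints_cases)
  then show ?thesis by (simp add: echar_def cis_multiple_2pi[of "of_int m"])
qed

lemma torus_domain_subset: "torus_domain \<subseteq> cbox 0 1"
  by (auto simp: torus_domain_def mem_box_cart less_imp_le)

lemma torus_measurable [measurable]: "torus_domain \<in> sets borel"
proof -
  have "torus_domain = {x. 0 \<le> x $ 1} \<inter> {x. 0 \<le> x $ 2} \<inter> {x. x $ 1 < 1} \<inter> {x::real^2. x $ 2 < 1}"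
    by (auto simp: torus_domain_def forall_2)
  also have "\<dots> \<in> sets borel"
    by (intro sets.Int borel_closed borel_open closed_Collect_le open_Collect_less continuous_intros)
  finally show ?thesis .
qed

lemma emeasure_torus_finite: "emeasure lborel torus_domain < \<infinity>"
  using emeasure_mono[OF torus_domain_subset, of lborel] emeasure_lborel_cbox_finite[of "0::real^2" 1]
  by (auto simp: order.strict_trans1)

lemma integral_cis_period:
  fixes n :: real assumes "n \<in> \<int>"
  shows "(\<integral>t. indicator {0..<1} t *\<^sub>R cis (2 * pi * n * t) \<partial>lborel) = (if n = 0 then 1 else 0)"
proof -
  have [measurable]: "(\<lambda>t. cis (2 * pi * n * t)) \<in> borel_measurable borel"
    by (intro borel_measurable_continuous_onI continuous_intros)
  have "(\<integral>t. indicator {0..<1} t *\<^sub>R cis (2 * pi * n * t) \<partial>lborel) = (\<integral>t. indicator {0..1} t *\<^sub>R cis (2 * pi * n * t) \<partial>lborel)"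
  proof (rule integral_cong_AE)
    show "AE t in lborel. indicator {0..<1} t *\<^sub>R cis (2 * pi * n * t) = indicator {0..1} t *\<^sub>R cis (2 * pi * n * t)"
      using AE_lborel_singleton[of "1::real"] by eventually_elim (auto simp: indicator_def)
  qed measurable
  also have "\<dots> = (if n = 0 then 1 else 0)"
  proof (cases "n = 0")
    case True then show ?thesis by simp
  next
    case False
    define F where "F t = cis (2 * pi * n * t) / (\<i> * of_real (2 * pi * n))" for t :: real
    have "(\<integral>t. indicator {0..1} t *\<^sub>R cis (2 * pi * n * t) \<partial>lborel) = F 1 - F 0"
    proof (rule integral_FTC_atLeastAtMost)
      fix x :: real
      have e: "cis (2 * pi * n * t) = exp (of_real t * (\<i> * of_real (2 * pi * n)))" for t
        by (simp add: cis_conv_exp mult_ac)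
      show "(F has_vector_derivative cis (2 * pi * n * x)) (at x within {0..1})"
        unfolding F_def e using False
        by (auto intro!: derivative_eq_intros has_vector_derivative_real_field simp: field_simps)
    qed (auto intro!: continuous_intros)
    also have "\<dots> = 0" using cis_multiple_2pi[OF assms] by (simp add: F_def)
    finally show ?thesis using False by simp
  qed
  finally show ?thesis .
qed

lemma integrable_torus:
  fixes f :: "real^2 \<Rightarrow> 'a::euclidean_space"
  assumes [measurable]: "f \<in> borel_measurable borel" and "\<And>x. x \<in> torus_domain \<Longrightarrow> norm (f x) \<le> B"
  shows "integrable lborel (\<lambda>x. indicator torus_domain x *\<^sub>R f x)"
  using assms emeasure_torus_finite
  by (intro integrableI_bounded_set_indicator[where B=B]) auto

lemma integral_torus_echar:
  assumes k: "k \<in> int_lattice"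
  shows "(\<integral>x. indicator torus_domain x *\<^sub>R echar k x \<partial>lborel) = (if k = 0 then 1 else 0)"
proof -
  have "(\<integral>x. indicator torus_domain x *\<^sub>R echar k x \<partial>lborel) = (\<integral>s. (\<integral>t. indicator torus_domain (vec2 (s, t)) *\<^sub>R echar k (vec2 (s, t)) \<partial>lborel) \<partial>lborel)"
    by (rule integral_real2_fubini, rule integrable_torus[where B=1]) (auto simp: echar_simps)
  also have "\<dots> = (\<integral>s. (\<integral>t. (indicator {0..<1} s *\<^sub>R cis (2 * pi * k $ 1 * s)) * (indicator {0..<1} t *\<^sub>R cis (2 * pi * k $ 2 * t)) \<partial>lborel) \<partial>lborel)"
    by (intro Bochner_Integration.integral_cong refl)
       (auto simp: torus_domain_def forall_2 echar_def inner_real2 cis_mult algebra_simps indicator_def)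
  also have "\<dots> = (\<integral>s. (indicator {0..<1} s *\<^sub>R cis (2 * pi * k $ 1 * s)) \<partial>lborel) * (\<integral>t. (indicator {0..<1} t *\<^sub>R cis (2 * pi * k $ 2 * t)) \<partial>lborel)"
    by (simp only: integral_mult_left_zero integral_mult_right_zero)
  also have "\<dots> = (if k = 0 then 1 else 0)"
    using k by (subst (1 2) integral_cis_period) (auto simp: int_lattice_def vec_eq_iff forall_2)
  finally show ?thesis .
qed


text \<open>
  The weight \<open>1 - (t - c)\<^sup>2\<close> vanishes at both ends of the interval, so two integrations by parts are
  possible without a boundary term of first order. This gives decay of order \<open>\<theta> powr (-2)\<close>, which is
  summable over unit windows. The primitive is written down explicitly as \<open>F\<close>.
\<close>
lemma norm_integral_parabola_cis:
  fixes \<theta> c :: real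
  shows "norm (\<integral>t. indicator {c-1..c+1} t *\<^sub>R (of_real (1 - (t - c)\<^sup>2) * cis (t * \<theta>)) \<partial>lborel) \<le> 16 / (1 + \<theta>\<^sup>2)"
proof (cases "\<bar>\<theta>\<bar> \<le> 1")
  case True
  have "norm (\<integral>t. indicator {c-1..c+1} t *\<^sub>R (of_real (1 - (t - c)\<^sup>2) * cis (t * \<theta>)) \<partial>lborel) \<le> (\<integral>t. indicator {c-1..c+1} t \<partial>lborel)"
  proof (rule Bochner_Integration.integral_norm_bound_integral)
    fix t show "norm (indicator {c-1..c+1} t *\<^sub>R (of_real (1 - (t - c)\<^sup>2) * cis (t * \<theta>))) \<le> indicat_real {c-1..c+1} t"
    proof (cases "t \<in> {c-1..c+1}")
      case True
      then have "\<bar>t - c\<bar> \<le> 1" by auto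
      then have "(t - c)\<^sup>2 \<le> 1" by (simp add: abs_square_le_1)
      then show ?thesis using True by (simp add: norm_mult norm_of_real[of "1 - (t - c)\<^sup>2", simplified] del: of_real_diff of_real_power)
    qed simp
  next
    show "integrable lborel (\<lambda>t. indicator {c-1..c+1} t *\<^sub>R (of_real (1 - (t - c)\<^sup>2) * cis (t * \<theta>)))"
      by (rule borel_integrable_compact) (auto intro!: continuous_intros)
  qed simp
  also have "\<dots> = 2" by simp
  also have "\<dots> \<le> 16 / (1 + \<theta>\<^sup>2)"
  proof -
    have "\<theta>\<^sup>2 \<le> 1" using True by (simp add: abs_square_le_1)
    then show ?thesis by (simp add: field_simps add_pos_nonneg)
  qed
  finally show ?thesis .
next
  case False
  define z where "z = \<i> * of_real \<theta>"
  have z: "z \<noteq> 0" "norm z = \<bar>\<theta>\<bar>" using False by (auto simp: z_def norm_mult)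
  define F where "F t = exp (of_real t * z) * (of_real (1 - (t - c)\<^sup>2) / z + 2 * of_real (t - c) / z\<^sup>2 - 2 / z ^ 3)" for t
  have e: "cis (t * \<theta>) = exp (of_real t * z)" for t by (simp add: cis_conv_exp z_def mult_ac)
  have "(\<integral>t. indicator {c-1..c+1} t *\<^sub>R (of_real (1 - (t - c)\<^sup>2) * cis (t * \<theta>)) \<partial>lborel) = F (c + 1) - F (c - 1)"
  proof (rule integral_FTC_atLeastAtMost)
    fix x :: real
    have "((\<lambda>t. exp (t * z) * ((1 - (t - of_real c)\<^sup>2) / z + 2 * (t - of_real c) / z\<^sup>2 - 2 / z ^ 3)) has_field_derivative
        (1 - (of_real x - of_real c)\<^sup>2) * exp (of_real x * z)) (at (of_real x))"
      using z by (auto intro!: derivative_eq_intros simp: field_simps power2_eq_square power3_eq_cube)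
    then show "(F has_vector_derivative of_real (1 - (x - c)\<^sup>2) * cis (x * \<theta>)) (at x within {c-1..c+1})"
      unfolding F_def e using has_vector_derivative_real_field[of _ _ x "{c-1..c+1}"] by fastforce
  qed (auto intro!: continuous_intros)
  also have "norm \<dots> \<le> norm (F (c + 1)) + norm (F (c - 1))" by (rule norm_triangle_ineq4)
  also have "\<dots> \<le> 8 / \<theta>\<^sup>2"
  proof -
    have "norm (F t) \<le> 4 / \<theta>\<^sup>2" if t: "\<bar>t - c\<bar> = 1" for t
    proof -
      have sq: "(t - c)\<^sup>2 = 1" using t by (metis power2_abs power_one)
      have "norm (F t) = norm (2 * of_real (t - c) / z\<^sup>2 - 2 / z ^ 3)"
        unfolding F_def sq by (simp add: norm_mult z_def)
      also have "\<dots> \<le> norm (2 * of_real (t - c) / z\<^sup>2) + norm (2 / z ^ 3)" by (rule norm_triangle_ineq4)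
      also have "\<dots> = 2 / \<theta>\<^sup>2 + 2 / \<bar>\<theta>\<bar> ^ 3"
        using t by (simp add: norm_divide norm_mult norm_power z del: of_real_diff)
      also have "2 / \<bar>\<theta>\<bar> ^ 3 \<le> 2 / \<bar>\<theta>\<bar>\<^sup>2"
        using False by (intro divide_left_mono power_increasing) auto
      finally show ?thesis by simp
    qed
    from this[of "c + 1"] this[of "c - 1"] show ?thesis by simp
  qed
  also have "\<dots> \<le> 16 / (1 + \<theta>\<^sup>2)"
  proof -
    have "1 \<le> \<theta>\<^sup>2" using False by (metis abs_square_le_1 linear)
    moreover have "8 / y \<le> 16 / (1 + y)" if "1 \<le> y" for y :: real using that by (simp add: divide_simps)
    ultimately show ?thesis by blast
  qed
  finally show ?thesis .
qed

text \<open>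
  Orthogonality of the characters. The frequencies \<open>n i\<close> may coincide, hence the double sum.
\<close>
lemma torus_mean_square:
  fixes n :: "'i \<Rightarrow> real^2" and D :: "'i \<Rightarrow> complex"
  assumes I: "finite I" and n: "\<And>i. i \<in> I \<Longrightarrow> n i \<in> int_lattice"
  shows "of_real (LINT x:torus_domain|lebesgue. (norm (\<Sum>i\<in>I. D i * echar (n i) x))\<^sup>2) =
    (\<Sum>i\<in>I. \<Sum>j\<in>{j\<in>I. n j = n i}. D i * cnj (D j))"
proof -
  have "of_real (LINT x:torus_domain|lebesgue. (norm (\<Sum>i\<in>I. D i * echar (n i) x))\<^sup>2) =
     (\<integral>x. indicator torus_domain x *\<^sub>R (of_real ((norm (\<Sum>i\<in>I. D i * echar (n i) x))\<^sup>2) :: complex) \<partial>lborel)"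
    unfolding set_lebesgue_integral_def
    by (subst integral_completion) (auto simp: scaleR_conv_of_real simp flip: integral_complex_of_real)
  also have "\<dots> = (\<integral>x. (\<Sum>i\<in>I. \<Sum>j\<in>I. D i * cnj (D j) * (indicator torus_domain x *\<^sub>R echar (n i - n j) x)) \<partial>lborel)"
  proof (rule Bochner_Integration.integral_cong[OF refl])
    fix x
    have "(of_real ((norm (\<Sum>i\<in>I. D i * echar (n i) x))\<^sup>2) :: complex) = (\<Sum>i\<in>I. D i * echar (n i) x) * cnj (\<Sum>i\<in>I. D i * echar (n i) x)"
      by (rule complex_norm_square)
    also have "\<dots> = (\<Sum>i\<in>I. \<Sum>j\<in>I. D i * cnj (D j) * echar (n i - n j) x)"
      by (simp add: sum_product echar_simps mult_ac)
    finally show "indicator torus_domain x *\<^sub>R (of_real ((norm (\<Sum>i\<in>I. D i * echar (n i) x))\<^sup>2) :: complex) =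
      (\<Sum>i\<in>I. \<Sum>j\<in>I. D i * cnj (D j) * (indicator torus_domain x *\<^sub>R echar (n i - n j) x))"
      by (simp add: scaleR_sum_right)
  qed
  also have "\<dots> = (\<Sum>i\<in>I. \<Sum>j\<in>I. D i * cnj (D j) * (\<integral>x. (indicator torus_domain x *\<^sub>R echar (n i - n j) x) \<partial>lborel))"
  proof -
    have i: "integrable lborel (\<lambda>x. indicator torus_domain x *\<^sub>R echar k x)" for k
      by (rule integrable_torus[where B=1]) (auto simp: echar_simps)
    show ?thesis
      by (subst Bochner_Integration.integral_sum, (intro Bochner_Integration.integrable_sum integrable_mult_right i),
          intro sum.cong refl, subst Bochner_Integration.integral_sum, intro integrable_mult_right i,
          intro sum.cong refl integral_mult_right_zero)
  qed
  also have "\<dots> = (\<Sum>i\<in>I. \<Sum>j\<in>I. if n j = n i then D i * cnj (D j) else 0)"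
    using n by (intro sum.cong refl) (auto simp: integral_torus_echar int_lattice_group)
  also have "\<dots> = (\<Sum>i\<in>I. \<Sum>j\<in>{j\<in>I. n j = n i}. D i * cnj (D j))"
    using I by (intro sum.cong refl sum.inter_filter[symmetric])
  finally show ?thesis .
qed

text \<open>
  The mean over the torus leaves the pairs of indices with the same frequency. The indicator function of
  \<open>{R..R+1}\<close> is at most \<open>4 / 3\<close> times a parabola supported on an interval of length 2, and
  the Fourier transform of the parabola damps pairs with different \<open>\<Theta>\<close>.
\<close>
lemma spacetime_mean_square:
  fixes n :: "'i \<Rightarrow> real^2" and C :: "'i \<Rightarrow> complex" and \<Theta> :: "'i \<Rightarrow> real" and R :: real
  assumes I: "finite I" and n: "\<And>i. i \<in> I \<Longrightarrow> n i \<in> int_lattice"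
  defines "G \<equiv> \<lambda>t. LINT x:torus_domain|lebesgue. (norm (\<Sum>i\<in>I. C i * cis (t * \<Theta> i) * echar (n i) x))\<^sup>2"
  shows "continuous_on UNIV G"
    "(LINT t:{R..R+1}|lebesgue. G t) \<le> 22 * (\<Sum>i\<in>I. \<Sum>j\<in>{j\<in>I. n j = n i}. norm (C i) * norm (C j) / (1 + (\<Theta> i - \<Theta> j)\<^sup>2))"
proof -
  define Z where "Z t = (\<Sum>i\<in>I. \<Sum>j\<in>{j\<in>I. n j = n i}. C i * cnj (C j) * cis (t * (\<Theta> i - \<Theta> j)))" for t
  have GZ: "of_real (G t) = Z t" for t
    unfolding G_def Z_def by (subst torus_mean_square[OF I n])
      (auto intro!: sum.cong simp: cis_cnj cis_mult algebra_simps)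
  have "continuous_on UNIV (\<lambda>t. Re (Z t))" unfolding Z_def by (intro continuous_intros)
  then show cG: "continuous_on UNIV G" using GZ by (metis (no_types, lifting) Re_complex_of_real continuous_on_cong)
  have [measurable]: "G \<in> borel_measurable borel" using cG by (rule borel_measurable_continuous_onI)
  have G0: "0 \<le> G t" for t unfolding G_def set_lebesgue_integral_def by (rule Bochner_Integration.integral_nonneg) auto
  define c where "c = R + 1/2"
  define J where "J = {c-1..c+1}"
  have "(LINT t:{R..R+1}|lebesgue. G t) = (\<integral>t. indicator {R..R+1} t * G t \<partial>lborel)"
    unfolding set_lebesgue_integral_def by (subst integral_completion) auto
  also have "\<dots> \<le> (\<integral>t. 4 / 3 * (indicator J t *\<^sub>R ((1 - (t - c)\<^sup>2) * G t)) \<partial>lborel)"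
  proof (rule integral_mono')
    show "integrable lborel (\<lambda>t. 4 / 3 * (indicator J t *\<^sub>R ((1 - (t - c)\<^sup>2) * G t)))"
      unfolding J_def by (intro integrable_mult_right borel_integrable_compact)
        (auto intro!: continuous_intros continuous_on_subset[OF cG])
    fix t :: real
    have w: "0 \<le> 1 - (t - c)\<^sup>2" if "t \<in> J"
    proof -
      have "\<bar>t - c\<bar> \<le> 1" using that by (auto simp: J_def)
      then show ?thesis by (simp add: abs_square_le_1)
    qed
    show "0 \<le> 4 / 3 * (indicat_real J t *\<^sub>R ((1 - (t - c)\<^sup>2) * G t))"
      using w G0[of t] by (auto simp: indicator_def)
    show "indicat_real {R..R+1} t * G t \<le> 4 / 3 * (indicat_real J t *\<^sub>R ((1 - (t - c)\<^sup>2) * G t))"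
    proof (cases "t \<in> {R..R+1}")
      case True
      then have "t - c \<le> 1/2" "- (1/2) \<le> t - c" and tJ: "t \<in> J" by (auto simp: c_def J_def)
      then have a: "\<bar>t - c\<bar> \<le> 1/2" by linarith
      have "(t - c)\<^sup>2 \<le> (1/2)\<^sup>2" using a by (subst abs_le_square_iff[symmetric]) auto
      then have "1 \<le> 4 / 3 * (1 - (t - c)\<^sup>2)" by (simp add: power2_eq_square)
      then have "1 * G t \<le> 4 / 3 * (1 - (t - c)\<^sup>2) * G t" using G0 by (intro mult_right_mono) auto
      then show ?thesis using True tJ by (simp only: indicator_simps scaleR_one mult.assoc)
    next
      case False
      then show ?thesis using w G0[of t] by (auto simp: indicator_def)
    qed
  qed
  also have "\<dots> = 4 / 3 * (\<integral>t. indicator J t *\<^sub>R ((1 - (t - c)\<^sup>2) * G t) \<partial>lborel)" by simp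
  also have "(\<integral>t. indicator J t *\<^sub>R ((1 - (t - c)\<^sup>2) * G t) \<partial>lborel) \<le> norm (of_real (\<integral>t. indicator J t *\<^sub>R ((1 - (t - c)\<^sup>2) * G t) \<partial>lborel) :: complex)"
    by simp
  also have "(of_real (\<integral>t. indicator J t *\<^sub>R ((1 - (t - c)\<^sup>2) * G t) \<partial>lborel) :: complex) =
      (\<integral>t. (\<Sum>i\<in>I. \<Sum>j\<in>{j\<in>I. n j = n i}. C i * cnj (C j) * (indicator J t *\<^sub>R (of_real (1 - (t - c)\<^sup>2) * cis (t * (\<Theta> i - \<Theta> j))))) \<partial>lborel)"
    by (subst integral_complex_of_real[symmetric], rule Bochner_Integration.integral_cong[OF refl])
       (simp add: scaleR_conv_of_real GZ Z_def sum_distrib_left mult_ac)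
  also have "\<dots> = (\<Sum>i\<in>I. \<Sum>j\<in>{j\<in>I. n j = n i}. C i * cnj (C j) * (\<integral>t. (indicator J t *\<^sub>R (of_real (1 - (t - c)\<^sup>2) * cis (t * (\<Theta> i - \<Theta> j)))) \<partial>lborel))"
  proof -
    have i: "integrable lborel (\<lambda>t. indicator J t *\<^sub>R (of_real (1 - (t - c)\<^sup>2) * cis (t * \<theta>)))" for \<theta>
      unfolding J_def by (rule borel_integrable_compact) (auto intro!: continuous_intros)
    show ?thesis
      by (subst Bochner_Integration.integral_sum, (intro Bochner_Integration.integrable_sum integrable_mult_right i),
          intro sum.cong refl, subst Bochner_Integration.integral_sum, intro integrable_mult_right i,
          intro sum.cong refl integral_mult_right_zero)
  qed
  also have "norm \<dots> \<le> (\<Sum>i\<in>I. \<Sum>j\<in>{j\<in>I. n j = n i}. norm (C i) * norm (C j) * (16 / (1 + (\<Theta> i - \<Theta> j)\<^sup>2)))"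
    unfolding J_def by (intro sum_norm_le) (simp only: norm_mult complex_mod_cnj, intro mult_left_mono norm_integral_parabola_cis, simp)
  also have "\<dots> = 16 * (\<Sum>i\<in>I. \<Sum>j\<in>{j\<in>I. n j = n i}. norm (C i) * norm (C j) / (1 + (\<Theta> i - \<Theta> j)\<^sup>2))"
    by (simp add: sum_distrib_left mult_ac)
  finally have "(LINT t:{R..R+1}|lebesgue. G t) \<le> 64 / 3 * (\<Sum>i\<in>I. \<Sum>j\<in>{j\<in>I. n j = n i}. norm (C i) * norm (C j) / (1 + (\<Theta> i - \<Theta> j)\<^sup>2))"
    by simp
  also have "\<dots> \<le> 22 * (\<Sum>i\<in>I. \<Sum>j\<in>{j\<in>I. n j = n i}. norm (C i) * norm (C j) / (1 + (\<Theta> i - \<Theta> j)\<^sup>2))"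
    by (intro mult_right_mono sum_nonneg) (auto simp: add_nonneg_nonneg)
  finally show "(LINT t:{R..R+1}|lebesgue. G t) \<le> 22 * (\<Sum>i\<in>I. \<Sum>j\<in>{j\<in>I. n j = n i}. norm (C i) * norm (C j) / (1 + (\<Theta> i - \<Theta> j)\<^sup>2))" .
qed

section \<open>The Fourier transform of the disc along a line\<close>

text \<open>
  In terms of Bessel functions this is \<open>\<pi> J\<^sub>1(z) / z\<close>; it is half the Fourier transform of the unit disc
  at distance \<open>z\<close> from the origin.
\<close>
definition semicircle_ft :: "real \<Rightarrow> real" where
  "semicircle_ft z = integral {-1..1} (\<lambda>t. sqrt (1 - t\<^sup>2) * cos (z * t))"

definition semicircle_ft' :: "real \<Rightarrow> real" where
  "semicircle_ft' z = integral {-1..1} (\<lambda>t. sqrt (1 - t\<^sup>2) * (- t * sin (z * t)))"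

definition semicircle_ft'' :: "real \<Rightarrow> real" where
  "semicircle_ft'' z = integral {-1..1} (\<lambda>t. sqrt (1 - t\<^sup>2) * (- t\<^sup>2 * cos (z * t)))"

lemma semicircle_ft_derivatives:
  "(semicircle_ft has_real_derivative semicircle_ft' z) (at z)"
  "(semicircle_ft' has_real_derivative semicircle_ft'' z) (at z)"
proof -
  have "((\<lambda>z. integral (cbox (-1) 1) (\<lambda>t. sqrt (1 - t\<^sup>2) * cos (z * t))) has_real_derivative
      integral (cbox (-1) 1) (\<lambda>t. sqrt (1 - t\<^sup>2) * (- t * sin (z * t)))) (at z within UNIV)"
    by (rule leibniz_rule_field_derivative)
       (auto intro!: derivative_eq_intros integrable_continuous_real continuous_intros simp: case_prod_beta)
  then show "(semicircle_ft has_real_derivative semicircle_ft' z) (at z)"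
    by (simp add: semicircle_ft_def[abs_def] semicircle_ft'_def)
  have "((\<lambda>z. integral (cbox (-1) 1) (\<lambda>t. sqrt (1 - t\<^sup>2) * (- t * sin (z * t)))) has_real_derivative
      integral (cbox (-1) 1) (\<lambda>t. sqrt (1 - t\<^sup>2) * (- t\<^sup>2 * cos (z * t)))) (at z within UNIV)"
    by (rule leibniz_rule_field_derivative)
       (auto intro!: derivative_eq_intros integrable_continuous_real continuous_intros simp: case_prod_beta power2_eq_square)
  then show "(semicircle_ft' has_real_derivative semicircle_ft'' z) (at z)"
    by (simp add: semicircle_ft'_def[abs_def] semicircle_ft''_def)
qed

text \<open>
  Bessel's equation. Integrating the derivative of \<open>(1 - t\<^sup>2) powr (3/2) * sin (z * t)\<close> over \<open>{-1..1}\<close>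
  gives zero.
\<close>
lemma semicircle_ft_ode: "z * (semicircle_ft'' z + semicircle_ft z) + 3 * semicircle_ft' z = 0"
proof -
  define f where "f t = (1 - t\<^sup>2) * sqrt (1 - t\<^sup>2) * sin (z * t)" for t :: real
  let ?f' = "\<lambda>t. z * (sqrt (1 - t\<^sup>2) * (- t\<^sup>2 * cos (z * t)) + sqrt (1 - t\<^sup>2) * cos (z * t)) + 3 * (sqrt (1 - t\<^sup>2) * (- t * sin (z * t)))"
  have "(?f' has_integral f 1 - f (-1)) {-1..1}"
  proof (rule fundamental_theorem_of_calculus_interior)
    show "continuous_on {-1..1} f" unfolding f_def by (intro continuous_intros)
    fix t :: real assume t: "t \<in> {-1<..<1}"
    then have "t\<^sup>2 < 1" by (simp add: abs_square_less_1 abs_less_iff)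
    define s where "s = sqrt (1 - t\<^sup>2)"
    have s: "s > 0" "1 - t\<^sup>2 = s\<^sup>2" using \<open>t\<^sup>2 < 1\<close> by (auto simp: s_def)
    have "(f has_real_derivative (- (2 * t)) * s * sin (z * t) + s\<^sup>2 * (- (2 * t) * (inverse s / 2)) * sin (z * t) + s\<^sup>2 * s * (cos (z * t) * z)) (at t)"
      unfolding f_def s(2)[symmetric] unfolding s_def using \<open>t\<^sup>2 < 1\<close>
      by (auto intro!: derivative_eq_intros simp: algebra_simps)
    also have "(- (2 * t)) * s * sin (z * t) + s\<^sup>2 * (- (2 * t) * (inverse s / 2)) * sin (z * t) + s\<^sup>2 * s * (cos (z * t) * z) = ?f' t"
    proof -
      have "s\<^sup>2 * (- (2 * t) * (inverse s / 2)) = - t * s" using s by (simp add: power2_eq_square)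
      moreover have "s\<^sup>2 * s * (cos (z * t) * z) = z * (s * (- t\<^sup>2 * cos (z * t)) + s * cos (z * t))"
        unfolding s(2)[symmetric] by (simp add: algebra_simps)
      moreover have "- (2 * t) * s * sin (z * t) + (- t * s) * sin (z * t) + z * (s * (- t\<^sup>2 * cos (z * t)) + s * cos (z * t))
        = z * (s * (- t\<^sup>2 * cos (z * t)) + s * cos (z * t)) + 3 * (s * (- t * sin (z * t)))"
        by simp
      ultimately show ?thesis unfolding s_def[symmetric] by (simp only:)
    qed
    finally show "(f has_vector_derivative ?f' t) (at t)" by (simp add: has_real_derivative_iff_has_vector_derivative)
  qed simp
  then have "integral {-1..1} ?f' = 0" by (simp add: f_def integral_unique)
  also have "integral {-1..1} ?f' = z * (semicircle_ft'' z + semicircle_ft z) + 3 * semicircle_ft' z"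
  proof -
    have i: "(\<lambda>t. sqrt (1 - t\<^sup>2) * (- t\<^sup>2 * cos (z * t))) integrable_on {-1..1}" "(\<lambda>t. sqrt (1 - t\<^sup>2) * cos (z * t)) integrable_on {-1..1}"
      "(\<lambda>t. sqrt (1 - t\<^sup>2) * (- t * sin (z * t))) integrable_on {-1..1}"
      by (auto intro!: integrable_continuous_real continuous_intros)
    have "(?f' has_integral (z * (semicircle_ft'' z + semicircle_ft z) + 3 * semicircle_ft' z)) {-1..1}"
      unfolding semicircle_ft_def semicircle_ft'_def semicircle_ft''_def
      using i[THEN integrable_integral] by (intro has_integral_add has_integral_mult_right)
    then show ?thesis by (rule integral_unique)
  qed
  finally show ?thesis by simp
qed

text \<open>
  Both \<open>f + K / z\<close> and \<open>f - K / z\<close> are monotone, the first decreasing and the second increasing, and every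
  value of the second is at most every value of the first. Any number in between is the required limit.
\<close>
lemma limit_of_quadratic_decay:
  fixes f f' :: "real \<Rightarrow> real"
  assumes d: "\<And>z. 1 \<le> z \<Longrightarrow> (f has_real_derivative f' z) (at z)" and b: "\<And>z. 1 \<le> z \<Longrightarrow> \<bar>f' z\<bar> \<le> K / z\<^sup>2"
  shows "\<exists>L. \<forall>z\<ge>1. \<bar>f z - L\<bar> \<le> K / z"
proof -
  have dK: "((\<lambda>z. K / z) has_real_derivative - (K / z\<^sup>2)) (at z)" if "1 \<le> z" for z
    using that by (auto intro!: derivative_eq_intros simp: power2_eq_square)
  have dec: "f y + K / y \<le> f x + K / x" if "1 \<le> x" "x \<le> y" for x y
  proof (rule DERIV_nonpos_imp_nonincreasing[OF that(2)])
    fix w assume "x \<le> w" "w \<le> y"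
    then have w: "1 \<le> w" using that by simp
    show "\<exists>D. ((\<lambda>z. f z + K / z) has_real_derivative D) (at w) \<and> D \<le> 0"
      using b[OF w] by (intro exI[of _ "f' w + - (K / w\<^sup>2)"] conjI DERIV_add d[OF w] dK[OF w]) linarith
  qed
  have inc: "f x - K / x \<le> f y - K / y" if "1 \<le> x" "x \<le> y" for x y
  proof (rule DERIV_nonneg_imp_nondecreasing[OF that(2)])
    fix w assume "x \<le> w" "w \<le> y"
    then have w: "1 \<le> w" using that by simp
    show "\<exists>D. ((\<lambda>z. f z - K / z) has_real_derivative D) (at w) \<and> 0 \<le> D"
      using b[OF w] by (intro exI[of _ "f' w - - (K / w\<^sup>2)"] conjI DERIV_diff d[OF w] dK[OF w]) linarith
  qed
  have K: "0 \<le> K" using b[of 1] by simp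
  have cross: "f x - K / x \<le> f y + K / y" if "1 \<le> x" "1 \<le> y" for x y
  proof -
    have p: "0 \<le> K / x" "0 \<le> K / y" using that K by auto
    show ?thesis using dec[of y x] inc[of x y] that p by (cases "x \<le> y") auto
  qed
  define L where "L = (SUP x\<in>{1..}. f x - K / x)"
  have "f z - K / z \<le> L" if "1 \<le> z" for z
    unfolding L_def using cross[of _ 1] that by (intro cSUP_upper bdd_aboveI[where M="f 1 + K / 1"]) auto
  moreover have "L \<le> f z + K / z" if "1 \<le> z" for z
    unfolding L_def using cross that by (intro cSUP_least) auto
  ultimately show ?thesis by (intro exI[of _ L] allI impI) (fastforce simp: abs_le_iff)
qed

lemma abs_semicircle_ft_le: "\<bar>semicircle_ft z\<bar> \<le> 2"
proof -
  have "norm (integral {-1..1} (\<lambda>t. sqrt (1 - t\<^sup>2) * cos (z * t))) \<le> integral {-1..1} (\<lambda>t::real. 1)"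
  proof (rule integral_norm_bound_integral)
    fix t :: real assume "t \<in> {-1..1}"
    then have "t\<^sup>2 \<le> 1" by (simp add: abs_square_le_1 abs_le_iff)
    then have "\<bar>sqrt (1 - t\<^sup>2)\<bar> \<le> 1" by simp
    then have "\<bar>sqrt (1 - t\<^sup>2)\<bar> * \<bar>cos (z * t)\<bar> \<le> 1 * 1" by (intro mult_mono) auto
    then show "norm (sqrt (1 - t\<^sup>2) * cos (z * t)) \<le> 1" by (simp add: abs_mult)
  qed (auto intro!: integrable_continuous_real continuous_intros)
  then show ?thesis by (simp add: semicircle_ft_def)
qed

lemma semicircle_ft_0: "0 < semicircle_ft 0"
proof -
  have "integral {-1..1} (\<lambda>t::real. 1 - t\<^sup>2) \<le> integral {-1..1} (\<lambda>t. sqrt (1 - t\<^sup>2) * cos (0 * t))"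
  proof (rule integral_le)
    fix t :: real assume "t \<in> {-1..1}"
    then have t: "t\<^sup>2 \<le> 1" by (simp add: abs_square_le_1 abs_le_iff)
    have "x\<^sup>2 \<le> x" if "0 \<le> x" "x \<le> 1" for x :: real using that by (simp add: power2_eq_square mult_left_le)
    then have "(1 - t\<^sup>2)\<^sup>2 \<le> 1 - t\<^sup>2" using t by simp
    then show "1 - t\<^sup>2 \<le> sqrt (1 - t\<^sup>2) * cos (0 * t)" using t by (simp add: real_le_rsqrt)
  qed (auto intro!: integrable_continuous_real continuous_intros)
  moreover have "((\<lambda>t::real. 1 - t\<^sup>2) has_integral ((1 - 1^3 / 3) - (- 1 - (- 1)^3 / 3))) {-1..1}"
    by (rule fundamental_theorem_of_calculus)
       (auto intro!: derivative_eq_intros simp: has_real_derivative_iff_has_vector_derivative[symmetric] power2_eq_square)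
  ultimately show ?thesis by (simp add: semicircle_ft_def integral_unique)
qed

text \<open>
  The function \<open>u = z powr (3/2) * semicircle_ft z\<close> satisfies \<open>u'' = - (1 - 3 / (4 z\<^sup>2)) u\<close>, a perturbed
  harmonic oscillator. The energy \<open>u\<^sup>2 + u'\<^sup>2\<close> stays bounded, because after multiplication with
  \<open>exp (3 / (4 z))\<close> it decreases. In coordinates that rotate with the unperturbed oscillator the
  derivatives are therefore \<open>O(1 / z\<^sup>2)\<close>, and the amplitudes \<open>A\<close> and \<open>B\<close> are the limits of these
  coordinates.
\<close>
lemma semicircle_ft_asymptotics:
  "\<exists>A B C. \<forall>z>0. \<bar>z * sqrt z * semicircle_ft z - (A * cos z + B * sin z)\<bar> \<le> C / z"
proof -
  define u where "u z = z * sqrt z * semicircle_ft z" for z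
  define v where "v z = z * sqrt z * semicircle_ft' z + 3 / 2 * sqrt z * semicircle_ft z" for z
  define q where "q z = 3 / 4 / z\<^sup>2 * u z" for z
  have du: "(u has_real_derivative v z) (at z)" if z: "1 \<le> z" for z
  proof -
    define s where "s = sqrt z"
    have s: "s > 0" "z = s * s" using z by (auto simp: s_def)
    show ?thesis unfolding u_def[abs_def] v_def using z
      by (auto intro!: derivative_eq_intros semicircle_ft_derivatives simp: s_def[symmetric])
         (simp add: s(2) s(1) field_simps)
  qed
  have dv: "(v has_real_derivative - u z + q z) (at z)" if z: "1 \<le> z" for z
  proof -
    define s where "s = sqrt z"
    have s: "s > 0" "z = s * s" using z by (auto simp: s_def)
    define X where "X = semicircle_ft'' z"
    have ode: "z * X = - (z * semicircle_ft z) - 3 * semicircle_ft' z"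
      using semicircle_ft_ode[of z] by (simp add: X_def algebra_simps)
    have "(v has_real_derivative (s * semicircle_ft' z + z * (inverse s / 2) * semicircle_ft' z + s * (z * X)
        + (3 / 2 * (inverse s / 2) * semicircle_ft z + 3 / 2 * s * semicircle_ft' z))) (at z)"
      unfolding v_def[abs_def] s_def X_def using z
      by (auto intro!: derivative_eq_intros semicircle_ft_derivatives simp: algebra_simps) (simp add: add_divide_distrib)
    also have "(s * semicircle_ft' z + z * (inverse s / 2) * semicircle_ft' z + s * (z * X)
        + (3 / 2 * (inverse s / 2) * semicircle_ft z + 3 / 2 * s * semicircle_ft' z)) = - u z + q z"
    proof -
      have "z * (inverse s / 2) = s / 2" using s by simp
      moreover have "q z = 3 / 4 * inverse s * semicircle_ft z"
        unfolding q_def u_def s_def[symmetric] using s by (simp add: s(2) power2_eq_square field_simps)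
      ultimately show ?thesis unfolding ode by (simp add: u_def s_def[symmetric] algebra_simps)
    qed
    finally show ?thesis .
  qed
  define E where "E z = (u z)\<^sup>2 + (v z)\<^sup>2" for z
  define \<Phi> where "\<Phi> z = E z * exp (3 / 4 / z)" for z
  have d\<Phi>: "\<exists>y. (\<Phi> has_real_derivative y) (at z) \<and> y \<le> 0" if z: "1 \<le> z" for z
  proof (intro exI conjI)
    show "(\<Phi> has_real_derivative (2 * u z * v z + 2 * v z * (- u z + q z) - 3 / 4 / z\<^sup>2 * E z) * exp (3 / 4 / z)) (at z)"
      unfolding \<Phi>_def[abs_def] E_def[abs_def] using z
      by (auto intro!: derivative_eq_intros du dv simp: algebra_simps power2_eq_square) (simp add: add_divide_distrib)
    have "2 * u z * v z + 2 * v z * (- u z + q z) - 3 / 4 / z\<^sup>2 * E z = - (3 / 4 / z\<^sup>2) * (u z - v z)\<^sup>2"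
      by (simp add: E_def q_def power2_eq_square algebra_simps)
    also have "\<dots> \<le> 0" by simp
    finally show "(2 * u z * v z + 2 * v z * (- u z + q z) - 3 / 4 / z\<^sup>2 * E z) * exp (3 / 4 / z) \<le> 0"
      by (simp add: mult_le_0_iff)
  qed
  define K where "K = sqrt (\<Phi> 1)"
  have u: "\<bar>u z\<bar> \<le> K" if z: "1 \<le> z" for z
  proof -
    have "(u z)\<^sup>2 \<le> E z * 1" by (simp add: E_def)
    also have "\<dots> \<le> \<Phi> z" unfolding \<Phi>_def using z by (intro mult_left_mono) (auto simp: E_def)
    also have "\<dots> \<le> \<Phi> 1" by (rule DERIV_nonpos_imp_nonincreasing[OF z]) (use d\<Phi> in auto)
    finally show ?thesis unfolding K_def by (intro real_le_rsqrt) simp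
  qed
  have qb: "\<bar>q z * w\<bar> \<le> K / z\<^sup>2" if z: "1 \<le> z" "\<bar>w\<bar> \<le> 1" for z w
  proof -
    have "\<bar>q z * w\<bar> \<le> \<bar>q z\<bar> * 1" unfolding abs_mult using z by (intro mult_left_mono) auto
    also have "\<dots> = 3 / 4 * \<bar>u z\<bar> / z\<^sup>2" by (simp add: q_def abs_mult)
    also have "\<dots> \<le> K / z\<^sup>2" using u[OF z(1)] by (intro divide_right_mono) auto
    finally show ?thesis .
  qed
  have "\<exists>A. \<forall>z\<ge>1. \<bar>(u z * cos z - v z * sin z) - A\<bar> \<le> K / z"
  proof (rule limit_of_quadratic_decay)
    fix z :: real assume z: "1 \<le> z"
    show "((\<lambda>z. u z * cos z - v z * sin z) has_real_derivative q z * (- sin z)) (at z)"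
      using du[OF z] dv[OF z] by (auto intro!: derivative_eq_intros simp: algebra_simps)
    show "\<bar>q z * (- sin z)\<bar> \<le> K / z\<^sup>2" by (rule qb[OF z]) simp
  qed
  then obtain A where A: "\<And>z. z \<ge> 1 \<Longrightarrow> \<bar>(u z * cos z - v z * sin z) - A\<bar> \<le> K / z" by blast
  have "\<exists>B. \<forall>z\<ge>1. \<bar>(u z * sin z + v z * cos z) - B\<bar> \<le> K / z"
  proof (rule limit_of_quadratic_decay)
    fix z :: real assume z: "1 \<le> z"
    show "((\<lambda>z. u z * sin z + v z * cos z) has_real_derivative q z * cos z) (at z)"
      using du[OF z] dv[OF z] by (auto intro!: derivative_eq_intros simp: algebra_simps)
    show "\<bar>q z * cos z\<bar> \<le> K / z\<^sup>2" by (rule qb[OF z]) simp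
  qed
  then obtain B where B: "\<And>z. z \<ge> 1 \<Longrightarrow> \<bar>(u z * sin z + v z * cos z) - B\<bar> \<le> K / z" by blast
  have K0: "0 \<le> K" using u[of 1] by linarith
  define C where "C = 2 * K + 2 + \<bar>A\<bar> + \<bar>B\<bar>"
  have "\<bar>u z - (A * cos z + B * sin z)\<bar> \<le> C / z" if z: "z > 0" for z
  proof (cases "1 \<le> z")
    case True
    define p q where "p = u z * cos z - v z * sin z - A" and "q = u z * sin z + v z * cos z - B"
    have "(p + A) * cos z + (q + B) * sin z = u z * ((cos z)\<^sup>2 + (sin z)\<^sup>2)"
      unfolding p_def q_def power2_eq_square by algebra
    then have "u z = (p + A) * cos z + (q + B) * sin z" by simp
    then have "u z - (A * cos z + B * sin z) = p * cos z + q * sin z" by (simp add: distrib_right)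
    also have "\<bar>\<dots>\<bar> \<le> \<bar>p\<bar> * \<bar>cos z\<bar> + \<bar>q\<bar> * \<bar>sin z\<bar>"
      using abs_triangle_ineq[of "p * cos z" "q * sin z"] by (simp add: abs_mult)
    also have "\<dots> \<le> \<bar>p\<bar> * 1 + \<bar>q\<bar> * 1" by (intro add_mono mult_left_mono) auto
    also have "\<dots> \<le> 2 * K / z" using A[OF True] B[OF True] by (simp add: p_def q_def)
    also have "\<dots> \<le> C / z" using z by (intro divide_right_mono) (auto simp: C_def)
    finally show ?thesis .
  next
    case False
    have "sqrt z \<le> 1" using False by simp
    then have "\<bar>u z\<bar> \<le> 1 * 1 * 2" unfolding u_def abs_mult using z False abs_semicircle_ft_le[of z]
      by (intro mult_mono) auto
    moreover have "\<bar>A * cos z\<bar> \<le> \<bar>A\<bar> * 1" "\<bar>B * sin z\<bar> \<le> \<bar>B\<bar> * 1"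
      unfolding abs_mult by (intro mult_left_mono; simp)+
    ultimately have "\<bar>u z - (A * cos z + B * sin z)\<bar> \<le> C" using K0 by (simp add: C_def)
    also have "\<dots> \<le> C / z" proof -
      have "0 \<le> C" using K0 by (simp add: C_def)
      then have "C * z \<le> C * 1" using False by (intro mult_left_mono) auto
      then show ?thesis using z by (simp add: pos_le_divide_eq)
    qed
    finally show ?thesis .
  qed
  then show ?thesis unfolding u_def by blast
qed

lemma semicircle_ft_decay: "\<exists>C. \<forall>z>0. \<bar>semicircle_ft z\<bar> * (z * sqrt z) \<le> C"
proof -
  obtain A B C where *: "\<And>z. z > 0 \<Longrightarrow> \<bar>z * sqrt z * semicircle_ft z - (A * cos z + B * sin z)\<bar> \<le> C / z"
    using semicircle_ft_asymptotics by blast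
  have C: "0 \<le> C" using *[of 1] by simp
  have "\<bar>semicircle_ft z\<bar> * (z * sqrt z) \<le> \<bar>A\<bar> + \<bar>B\<bar> + C + 2" if z: "z > 0" for z
  proof (cases "1 \<le> z")
    case True
    have "\<bar>A * cos z\<bar> \<le> \<bar>A\<bar> * 1" "\<bar>B * sin z\<bar> \<le> \<bar>B\<bar> * 1"
      unfolding abs_mult by (intro mult_left_mono; simp)+
    moreover have "C / z \<le> C" using mult_left_mono[of 1 z C] C True by (simp add: field_simps)
    moreover have "\<bar>semicircle_ft z\<bar> * (z * sqrt z) = \<bar>z * sqrt z * semicircle_ft z\<bar>" using z by (simp add: abs_mult)
    ultimately show ?thesis using *[OF z] by linarith
  next
    case False
    have "\<bar>semicircle_ft z\<bar> * (z * sqrt z) \<le> 2 * (1 * 1)"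
      using z False abs_semicircle_ft_le[of z] by (intro mult_mono) auto
    then show ?thesis using C by simp
  qed
  then show ?thesis by blast
qed

section \<open>Fourier transforms of ellipses\<close>

text \<open>
  Lebesgue measure is determined by its values on boxes, and the preimage of a box under \<open>g\<close> is its image
  under the inverse map, whose determinant is the reciprocal one.
\<close>
lemma lborel_linear_image:
  fixes g :: "real^2 \<Rightarrow> real^2"
  assumes g: "linear g" "det (matrix g) \<noteq> 0"
  shows "(lborel :: (real^2) measure) = density (distr lborel borel g) (\<lambda>_. ennreal \<bar>det (matrix g)\<bar>)"
proof (rule lborel_eqI)
  obtain h where h: "linear h" "\<And>x. h (g x) = x" "\<And>x. g (h x) = x"
    using g det_nz_iff_inj linear_injective_isomorphism by metis
  have "g \<circ> h = id" using h by auto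
  then have "matrix g ** matrix h = mat 1" using matrix_compose[OF h(1) g(1)] by (simp add: matrix_id_mat_1)
  then have "det (matrix g) * det (matrix h) = 1" by (metis det_I det_mul)
  then have d: "\<bar>det (matrix g)\<bar> * \<bar>det (matrix h)\<bar> = 1" by (metis abs_1 abs_mult)
  have m [measurable]: "g \<in> borel_measurable borel"
    using g by (intro borel_measurable_continuous_onI linear_continuous_on linear_conv_bounded_linear[THEN iffD1])
  fix l u :: "real^2" assume le: "\<And>b. b \<in> Basis \<Longrightarrow> l \<bullet> b \<le> u \<bullet> b"
  have vi: "g -` box l u = h ` box l u" using h by (auto simp: image_iff) metis
  have bl: "box l u \<in> lmeasurable" by simp
  have mb: "g -` box l u \<in> sets borel" using measurable_sets_borel[OF m, of "box l u"] by simp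
  have lm: "h ` box l u \<in> lmeasurable" by (rule measurable_linear_image[OF h(1) bl])
  have "emeasure (density (distr lborel borel g) (\<lambda>_. ennreal \<bar>det (matrix g)\<bar>)) (box l u) =
      ennreal \<bar>det (matrix g)\<bar> * emeasure lborel (g -` box l u)"
    by (subst emeasure_density_const) (auto simp: emeasure_distr)
  also have "emeasure lborel (g -` box l u) = emeasure lebesgue (h ` box l u)"
    using mb by (simp add: vi)
  also have "\<dots> = ennreal (measure lebesgue (h ` box l u))"
    using fmeasurableD2[OF lm] by (intro emeasure_eq_ennreal_measure) auto
  also have "measure lebesgue (h ` box l u) = \<bar>det (matrix h)\<bar> * measure lebesgue (box l u)"
    by (rule measure_linear_image[OF h(1) bl])
  also have "ennreal \<bar>det (matrix g)\<bar> * ennreal (\<bar>det (matrix h)\<bar> * measure lebesgue (box l u)) = ennreal (measure lebesgue (box l u))"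
    using d by (simp add: ennreal_mult[symmetric] mult.assoc[symmetric])
  also have "\<dots> = ennreal (\<Prod>b\<in>Basis. (u - l) \<bullet> b)" using le by (simp add: measure_completion)
  finally show "emeasure (density (distr lborel borel g) (\<lambda>_. ennreal \<bar>det (matrix g)\<bar>)) (box l u) = ennreal (\<Prod>b\<in>Basis. (u - l) \<bullet> b)" .
qed simp

lemma integral_linear_change:
  fixes g :: "real^2 \<Rightarrow> real^2" and f :: "real^2 \<Rightarrow> 'a::{banach, second_countable_topology}"
  assumes g: "linear g" "det (matrix g) \<noteq> 0" and [measurable]: "f \<in> borel_measurable borel"
  shows "(\<integral>x. f x \<partial>lborel) = \<bar>det (matrix g)\<bar> *\<^sub>R (\<integral>x. f (g x) \<partial>lborel)"
proof -
  have [measurable]: "g \<in> borel_measurable borel"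
    using g by (intro borel_measurable_continuous_onI linear_continuous_on linear_conv_bounded_linear[THEN iffD1])
  show ?thesis
    by (subst lborel_linear_image[OF g]) (simp add: integral_density integral_distr)
qed

text \<open>
  Integrating first along the lines orthogonal to the frequency leaves the chord length
  \<open>2 * sqrt (1 - s\<^sup>2)\<close>; the odd part of the exponential integrates to zero.
\<close>
lemma integral_disc_cis:
  "(\<integral>y. indicator {y::real^2. norm y \<le> 1} y *\<^sub>R cis (z * y $ 1) \<partial>lborel) = of_real (2 * semicircle_ft z)"
proof -
  define D where "D = {y::real^2. norm y \<le> 1}"
  have D: "D = cball 0 1" by (auto simp: D_def)
  have Dm [measurable]: "D \<in> sets borel" by (simp add: D)
  have [measurable]: "(\<lambda>y::real^2. cis (z * y $ 1)) \<in> borel_measurable borel"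
    by (intro borel_measurable_continuous_onI continuous_intros)
  have inD: "vec2 (s, t) \<in> D \<longleftrightarrow> s\<^sup>2 + t\<^sup>2 \<le> 1" for s t
    by (simp add: D_def norm_eq_sqrt_inner inner_real2 power2_eq_square)
  define F where "F s = indicator {-1..1} s *\<^sub>R (2 * (sqrt (1 - s\<^sup>2) * cos (z * s)))" for s :: real
  define G where "G s = indicator {-1..1} s *\<^sub>R (2 * (sqrt (1 - s\<^sup>2) * sin (z * s)))" for s :: real
  have iF: "integrable lborel F" and iG: "integrable lborel G"
    unfolding F_def[abs_def] G_def[abs_def] by (rule borel_integrable_compact; auto intro!: continuous_intros)+
  have intG: "(\<integral>s. G s \<partial>lborel) = 0"
  proof -
    have "(\<integral>s. indicator {-1..1} s *\<^sub>R (2 * (sqrt (1 - s\<^sup>2) * sin (z * s))) \<partial>lborel) =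
      (\<integral>s. indicator {-1..1} (0 + (-1) * s) *\<^sub>R (2 * (sqrt (1 - (0 + (-1) * s)\<^sup>2) * sin (z * (0 + (-1) * s)))) \<partial>lborel)"
      by (subst lborel_integral_real_affine[where c="-1" and t=0]) auto
    also have "\<dots> = (\<integral>s. - (indicator {-1..1} s *\<^sub>R (2 * (sqrt (1 - s\<^sup>2) * sin (z * s)))) \<partial>lborel)"
      by (intro Bochner_Integration.integral_cong refl) (auto simp: indicator_def)
    also have "\<dots> = - (\<integral>s. (indicator {-1..1} s *\<^sub>R (2 * (sqrt (1 - s\<^sup>2) * sin (z * s)))) \<partial>lborel)" by simp
    finally show ?thesis by (simp add: G_def)
  qed
  have intF: "(\<integral>s. F s \<partial>lborel) = 2 * semicircle_ft z"
  proof -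
    have "set_integrable lborel {-1..1} (\<lambda>s. 2 * (sqrt (1 - s\<^sup>2) * cos (z * s)))"
      unfolding set_integrable_def by (rule borel_integrable_compact) (auto intro!: continuous_intros)
    from set_borel_integral_eq_integral(2)[OF this] show ?thesis
      unfolding set_lebesgue_integral_def semicircle_ft_def F_def by (simp only: Henstock_Kurzweil_Integration.integral_mult_right)
  qed
  have "(\<integral>y. indicator D y *\<^sub>R cis (z * y $ 1) \<partial>lborel) = (\<integral>s. (\<integral>t. indicator D (vec2 (s, t)) *\<^sub>R cis (z * s) \<partial>lborel) \<partial>lborel)"
  proof (subst integral_real2_fubini)
    show "integrable lborel (\<lambda>y. indicator D y *\<^sub>R cis (z * y $ 1))"
      by (rule integrableI_bounded_set_indicator[where B=1]) (use emeasure_lborel_cball_finite[of "0::real^2" 1] in \<open>auto simp: D top.not_eq_extremum\<close>)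
  qed simp
  also have "\<dots> = (\<integral>s. indicator {-1..1} s *\<^sub>R (of_real (2 * sqrt (1 - s\<^sup>2)) * cis (z * s)) \<partial>lborel)"
  proof (rule Bochner_Integration.integral_cong[OF refl])
    fix s :: real
    show "(\<integral>t. indicator D (vec2 (s, t)) *\<^sub>R cis (z * s) \<partial>lborel) = indicator {-1..1} s *\<^sub>R (of_real (2 * sqrt (1 - s\<^sup>2)) * cis (z * s))"
    proof (cases "s \<in> {-1..1}")
      case True
      then have "s\<^sup>2 \<le> 1" by (simp add: abs_square_le_1 abs_le_iff)
      then have "s\<^sup>2 + t\<^sup>2 \<le> 1 \<longleftrightarrow> t \<in> {- sqrt (1 - s\<^sup>2)..sqrt (1 - s\<^sup>2)}" for t
      proof -
        have "s\<^sup>2 + t\<^sup>2 \<le> 1 \<longleftrightarrow> t\<^sup>2 \<le> 1 - s\<^sup>2" by linarith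
        also have "\<dots> \<longleftrightarrow> \<bar>t\<bar> \<le> sqrt (1 - s\<^sup>2)" using \<open>s\<^sup>2 \<le> 1\<close> by (metis real_sqrt_abs real_sqrt_le_iff)
        finally show ?thesis by auto
      qed
      then have "(\<lambda>t. indicator D (vec2 (s, t)) :: real) = indicator {- sqrt (1 - s\<^sup>2)..sqrt (1 - s\<^sup>2)}"
        by (auto simp: indicator_def inD)
      then have "(\<integral>t. indicator D (vec2 (s, t)) *\<^sub>R cis (z * s) \<partial>lborel) = (\<integral>t. indicator {- sqrt (1 - s\<^sup>2)..sqrt (1 - s\<^sup>2)} t *\<^sub>R cis (z * s) \<partial>lborel)"
        by (metis (no_types))
      also have "\<dots> = (2 * sqrt (1 - s\<^sup>2)) *\<^sub>R cis (z * s)" using \<open>s\<^sup>2 \<le> 1\<close> by simp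
      finally show ?thesis using True by (simp add: scaleR_conv_of_real)
    next
      case False
      then have "\<not> s\<^sup>2 \<le> 1" by (auto simp: abs_square_le_1 abs_le_iff)
      then have "\<not> s\<^sup>2 + t\<^sup>2 \<le> 1" for t :: real using zero_le_power2[of t] by linarith
      then show ?thesis using False by (simp add: inD)
    qed
  qed
  also have "\<dots> = (\<integral>s. of_real (F s) + \<i> * of_real (G s) \<partial>lborel)"
    by (intro Bochner_Integration.integral_cong refl) (simp add: F_def G_def complex_eq_iff)
  also have "\<dots> = of_real (\<integral>s. F s \<partial>lborel) + \<i> * of_real (\<integral>s. G s \<partial>lborel)"
    using iF iG by simp
  finally show ?thesis by (simp add: D_def intF intG)
qed

text \<open>
  The ellipse centred at the origin with semi-axes \<open>a\<close> and \<open>b\<close> along the orthonormal vectors \<open>u\<close> and \<open>v\<close>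
  is the unit disc of the norm \<open>q\<close>. The length of \<open>freq k\<close> is \<open>2\<pi>\<close> times the dual norm of \<open>k\<close>; complex
  numbers serve as plane vectors here, so that \<open>freq\<close> maps the integer lattice to a general plane lattice.
\<close>
locale ellipse =
  fixes u v :: "real^2" and a b :: real
  assumes uv: "norm u = 1" "norm v = 1" "u \<bullet> v = 0" and ab: "0 < a" "0 < b"
begin

definition q :: "real^2 \<Rightarrow> real" where "q x = norm (Complex ((x \<bullet> u) / a) ((x \<bullet> v) / b))"
definition disc :: "real \<Rightarrow> (real^2) set" where "disc s = {x. q x \<le> s}"
definition freq :: "real^2 \<Rightarrow> complex" where "freq k = Complex (2 * pi * a * (k \<bullet> u)) (2 * pi * b * (k \<bullet> v))"

text \<open>
  In the plane \<open>v\<close> is \<open>u\<close> rotated by a right angle, up to the sign \<open>\<delta>\<close>.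
\<close>
lemma orthonormal: "x \<bullet> y = (x \<bullet> u) * (y \<bullet> u) + (x \<bullet> v) * (y \<bullet> v)"
  and det_frame: "(u $ 1 * v $ 2 - u $ 2 * v $ 1)\<^sup>2 = 1"
proof -
  have 1: "(u $ 1)\<^sup>2 + (u $ 2)\<^sup>2 = 1" "(v $ 1)\<^sup>2 + (v $ 2)\<^sup>2 = 1" "u $ 1 * v $ 1 + u $ 2 * v $ 2 = 0"
    using uv by (simp_all add: norm_eq_1 inner_real2 power2_eq_square)
  define \<delta> where "\<delta> = u $ 1 * v $ 2 - u $ 2 * v $ 1"
  have v: "v $ 1 = - \<delta> * u $ 2" "v $ 2 = \<delta> * u $ 1" unfolding \<delta>_def using 1 by algebra+
  have \<delta>: "\<delta>\<^sup>2 = 1" unfolding \<delta>_def using 1 by algebra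
  then show "(u $ 1 * v $ 2 - u $ 2 * v $ 1)\<^sup>2 = 1" by (simp add: \<delta>_def)
  show "x \<bullet> y = (x \<bullet> u) * (y \<bullet> u) + (x \<bullet> v) * (y \<bullet> v)"
    unfolding inner_real2 v using 1(1) \<delta> by algebra
qed

lemma freq_add: "freq (x + y) = freq x + freq y" and freq_diff: "freq (x - y) = freq x - freq y"
  and freq_0: "freq 0 = 0"
  by (simp_all add: freq_def inner_simps complex_eq_iff algebra_simps)

lemma q_triangle: "q (x + y) \<le> q x + q y"
proof -
  have "q (x + y) = norm (Complex ((x \<bullet> u) / a) ((x \<bullet> v) / b) + Complex ((y \<bullet> u) / a) ((y \<bullet> v) / b))"
    by (simp add: q_def inner_simps add_divide_distrib plus_complex.code)
  then show ?thesis unfolding q_def by (metis norm_triangle_ineq)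
qed

lemma q_minus: "q (- x) = q x" by (simp add: q_def cmod_def)
lemma q_nonneg: "0 \<le> q x" by (simp add: q_def)

lemma continuous_on_q [continuous_intros]: "continuous_on A f \<Longrightarrow> continuous_on A (\<lambda>x. q (f x))" for f :: "'a::t2_space \<Rightarrow> real^2"
  unfolding q_def cmod_def using ab by (auto intro!: continuous_intros)

lemma q_ge: "norm x \<le> (a + b) * q x"
proof -
  have "norm x = sqrt ((x \<bullet> u)\<^sup>2 + (x \<bullet> v)\<^sup>2)"
    unfolding norm_eq_sqrt_inner[of x] orthonormal[of x x] by (simp add: power2_eq_square)
  also have "\<dots> \<le> sqrt (((a + b) * q x)\<^sup>2)"
  proof (rule real_sqrt_le_mono)
    have "(x \<bullet> u)\<^sup>2 = a\<^sup>2 * ((x \<bullet> u) / a)\<^sup>2" "(x \<bullet> v)\<^sup>2 = b\<^sup>2 * ((x \<bullet> v) / b)\<^sup>2"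
      using ab by (simp_all add: power_divide)
    moreover have "a\<^sup>2 * ((x \<bullet> u) / a)\<^sup>2 \<le> (a + b)\<^sup>2 * ((x \<bullet> u) / a)\<^sup>2" "b\<^sup>2 * ((x \<bullet> v) / b)\<^sup>2 \<le> (a + b)\<^sup>2 * ((x \<bullet> v) / b)\<^sup>2"
      using ab by (auto intro!: mult_right_mono power_mono)
    ultimately show "(x \<bullet> u)\<^sup>2 + (x \<bullet> v)\<^sup>2 \<le> ((a + b) * q x)\<^sup>2"
      by (simp add: q_def cmod_power2 power_mult_distrib distrib_left)
  qed
  also have "\<dots> = (a + b) * q x" using ab q_nonneg[of x] by simp
  finally show ?thesis .
qed

lemma disc_bounded: "disc s \<subseteq> cball 0 ((a + b) * s)"
proof
  fix x assume "x \<in> disc s"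
  then have "(a + b) * q x \<le> (a + b) * s" using ab by (intro mult_left_mono) (auto simp: disc_def)
  then show "x \<in> cball 0 ((a + b) * s)" using q_ge[of x] by simp
qed

lemma disc_closed: "closed (disc s)"
  unfolding disc_def by (intro closed_Collect_le continuous_intros)

lemma disc_measurable [measurable]: "disc s \<in> sets borel" by (rule borel_closed[OF disc_closed])

lemma emeasure_disc_finite: "emeasure lborel (disc s) < \<infinity>"
  using emeasure_lborel_cball_finite[of "0::real^2"] emeasure_mono[OF disc_bounded[of s], of lborel] by (auto simp: order.strict_trans1 top.not_eq_extremum)

text \<open>
  The linear map \<open>g\<close> takes the round unit disc to \<open>disc s\<close>. It is preceded by the rotation with
  coefficients \<open>w1\<close>, \<open>w2\<close> that turns the frequency to the first coordinate axis, so that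
  \<open>integral_disc_cis\<close> applies.
\<close>
lemma integral_disc_echar:
  assumes s: "0 < s"
  shows "(\<integral>x. indicator (disc s) x *\<^sub>R echar k x \<partial>lborel) = of_real (s\<^sup>2 * (2 * a * b) * semicircle_ft (s * norm (freq k)))"
proof -
  define \<rho> where "\<rho> = norm (freq k)"
  obtain w1 w2 where w: "w1\<^sup>2 + w2\<^sup>2 = 1" "2 * pi * a * (k \<bullet> u) = \<rho> * w1" "2 * pi * b * (k \<bullet> v) = \<rho> * w2"
  proof (cases "freq k = 0")
    case True
    then have "2 * pi * a * (k \<bullet> u) = 0" "2 * pi * b * (k \<bullet> v) = 0" "\<rho> = 0"
      by (simp_all add: \<rho>_def) (simp_all add: freq_def complex_eq_iff)
    then show ?thesis by (intro that[of 1 0]) simp_all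
  next
    case False
    then have r: "\<rho> \<noteq> 0" by (simp add: \<rho>_def)
    have "\<rho>\<^sup>2 = (2 * pi * a * (k \<bullet> u))\<^sup>2 + (2 * pi * b * (k \<bullet> v))\<^sup>2" by (simp add: \<rho>_def cmod_power2 freq_def)
    then have "(2 * pi * a * (k \<bullet> u) / \<rho>)\<^sup>2 + (2 * pi * b * (k \<bullet> v) / \<rho>)\<^sup>2 = \<rho>\<^sup>2 / \<rho>\<^sup>2"
      by (simp only: power_divide add_divide_distrib[symmetric])
    also have "\<dots> = 1" using r by simp
    finally show ?thesis using r by (intro that[of "2 * pi * a * (k \<bullet> u) / \<rho>" "2 * pi * b * (k \<bullet> v) / \<rho>"]) auto
  qed
  define g :: "real^2 \<Rightarrow> real^2" where "g y = (s * a * (w1 * y $ 1 - w2 * y $ 2)) *\<^sub>R u + (s * b * (w2 * y $ 1 + w1 * y $ 2)) *\<^sub>R v" for y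
  have lin: "linear g" by (rule linearI) (simp_all add: g_def vec_eq_iff algebra_simps)
  have uu: "u \<bullet> u = 1" "v \<bullet> v = 1" "v \<bullet> u = 0" using uv by (simp_all add: norm_eq_1 inner_commute)
  have gu: "g y \<bullet> u = s * a * (w1 * y $ 1 - w2 * y $ 2)" "g y \<bullet> v = s * b * (w2 * y $ 1 + w1 * y $ 2)" for y
    using uu uv by (simp_all add: g_def inner_simps)
  have "det (matrix g) = s\<^sup>2 * a * b * (u $ 1 * v $ 2 - u $ 2 * v $ 1)"
  proof -
    have "matrix g $ i $ j = g (axis j 1) $ i" for i j by (simp add: matrix_def)
    then have "det (matrix g) = (s * a * w1 * u $ 1 + s * b * w2 * v $ 1) * (- s * a * w2 * u $ 2 + s * b * w1 * v $ 2)
       - (- s * a * w2 * u $ 1 + s * b * w1 * v $ 1) * (s * a * w1 * u $ 2 + s * b * w2 * v $ 2)"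
      by (simp add: det_2 g_def axis_def)
    also have "\<dots> = s\<^sup>2 * a * b * (u $ 1 * v $ 2 - u $ 2 * v $ 1) * (w1\<^sup>2 + w2\<^sup>2)" by algebra
    finally show ?thesis using w(1) by simp
  qed
  moreover have "\<bar>u $ 1 * v $ 2 - u $ 2 * v $ 1\<bar> = 1" using det_frame by (simp add: abs_square_eq_1)
  ultimately have det: "\<bar>det (matrix g)\<bar> = s\<^sup>2 * (a * b)" using ab by (simp add: abs_mult)
  have qg: "q (g y) = s * norm y" for y
  proof -
    have "(q (g y))\<^sup>2 = (s * (w1 * y $ 1 - w2 * y $ 2))\<^sup>2 + (s * (w2 * y $ 1 + w1 * y $ 2))\<^sup>2"
      using ab by (simp add: q_def cmod_power2 gu)
    also have "\<dots> = s\<^sup>2 * ((w1\<^sup>2 + w2\<^sup>2) * ((y $ 1)\<^sup>2 + (y $ 2)\<^sup>2))" by algebra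
    also have "(y $ 1)\<^sup>2 + (y $ 2)\<^sup>2 = (norm y)\<^sup>2"
      unfolding power2_norm_eq_inner inner_real2 by (simp add: power2_eq_square)
    also have "s\<^sup>2 * ((w1\<^sup>2 + w2\<^sup>2) * (norm y)\<^sup>2) = (s * norm y)\<^sup>2" unfolding w(1) by (simp add: power_mult_distrib)
    finally show ?thesis using s q_nonneg by (simp add: power2_eq_iff_nonneg)
  qed
  have kg: "2 * pi * (k \<bullet> g y) = s * \<rho> * y $ 1" for y
  proof -
    have "2 * pi * (k \<bullet> g y) = 2 * pi * ((k \<bullet> u) * (g y \<bullet> u) + (k \<bullet> v) * (g y \<bullet> v))" by (subst orthonormal) simp
    also have "\<dots> = s * ((2 * pi * a * (k \<bullet> u)) * (w1 * y $ 1 - w2 * y $ 2) + (2 * pi * b * (k \<bullet> v)) * (w2 * y $ 1 + w1 * y $ 2))"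
      unfolding gu by algebra
    also have "\<dots> = s * \<rho> * ((w1\<^sup>2 + w2\<^sup>2) * y $ 1)" unfolding w(2,3) by algebra
    finally show ?thesis using w by simp
  qed
  have "(\<integral>x. indicator (disc s) x *\<^sub>R echar k x \<partial>lborel) = \<bar>det (matrix g)\<bar> *\<^sub>R (\<integral>y. indicator (disc s) (g y) *\<^sub>R echar k (g y) \<partial>lborel)"
    by (rule integral_linear_change[OF lin]) (use det s ab in auto)
  also have "(\<lambda>y. indicator (disc s) (g y) *\<^sub>R echar k (g y)) = (\<lambda>y. indicator {y::real^2. norm y \<le> 1} y *\<^sub>R cis ((s * \<rho>) * y $ 1))"
    using s by (auto simp: fun_eq_iff disc_def qg echar_def kg indicator_def)
  finally show ?thesis unfolding integral_disc_cis det by (simp add: scaleR_conv_of_real \<rho>_def)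
qed

lemma measure_disc: "0 < s \<Longrightarrow> measure lborel (disc s) = s\<^sup>2 * (2 * a * b) * semicircle_ft 0"
proof -
  assume "0 < s"
  from integral_disc_echar[OF this, of 0] have "complex_of_real (measure lborel (disc s)) = of_real (s\<^sup>2 * (2 * a * b) * semicircle_ft 0)"
    by (simp add: echar_simps freq_0 scaleR_conv_of_real del: of_real_mult)
  then show ?thesis by (simp only: of_real_eq_iff)
qed

end

section \<open>Reconstruction from Fourier coefficients\<close>

definition trigpoly :: "(real^2 \<Rightarrow> complex) \<Rightarrow> bool" where
  "trigpoly f \<longleftrightarrow> (\<exists>F t. finite F \<and> F \<subseteq> int_lattice \<and> f = (\<lambda>x. \<Sum>k\<in>F. t k * echar k x))"

lemma trigpoly_sum:
  assumes "finite I" "\<And>i. i \<in> I \<Longrightarrow> n i \<in> int_lattice"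
  shows "trigpoly (\<lambda>x. \<Sum>i\<in>I. C i * echar (n i) x)"
  unfolding trigpoly_def
proof (intro exI conjI ext)
  fix x
  have "(\<Sum>i\<in>I. C i * echar (n i) x) = (\<Sum>k\<in>n ` I. \<Sum>i\<in>{i\<in>I. n i = k}. C i * echar (n i) x)"
    using assms(1) by (rule sum.image_gen)
  also have "\<dots> = (\<Sum>k\<in>n ` I. (\<Sum>i\<in>{i\<in>I. n i = k}. C i) * echar k x)"
    by (intro sum.cong refl) (auto simp: sum_distrib_right)
  finally show "(\<Sum>i\<in>I. C i * echar (n i) x) = (\<Sum>k\<in>n ` I. (\<Sum>i\<in>{i\<in>I. n i = k}. C i) * echar k x)" .
qed (use assms in auto)

lemma trigpoly_monomial: "k \<in> int_lattice \<Longrightarrow> trigpoly (\<lambda>x. c * echar k x)"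
  using trigpoly_sum[of "{()}" "\<lambda>_. k" "\<lambda>_. c"] by simp

lemma trigpoly_const: "trigpoly (\<lambda>x. c)"
  using trigpoly_monomial[of 0 c] by (simp add: int_lattice_group echar_simps)

lemma trigpoly_mult:
  assumes "trigpoly f" "trigpoly g" shows "trigpoly (\<lambda>x. f x * g x)"
proof -
  obtain F t G s where F: "finite F" "F \<subseteq> int_lattice" "f = (\<lambda>x. \<Sum>k\<in>F. t k * echar k x)"
    and G: "finite G" "G \<subseteq> int_lattice" "g = (\<lambda>x. \<Sum>k\<in>G. s k * echar k x)"
    using assms unfolding trigpoly_def by blast
  have "(\<lambda>x. f x * g x) = (\<lambda>x. \<Sum>p\<in>F \<times> G. (t (fst p) * s (snd p)) * echar (fst p + snd p) x)"
    unfolding F G sum_product sum.cartesian_product by (intro ext sum.cong refl) (auto simp: echar_simps mult_ac)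
  then show ?thesis using F G by (simp only:) (intro trigpoly_sum, auto intro!: int_lattice_group)
qed

lemma trigpoly_add:
  assumes "trigpoly f" "trigpoly g" shows "trigpoly (\<lambda>x. f x + g x)"
proof -
  obtain F t G s where F: "finite F" "F \<subseteq> int_lattice" "f = (\<lambda>x. \<Sum>k\<in>F. t k * echar k x)"
    and G: "finite G" "G \<subseteq> int_lattice" "g = (\<lambda>x. \<Sum>k\<in>G. s k * echar k x)"
    using assms unfolding trigpoly_def by blast
  have "(\<lambda>x. f x + g x) = (\<lambda>x. \<Sum>p\<in>F <+> G. case_sum t s p * echar (case_sum id id p) x)"
    unfolding F G using F(1) G(1) by (simp add: sum.Plus)
  then show ?thesis using F G by (simp only:) (intro trigpoly_sum, auto)
qed

lemma trigpoly_power: "trigpoly f \<Longrightarrow> trigpoly (\<lambda>x. f x ^ n)"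
  by (induction n) (auto intro: trigpoly_mult trigpoly_const)

lemma trigpoly_coefficient:
  assumes "finite F" "F \<subseteq> int_lattice" "f = (\<lambda>x. \<Sum>k\<in>F. t k * echar k x)" "k \<in> F"
  shows "t k = (\<integral>x. indicator torus_domain x *\<^sub>R (f x * cnj (echar k x)) \<partial>lborel)"
proof -
  have i: "integrable lborel (\<lambda>x. indicator torus_domain x *\<^sub>R echar k x)" for k
    by (rule integrable_torus[where B=1]) (auto simp: echar_simps)
  have "(\<integral>x. indicator torus_domain x *\<^sub>R (f x * cnj (echar k x)) \<partial>lborel) =
      (\<integral>x. (\<Sum>l\<in>F. t l * (indicator torus_domain x *\<^sub>R echar (l - k) x)) \<partial>lborel)"
    unfolding assms(3) by (intro Bochner_Integration.integral_cong refl)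
      (simp add: sum_distrib_right sum_distrib_left scaleR_sum_right echar_simps mult_ac)
  also have "\<dots> = (\<Sum>l\<in>F. t l * (\<integral>x. (indicator torus_domain x *\<^sub>R echar (l - k) x) \<partial>lborel))"
    by (subst Bochner_Integration.integral_sum, intro integrable_mult_right i,
        intro sum.cong refl integral_mult_right_zero)
  also have "\<dots> = (\<Sum>l\<in>F. if l = k then t l else 0)"
    using assms by (intro sum.cong refl) (auto simp: integral_torus_echar int_lattice_group subset_iff)
  also have "\<dots> = t k" using assms by simp
  finally show ?thesis ..
qed

text \<open>
  The product of \<open>cos\<^sup>2 (\<pi> x\<^sub>i)\<close>: a trigonometric polynomial with values in \<open>{0..1}\<close> that equals 1 exactly
  on the integer lattice. Its powers are the summation kernels used below.
\<close>
definition peak :: "real^2 \<Rightarrow> real" where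
  "peak x = (1 + cos (2 * pi * x $ 1)) / 2 * ((1 + cos (2 * pi * x $ 2)) / 2)"

lemma trigpoly_peak_power: "trigpoly (\<lambda>x. of_real (peak (x - y) ^ n))"
proof -
  have one: "trigpoly (\<lambda>x. of_real ((1 + cos (2 * pi * (x - y) $ i)) / 2))" for i :: 2
  proof -
    have l: "axis i 1 \<in> int_lattice" by (auto simp: int_lattice_def axis_def)
    have "(\<lambda>x. of_real ((1 + cos (2 * pi * (x - y) $ i)) / 2)) =
       (\<lambda>x. (1/2) + (echar (axis i 1) (- y) / 4 * echar (axis i 1) x + echar (- axis i 1) (- y) / 4 * echar (- axis i 1) x))"
    proof
      fix x
      define \<theta> where "\<theta> = 2 * pi * (x - y) $ i"
      have "echar (axis i 1) (- y) * echar (axis i 1) x = cis \<theta>"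
        unfolding echar_simps(6)[symmetric] by (simp add: echar_def \<theta>_def inner_axis')
      moreover have "echar (- axis i 1) (- y) * echar (- axis i 1) x = cnj (cis \<theta>)"
        unfolding echar_simps(6)[symmetric] by (simp add: echar_def \<theta>_def inner_axis' cis_cnj algebra_simps)
      moreover have "of_real ((1 + cos \<theta>) / 2) = (1/2 :: complex) + (cis \<theta> / 4 + cnj (cis \<theta>) / 4)"
        by (simp add: complex_eq_iff field_simps)
      ultimately show "of_real ((1 + cos (2 * pi * (x - y) $ i)) / 2) =
         (1/2) + (echar (axis i 1) (- y) / 4 * echar (axis i 1) x + echar (- axis i 1) (- y) / 4 * echar (- axis i 1) x)"
        by (simp add: \<theta>_def)
    qed
    then show ?thesis
      by (simp only:) (intro trigpoly_add trigpoly_const trigpoly_monomial l int_lattice_group)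
  qed
  show ?thesis unfolding peak_def of_real_power of_real_mult by (intro trigpoly_power trigpoly_mult one)
qed

lemma one_plus_cos_half_bounds: fixes t :: real shows "0 \<le> (1 + cos t) / 2" "(1 + cos t) / 2 \<le> (1::real)"
  proof -
  define c where "c = cos t"
  have "- 1 \<le> c" "c \<le> 1" by (auto simp: c_def)
  then show "0 \<le> (1 + cos t) / 2" "(1 + cos t) / 2 \<le> 1" unfolding c_def[symmetric] by auto
qed

lemma peak_bounds: "0 \<le> peak x" "peak x \<le> 1"
proof -
  note b = one_plus_cos_half_bounds
  show "0 \<le> peak x" unfolding peak_def by (intro mult_nonneg_nonneg b)
  show "peak x \<le> 1" unfolding peak_def using b mult_le_one by blast
qed

lemma peak_periodic: "k \<in> int_lattice \<Longrightarrow> peak (x + k) = peak x"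
proof -
  assume "k \<in> int_lattice"
  then have "cos (2 * pi * (x + k) $ i) = cos (2 * pi * x $ i)" for i
  proof -
    obtain m where "k $ i = of_int m" using \<open>k \<in> int_lattice\<close> by (auto simp: int_lattice_def elim: Ints_cases)
    then have "2 * pi * (x + k) $ i = 2 * pi * x $ i + of_int m * (2 * pi)" by (simp add: algebra_simps)
    then show ?thesis by (simp only: cos_add) (simp add: mult.commute[of _ "2 * pi"] cos_int_2pin sin_int_2pin)
  qed
  then show ?thesis by (simp add: peak_def)
qed

lemma continuous_on_peak [continuous_intros]:
  fixes f :: "'a::t2_space \<Rightarrow> real^2"
  shows "continuous_on A f \<Longrightarrow> continuous_on A (\<lambda>x. peak (f x))"
  unfolding peak_def
proof -
  assume f: "continuous_on A f"
  have "continuous_on A (\<lambda>x. f x $ i)" for i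
    using f unfolding continuous_on_def by (auto intro: tendsto_vec_nth)
  then have "continuous_on A (\<lambda>x. cos (2 * pi * f x $ i))" for i
    by (intro continuous_on_cos continuous_on_mult continuous_on_const)
  then show "continuous_on A (\<lambda>x. (1 + cos (2 * pi * f x $ 1)) / 2 * ((1 + cos (2 * pi * f x $ 2)) / 2))"
    by (intro continuous_on_mult continuous_on_divide continuous_on_add continuous_on_const) auto
qed

lemma peak_eq_1: assumes "peak x = 1" "\<And>i. \<bar>x $ i\<bar> \<le> 1/2" shows "x = 0"
proof -
  note b = one_plus_cos_half_bounds
  have mul: "a = 1 \<and> b = 1" if "a * b = 1" "0 \<le> a" "a \<le> 1" "0 \<le> b" "b \<le> 1" for a b :: real
  proof -
    have "a * b \<le> a" "a * b \<le> b" using mult_left_mono[of b 1 a] mult_right_mono[of a 1 b] that by auto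
    then show ?thesis using that by linarith
  qed
  have "cos (2 * pi * x $ 1) = 1 \<and> cos (2 * pi * x $ 2) = 1"
    using mul[OF assms(1)[unfolded peak_def] b b] by (auto simp: field_simps)
  then have c: "cos (2 * pi * x $ i) = 1" for i using exhaust_2[of i] by auto
  have "x $ i = 0" for i
  proof -
    obtain m :: int where "2 * pi * x $ i = of_int m * 2 * pi" using c[of i] cos_one_2pi_int by blast
    then have "x $ i = of_int m" by simp
    moreover from this have "\<bar>real_of_int m\<bar> \<le> 1/2" using assms(2)[of i] by simp
    then have "m = 0" by linarith
    ultimately show ?thesis by simp
  qed
  then show ?thesis by (simp add: vec_eq_iff)
qed

lemma lattice_round: obtains k :: "real^2" where "k \<in> int_lattice" "\<And>i. \<bar>(x - k) $ i\<bar> \<le> 1/2"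
proof
  show "(\<chi> i. of_int (round (x $ i))) \<in> int_lattice" by (simp add: int_lattice_def)
  show "\<bar>(x - (\<chi> i. of_int (round (x $ i)))) $ i\<bar> \<le> 1/2" for i
    using of_int_round_abs_le[of "x $ i"] by (simp add: abs_minus_commute)
qed

lemma lattice_floor: obtains k :: "real^2" where "k \<in> int_lattice" "x - k \<in> torus_domain"
proof
  show "(\<chi> i. of_int \<lfloor>x $ i\<rfloor>) \<in> int_lattice" by (simp add: int_lattice_def)
  have "0 \<le> x $ i - of_int \<lfloor>x $ i\<rfloor>" "x $ i - of_int \<lfloor>x $ i\<rfloor> < 1" for i by linarith+
  then show "x - (\<chi> i. of_int \<lfloor>x $ i\<rfloor>) \<in> torus_domain" by (simp add: torus_domain_def)
qed

text \<open>
  After rounding to the nearest lattice point, \<open>peak\<close> is considered on a compact set that omits a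
  neighbourhood of the origin, and its maximum there is less than 1.
\<close>
lemma peak_concentrates:
  assumes \<kappa>: "0 < \<kappa>"
  obtains \<rho> where "0 \<le> \<rho>" "\<rho> < 1" "\<And>x. \<rho> < peak x \<Longrightarrow> \<exists>k\<in>int_lattice. norm (x - k) < \<kappa>"
proof -
  define Q where "Q = {x::real^2. \<forall>i. \<bar>x $ i\<bar> \<le> 1/2} \<inter> {x. \<kappa> \<le> norm x}"
  have "{x::real^2. \<forall>i. \<bar>x $ i\<bar> \<le> 1/2} = cbox (\<chi> i. -1/2) (\<chi> i. 1/2)"
  proof -
    have "\<bar>t\<bar> \<le> 1/2 \<longleftrightarrow> -1/2 \<le> t \<and> t \<le> 1/2" for t :: real by linarith
    then show ?thesis by (simp only: mem_box_cart set_eq_iff mem_Collect_eq vec_lambda_beta) simp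
  qed
  then have cQ: "compact Q" unfolding Q_def
    by (intro compact_Int_closed closed_Collect_le continuous_intros) auto
  have "\<exists>\<rho>\<ge>0. \<rho> < 1 \<and> (\<forall>x\<in>Q. peak x \<le> \<rho>)"
  proof (cases "Q = {}")
    case False
    obtain z where z: "z \<in> Q" "\<And>x. x \<in> Q \<Longrightarrow> peak x \<le> peak z"
      using continuous_attains_sup[OF cQ False continuous_on_peak[OF continuous_on_id]] by auto
    have "peak z \<noteq> 1" using z(1) peak_eq_1[of z] \<kappa> by (auto simp: Q_def)
    then show ?thesis using z peak_bounds[of z] by (intro exI[of _ "peak z"]) auto
  qed auto
  then obtain \<rho> where \<rho>: "0 \<le> \<rho>" "\<rho> < 1" "\<And>x. x \<in> Q \<Longrightarrow> peak x \<le> \<rho>" by blast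
  show ?thesis
  proof (rule that[OF \<rho>(1,2)])
    fix x assume x: "\<rho> < peak x"
    obtain k where k: "k \<in> int_lattice" "\<And>i. \<bar>(x - k) $ i\<bar> \<le> 1/2" using lattice_round by blast
    have "peak (x - k) = peak x" using peak_periodic[OF k(1), of "x - k"] by simp
    then have "x - k \<notin> Q" using \<rho>(3) x by fastforce
    then have "norm (x - k) < \<kappa>" using k by (auto simp: Q_def)
    then show "\<exists>k\<in>int_lattice. norm (x - k) < \<kappa>" using k by blast
  qed
qed

text \<open>
  A small box with lower left corner \<open>y\<close> stays inside the half-open unit square, even if \<open>y\<close> lies on its
  boundary.
\<close>
lemma torus_corner:
  assumes "y \<in> torus_domain" "0 < \<kappa>"
  obtains U where "U \<in> sets lborel" "U \<subseteq> torus_domain" "0 < measure lborel U" "\<And>x. x \<in> U \<Longrightarrow> norm (x - y) < \<kappa>"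
    "emeasure lborel U < \<infinity>"
proof -
  define u where "u = (\<chi> i. min 1 (y $ i + \<kappa> / 2))"
  have yu: "y $ i < u $ i" for i using assms by (auto simp: u_def torus_domain_def)
  show ?thesis
  proof (rule that[of "box y u"])
    show sub: "box y u \<subseteq> torus_domain" using assms(1)
      by (auto simp: mem_box_cart torus_domain_def u_def) (meson less_imp_le order.strict_trans1 order_le_less_trans)
    have "measure lborel (box y u) = (\<Prod>b\<in>Basis. (u - y) \<bullet> b)"
      by (rule measure_lborel_box) (auto simp: Basis_real2 inner_axis yu less_imp_le)
    also have "\<dots> > 0" by (rule prod_pos) (auto simp: Basis_real2 inner_axis yu)
    finally show "0 < measure lborel (box y u)" .
    show "norm (x - y) < \<kappa>" if x: "x \<in> box y u" for x
    proof -
      have "\<bar>(x - y) $ i\<bar> < \<kappa> / 2" for i using x by (auto simp: mem_box_cart u_def less_diff_eq dest!: spec[of _ i])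
      from this[of 1] this[of 2] show ?thesis using norm_le_l1_cart[of "x - y"] by (simp add: sum_2)
    qed
    show "emeasure lborel (box y u) < \<infinity>" using emeasure_lborel_box_finite[of y u] by (simp add: top.not_eq_extremum)
  qed auto
qed

text \<open>
  Let \<open>d\<close> be the difference of \<open>h\<close> and the partial sum. Testing \<open>d\<close> against the powers of \<open>peak\<close>
  centred at \<open>y0\<close> gives at most \<open>B\<close> times the integral of the power, because \<open>d\<close> has only the coefficients
  outside \<open>K\<close> and the coefficients of a nonnegative function are at most its integral. On the other
  hand the powers concentrate at \<open>y0\<close>, so the same integral is close to \<open>d y0\<close> times the integral of the
  power.
\<close>
lemma fourier_partial_sum_bound:
  fixes h :: "real^2 \<Rightarrow> complex"
  assumes cont: "continuous_on UNIV h" and per: "\<And>x k. k \<in> int_lattice \<Longrightarrow> h (x + k) = h x"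
    and a: "\<And>k. k \<in> int_lattice \<Longrightarrow> a k = (\<integral>x. indicator torus_domain x *\<^sub>R (h x * cnj (echar k x)) \<partial>lborel)"
    and K: "finite K" "K \<subseteq> int_lattice"
    and B: "\<And>K'. finite K' \<Longrightarrow> K' \<subseteq> int_lattice - K \<Longrightarrow> (\<Sum>k\<in>K'. norm (a k)) \<le> B"
  shows "norm (h y - (\<Sum>k\<in>K. a k * echar k y)) \<le> B"
proof (rule ccontr)
  assume neg: "\<not> ?thesis"
  define d where "d x = h x - (\<Sum>k\<in>K. a k * echar k x)" for x
  have dper: "d (x + k) = d x" if "k \<in> int_lattice" for x k
    unfolding d_def using per[OF that] K that by (simp add: echar_simps echar_lattice subset_iff)
  obtain k0 where k0: "k0 \<in> int_lattice" "y - k0 \<in> torus_domain" using lattice_floor by blast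
  define y0 where "y0 = y - k0"
  have y0: "y0 \<in> torus_domain" "B < norm (d y0)"
    using neg k0 dper[OF k0(1), of y0] by (auto simp: y0_def d_def)
  have dcont: "continuous_on UNIV d" unfolding d_def by (intro continuous_intros cont)
  have [measurable]: "d \<in> borel_measurable borel" using dcont by (rule borel_measurable_continuous_onI)
  have [measurable]: "h \<in> borel_measurable borel" using cont by (rule borel_measurable_continuous_onI)
  have "compact (d ` cbox 0 1)" by (intro compact_continuous_image continuous_on_subset[OF dcont]) auto
  then obtain M where M: "\<And>x. x \<in> cbox 0 1 \<Longrightarrow> norm (d x) \<le> M" by (meson bounded_iff compact_imp_bounded imageI)
  have "compact (h ` cbox 0 1)" by (intro compact_continuous_image continuous_on_subset[OF cont]) auto
  then obtain Mh where Mh: "\<And>x. x \<in> cbox 0 1 \<Longrightarrow> norm (h x) \<le> Mh" by (meson bounded_iff compact_imp_bounded imageI)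
  have M0: "0 \<le> M" using order_trans[OF norm_ge_zero M[of 0]] by (simp add: mem_box_cart)
  note MT = M[OF subsetD[OF torus_domain_subset]]
  define \<epsilon> where "\<epsilon> = (norm (d y0) - B) / 2"
  have \<epsilon>: "0 < \<epsilon>" using y0 by (simp add: \<epsilon>_def)
  have coef: "(\<integral>x. indicator torus_domain x *\<^sub>R (d x * cnj (echar k x)) \<partial>lborel) = (if k \<in> K then 0 else a k)"
    if k: "k \<in> int_lattice" for k
  proof -
    have i: "integrable lborel (\<lambda>x. indicator torus_domain x *\<^sub>R echar k x)" for k
      by (rule integrable_torus[where B=1]) (auto simp: echar_simps)
    have ih: "integrable lborel (\<lambda>x. indicator torus_domain x *\<^sub>R (h x * cnj (echar k x)))"
      by (rule integrable_torus[where B=Mh], measurable) (use Mh torus_domain_subset in \<open>auto simp: echar_simps norm_mult\<close>)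
    have "(\<integral>x. indicator torus_domain x *\<^sub>R (d x * cnj (echar k x)) \<partial>lborel) =
      (\<integral>x. indicator torus_domain x *\<^sub>R (h x * cnj (echar k x)) - (\<Sum>l\<in>K. a l * (indicator torus_domain x *\<^sub>R echar (l - k) x)) \<partial>lborel)"
      by (intro Bochner_Integration.integral_cong refl)
         (simp add: d_def left_diff_distrib right_diff_distrib sum_distrib_right sum_distrib_left scaleR_sum_right scaleR_diff_right echar_simps mult_ac)
    also have "\<dots> = a k - (\<Sum>l\<in>K. a l * (\<integral>x. (indicator torus_domain x *\<^sub>R echar (l - k) x) \<partial>lborel))"
      unfolding a[OF k]
      by (subst Bochner_Integration.integral_diff[OF ih], intro Bochner_Integration.integrable_sum integrable_mult_right i,
          subst Bochner_Integration.integral_sum, intro integrable_mult_right i)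
         (simp only: integral_mult_right_zero)
    also have "\<dots> = a k - (\<Sum>l\<in>K. if l = k then a l else 0)"
      using K k by (intro arg_cong2[where f=minus] refl sum.cong) (auto simp: integral_torus_echar int_lattice_group subset_iff)
    also have "\<dots> = (if k \<in> K then 0 else a k)" using K by simp
    finally show ?thesis .
  qed
  have "isCont d y0" using dcont by (simp add: continuous_on_eq_continuous_at)
  then obtain \<kappa> where \<kappa>: "0 < \<kappa>" "\<And>x. norm (x - y0) < \<kappa> \<Longrightarrow> norm (d x - d y0) < \<epsilon>"
    using \<epsilon> unfolding continuous_at_eps_delta dist_norm by blast
  obtain \<rho> where \<rho>: "0 \<le> \<rho>" "\<rho> < 1" "\<And>x. \<rho> < peak x \<Longrightarrow> \<exists>k\<in>int_lattice. norm (x - k) < \<kappa>"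
    using peak_concentrates[OF \<kappa>(1)] by blast
  have near: "norm (d x - d y0) < \<epsilon>" if h: "\<rho> < peak (x - y0)" for x
  proof -
    obtain k where k: "k \<in> int_lattice" "norm ((x - y0) - k) < \<kappa>" using \<rho>(3)[OF h] by blast
    have "norm (d (x - k) - d y0) < \<epsilon>" using k(2) by (intro \<kappa>(2)) (simp add: algebra_simps)
    then show ?thesis using dper[OF k(1), of "x - k"] by simp
  qed
  define \<sigma> where "\<sigma> = (1 + \<rho>) / 2"
  have \<sigma>: "\<rho> < \<sigma>" "\<sigma> < 1" "0 < \<sigma>" using \<rho> by (auto simp: \<sigma>_def)
  have "isCont peak 0" using continuous_on_peak[OF continuous_on_id, of UNIV] by (simp add: continuous_on_eq_continuous_at)
  moreover have "peak 0 = 1" by (simp add: peak_def)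
  ultimately obtain \<kappa>' where \<kappa>': "0 < \<kappa>'" "\<And>x. norm (x - 0) < \<kappa>' \<Longrightarrow> dist (peak x) 1 < 1 - \<sigma>"
    using \<sigma> unfolding continuous_at_eps_delta dist_norm by (metis diff_gt_0_iff_gt)
  obtain U where U: "U \<in> sets lborel" "U \<subseteq> torus_domain" "0 < measure lborel U" "\<And>x. x \<in> U \<Longrightarrow> norm (x - y0) < \<kappa>'" "emeasure lborel U < \<infinity>"
    using torus_corner[OF y0(1) \<kappa>'(1)] by blast
  have inU: "\<sigma> < peak (x - y0)" if "x \<in> U" for x
    using \<kappa>'(2)[of "x - y0"] U(4)[OF that] by (simp add: dist_real_def abs_if split: if_splits)
  have [measurable]: "(\<lambda>x. peak (x - y0)) \<in> borel_measurable borel"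
    by (intro borel_measurable_continuous_onI continuous_intros)
  define I where "I n = (\<integral>x. indicator torus_domain x *\<^sub>R (peak (x - y0) ^ n) \<partial>lborel)" for n
  have ip: "integrable lborel (\<lambda>x. indicator torus_domain x *\<^sub>R (peak (x - y0) ^ n))" for n
    by (rule integrable_torus[where B=1]) (auto simp: power_le_one peak_bounds)
  have main: "\<epsilon> * (measure lborel U * \<sigma> ^ n) \<le> 2 * M * \<rho> ^ n" for n
  proof -
    obtain F t where F: "finite F" "F \<subseteq> int_lattice" "(\<lambda>x. of_real (peak (x - y0) ^ n)) = (\<lambda>x. \<Sum>k\<in>F. t k * echar k x)"
      using trigpoly_peak_power[of y0 n] unfolding trigpoly_def by (elim exE conjE) (rule that)
    have tb: "norm (t k) \<le> I n" if "k \<in> F" for k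
    proof -
      have "t k = (\<integral>x. indicator torus_domain x *\<^sub>R (of_real (peak (x - y0) ^ n) * cnj (echar k x)) \<partial>lborel)"
        by (rule trigpoly_coefficient[OF F that])
      also have "norm \<dots> \<le> I n" unfolding I_def
      proof (rule Bochner_Integration.integral_norm_bound_integral[OF _ ip])
        show "integrable lborel (\<lambda>x. indicator torus_domain x *\<^sub>R (complex_of_real (peak (x - y0) ^ n) * cnj (echar k x)))"
          by (rule integrable_torus[where B=1], measurable) (auto simp: power_le_one peak_bounds norm_mult echar_simps norm_power)
        show "norm (indicator torus_domain x *\<^sub>R (complex_of_real (peak (x - y0) ^ n) * cnj (echar k x))) \<le> indicator torus_domain x *\<^sub>R (peak (x - y0) ^ n)" for x
          by (simp add: norm_mult echar_simps norm_power peak_bounds)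
      qed
      finally show ?thesis .
    qed
    have I0: "0 \<le> I n" unfolding I_def by (rule Bochner_Integration.integral_nonneg) (simp add: peak_bounds)
    have id: "integrable lborel (\<lambda>x. indicator torus_domain x *\<^sub>R (d x * of_real (peak (x - y0) ^ n)))"
    proof (rule integrable_torus[where B="M * 1"])
      show "norm (d x * of_real (peak (x - y0) ^ n)) \<le> M * 1" if "x \<in> torus_domain" for x
        unfolding norm_mult using MT[OF that] M0 by (intro mult_mono) (auto simp: norm_power peak_bounds power_le_one)
    qed measurable
    have idk: "integrable lborel (\<lambda>x. indicator torus_domain x *\<^sub>R (d x * cnj (echar k x)))" for k
      by (rule integrable_torus[where B="M"], measurable) (use MT in \<open>auto simp: norm_mult echar_simps\<close>)
    have "(\<integral>x. indicator torus_domain x *\<^sub>R (d x * of_real (peak (x - y0) ^ n)) \<partial>lborel) =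
      (\<integral>x. (\<Sum>k\<in>F. t k * (indicator torus_domain x *\<^sub>R (d x * cnj (echar (- k) x)))) \<partial>lborel)"
      unfolding fun_cong[OF F(3)]
      by (intro Bochner_Integration.integral_cong refl) (simp add: sum_distrib_left scaleR_sum_right echar_simps mult_ac)
    also have "\<dots> = (\<Sum>k\<in>F. t k * (\<integral>x. indicator torus_domain x *\<^sub>R (d x * cnj (echar (- k) x)) \<partial>lborel))"
      by (subst Bochner_Integration.integral_sum, intro integrable_mult_right idk) (simp only: integral_mult_right_zero)
    also have "\<dots> = (\<Sum>k\<in>F. t k * (if - k \<in> K then 0 else a (- k)))"
      using F(2) by (intro sum.cong refl arg_cong2[where f=times] coef) (auto intro!: int_lattice_group)
    also have "norm \<dots> \<le> (\<Sum>k\<in>F. I n * norm (if - k \<in> K then 0 else a (- k)))"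
      by (intro sum_norm_le) (simp only: norm_mult, intro mult_right_mono tb, auto)
    also have "\<dots> = I n * (\<Sum>k\<in>F. if - k \<in> K then 0 else norm (a (- k)))"
      by (simp add: sum_distrib_left if_distrib cong: if_cong)
    also have "(\<Sum>k\<in>F. if - k \<in> K then 0 else norm (a (- k))) = (\<Sum>k\<in>{k\<in>F. - k \<notin> K}. norm (a (- k)))"
      using F(1) by (auto simp: sum.inter_filter intro!: sum.cong)
    also have "\<dots> = (\<Sum>k\<in>uminus ` {k\<in>F. - k \<notin> K}. norm (a k))" by (subst sum.reindex) auto
    also have "I n * \<dots> \<le> I n * B"
      using F by (intro mult_left_mono[OF B I0]) (auto intro!: int_lattice_group)
    finally have 1: "norm (\<integral>x. indicator torus_domain x *\<^sub>R (d x * of_real (peak (x - y0) ^ n)) \<partial>lborel) \<le> I n * B" .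
    have icst: "integrable lborel (\<lambda>x. indicator torus_domain x *\<^sub>R (d y0 * of_real (peak (x - y0) ^ n)))"
      by (rule integrable_torus[where B="norm (d y0)"], measurable)
         (auto simp: norm_mult norm_power peak_bounds power_le_one mult_left_le)
    have itor: "integrable lborel (\<lambda>x. indicator torus_domain x *\<^sub>R (2 * M * \<rho> ^ n))"
      by (rule integrable_torus[where B="2 * M * \<rho> ^ n"]) (use M0 \<rho> in auto)
    have "norm ((\<integral>x. indicator torus_domain x *\<^sub>R (d y0 * of_real (peak (x - y0) ^ n)) \<partial>lborel) - (\<integral>x. indicator torus_domain x *\<^sub>R (d x * of_real (peak (x - y0) ^ n)) \<partial>lborel))
       \<le> (\<integral>x. \<epsilon> * (indicator torus_domain x *\<^sub>R (peak (x - y0) ^ n)) + indicator torus_domain x *\<^sub>R (2 * M * \<rho> ^ n) \<partial>lborel)"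
      unfolding Bochner_Integration.integral_diff[OF icst id, symmetric]
    proof (rule Bochner_Integration.integral_norm_bound_integral)
      fix x
      show "norm (indicator torus_domain x *\<^sub>R (d y0 * of_real (peak (x - y0) ^ n)) - indicator torus_domain x *\<^sub>R (d x * of_real (peak (x - y0) ^ n)))
        \<le> \<epsilon> * (indicator torus_domain x *\<^sub>R (peak (x - y0) ^ n)) + indicator torus_domain x *\<^sub>R (2 * M * \<rho> ^ n)"
      proof (cases "x \<in> torus_domain")
        case True
        have "norm (d y0 - d x) * peak (x - y0) ^ n \<le> \<epsilon> * peak (x - y0) ^ n + 2 * M * \<rho> ^ n"
        proof (cases "\<rho> < peak (x - y0)")
          case True
          have "norm (d y0 - d x) * peak (x - y0) ^ n \<le> \<epsilon> * peak (x - y0) ^ n"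
            using near[OF True] by (intro mult_right_mono) (auto simp: norm_minus_commute peak_bounds)
          moreover have "0 \<le> 2 * M * \<rho> ^ n" using M0 \<rho> by simp
          ultimately show ?thesis by linarith
        next
          case False
          have "norm (d y0 - d x) \<le> 2 * M" using norm_triangle_ineq4[of "d y0" "d x"] MT[OF y0(1)] MT[OF \<open>x \<in> torus_domain\<close>] by simp
          then have "norm (d y0 - d x) * peak (x - y0) ^ n \<le> 2 * M * \<rho> ^ n"
            using False M0 by (intro mult_mono power_mono) (auto simp: peak_bounds)
          moreover have "0 \<le> \<epsilon> * peak (x - y0) ^ n" using \<epsilon> by (simp add: peak_bounds)
          ultimately show ?thesis by linarith
        qed
        then show ?thesis using True by (simp add: left_diff_distrib[symmetric] norm_mult norm_power peak_bounds)
      qed simp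
    qed (intro Bochner_Integration.integrable_diff Bochner_Integration.integrable_add integrable_mult_right icst id ip itor)+
    also have "\<dots> = \<epsilon> * I n + 2 * M * \<rho> ^ n * measure lborel torus_domain"
      by (subst Bochner_Integration.integral_add, intro integrable_mult_right ip, rule itor) (simp add: I_def)
    also have "measure lborel torus_domain = 1"
    proof -
      have "complex_of_real (measure lborel torus_domain) = 1"
        using integral_torus_echar[of 0] by (simp add: int_lattice_group echar_simps scaleR_conv_of_real)
      then show ?thesis by simp
    qed
    also have "(\<integral>x. indicator torus_domain x *\<^sub>R (d y0 * of_real (peak (x - y0) ^ n)) \<partial>lborel) = d y0 * of_real (I n)"
    proof -
      have "(\<integral>x. indicator torus_domain x *\<^sub>R (d y0 * of_real (peak (x - y0) ^ n)) \<partial>lborel)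
         = (\<integral>x. d y0 * of_real (indicator torus_domain x *\<^sub>R (peak (x - y0) ^ n)) \<partial>lborel)"
        by (intro Bochner_Integration.integral_cong refl) (simp add: scaleR_conv_of_real mult_ac)
      also have "\<dots> = d y0 * of_real (I n)" unfolding I_def integral_mult_right_zero integral_complex_of_real ..
      finally show ?thesis .
    qed
    finally have 2: "norm (d y0 * of_real (I n) - (\<integral>x. indicator torus_domain x *\<^sub>R (d x * of_real (peak (x - y0) ^ n)) \<partial>lborel)) \<le> \<epsilon> * I n + 2 * M * \<rho> ^ n"
      by simp
    have "norm (d y0) * I n = norm (d y0 * of_real (I n))" using I0 by (simp add: norm_mult)
    also have "\<dots> \<le> norm (d y0 * of_real (I n) - (\<integral>x. indicator torus_domain x *\<^sub>R (d x * of_real (peak (x - y0) ^ n)) \<partial>lborel)) +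
       norm (\<integral>x. indicator torus_domain x *\<^sub>R (d x * of_real (peak (x - y0) ^ n)) \<partial>lborel)"
      by (subst add.commute) (rule norm_triangle_sub)
    also have "\<dots> \<le> (\<epsilon> * I n + 2 * M * \<rho> ^ n) + I n * B" using 1 2 by (rule add_mono[rotated])
    finally have "\<epsilon> * I n \<le> 2 * M * \<rho> ^ n" by (simp add: \<epsilon>_def field_simps)
    moreover have "measure lborel U * \<sigma> ^ n \<le> I n"
    proof -
      have "measure lborel U * \<sigma> ^ n = (\<integral>x. indicator U x *\<^sub>R (\<sigma> ^ n) \<partial>lborel)" by simp
      also have "\<dots> \<le> I n" unfolding I_def
      proof (rule integral_mono'[OF ip])
        fix x
        show "indicator U x *\<^sub>R \<sigma> ^ n \<le> indicator torus_domain x *\<^sub>R peak (x - y0) ^ n"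
        proof (cases "x \<in> U")
          case True
          then have "\<sigma> ^ n \<le> peak (x - y0) ^ n" using inU[of x] \<sigma> by (intro power_mono) auto
          then show ?thesis using True U(2) by auto
        qed (simp add: peak_bounds)
      qed (simp add: peak_bounds)
      finally show ?thesis .
    qed
    ultimately show ?thesis using \<epsilon> by (meson mult_left_mono less_imp_le order_trans)
  qed
  have "(\<lambda>n. (\<rho> / \<sigma>) ^ n) \<longlonglongrightarrow> 0" using \<rho> \<sigma> by (intro LIMSEQ_realpow_zero) (auto simp: field_simps)
  then have "(\<lambda>n. 2 * M * (\<rho> / \<sigma>) ^ n) \<longlonglongrightarrow> 2 * M * 0" by (rule tendsto_mult[OF tendsto_const])
  then have "(\<lambda>n. 2 * M * (\<rho> / \<sigma>) ^ n) \<longlonglongrightarrow> 0" by simp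
  moreover have "\<epsilon> * measure lborel U \<le> 2 * M * (\<rho> / \<sigma>) ^ n" for n
    using main[of n] \<sigma> by (simp add: power_divide field_simps)
  ultimately have "\<epsilon> * measure lborel U \<le> 0" by (intro LIMSEQ_le_const) auto
  then show False using \<epsilon> U(3) by (simp add: mult_le_0_iff)
qed

section \<open>Smoothed lattice point counts\<close>

definition lattice_sum :: "(real^2 \<Rightarrow> real) \<Rightarrow> real^2 \<Rightarrow> real" where
  "lattice_sum f y = (\<Sum>\<^sub>\<infinity>k\<in>int_lattice. f (k + y))"

lemma finite_lattice_ball: "finite {k\<in>int_lattice. norm k \<le> M}"
proof -
  define N where "N = \<lceil>M\<rceil>"
  have "{k\<in>int_lattice. norm k \<le> M} \<subseteq> (\<lambda>(i, j). vec2 (of_int i, of_int j)) ` ({-N..N} \<times> {-N..N})"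
  proof
    fix k :: "real^2" assume "k \<in> {k\<in>int_lattice. norm k \<le> M}"
    then have k: "k \<in> int_lattice" "norm k \<le> M" by auto
    obtain i j where ij: "k $ 1 = of_int i" "k $ 2 = of_int j"
      using k(1) unfolding int_lattice_def by (metis (mono_tags, lifting) Ints_cases mem_Collect_eq)
    have "\<bar>k $ 1\<bar> \<le> M" "\<bar>k $ 2\<bar> \<le> M" using component_le_norm_cart[of k] k(2) order_trans by blast+
    then have "\<bar>i\<bar> \<le> N" "\<bar>j\<bar> \<le> N" unfolding ij N_def by linarith+
    moreover have "k = vec2 (of_int i, of_int j)" by (simp add: vec_eq_iff forall_2 ij)
    ultimately show "k \<in> (\<lambda>(i, j). vec2 (of_int i, of_int j)) ` ({-N..N} \<times> {-N..N})" by (auto simp: abs_le_iff)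
  qed
  then show ?thesis by (rule finite_subset) auto
qed

lemma lattice_sum_finite:
  assumes supp: "\<And>x. M < norm x \<Longrightarrow> f x = 0" and y: "norm y \<le> Y"
  shows "lattice_sum f y = (\<Sum>k\<in>{k\<in>int_lattice. norm k \<le> M + Y}. f (k + y))"
proof -
  have "lattice_sum f y = infsum (\<lambda>k. f (k + y)) {k\<in>int_lattice. norm k \<le> M + Y}"
    unfolding lattice_sum_def
  proof (rule infsum_cong_neutral)
    fix k assume k: "k \<in> int_lattice - {k\<in>int_lattice. norm k \<le> M + Y}"
    have "norm k \<le> norm (k + y) + norm y" using norm_triangle_ineq4[of "k + y" y] by simp
    then show "f (k + y) = 0" using k y by (intro supp) auto
  qed auto
  then show ?thesis using finite_lattice_ball by simp
qed

lemma lattice_sum_mono: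
  assumes "\<And>x. M < norm x \<Longrightarrow> f x = 0" "\<And>x. M < norm x \<Longrightarrow> g x = 0" "\<And>x. f x \<le> g x"
  shows "lattice_sum f y \<le> lattice_sum g y"
  using assms by (simp add: lattice_sum_finite[of M _ y "norm y"] sum_mono)

lemma lattice_sum_periodic:
  assumes "m \<in> int_lattice" shows "lattice_sum f (y + m) = lattice_sum f y"
proof -
  have "bij_betw (\<lambda>k. k + m) int_lattice int_lattice"
    by (rule bij_betwI[of _ _ _ "\<lambda>k. k - m"]) (use assms in \<open>auto intro: int_lattice_group\<close>)
  from infsum_reindex_bij_betw[OF this, of "\<lambda>k. f (k + y)"] show ?thesis
    by (simp add: lattice_sum_def add_ac)
qed

lemma continuous_on_lattice_sum:
  assumes supp: "\<And>x. M < norm x \<Longrightarrow> f x = 0" and cont: "continuous_on UNIV f"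
  shows "continuous_on UNIV (lattice_sum f)"
proof -
  have "continuous_on (ball 0 Y) (lattice_sum f)" for Y
  proof -
    have "continuous_on (ball 0 Y) (\<lambda>y. \<Sum>k\<in>{k\<in>int_lattice. norm k \<le> M + Y}. f (k + y))"
      by (intro continuous_on_sum continuous_on_compose2[OF cont] continuous_intros) auto
    then show ?thesis by (rule continuous_on_eq) (simp add: lattice_sum_finite[of M f _ Y, OF supp])
  qed
  then have "continuous_on (\<Union>Y. ball 0 Y) (lattice_sum f)" by (intro continuous_on_open_UN) auto
  moreover have "(\<Union>Y. ball (0::real^2) Y) = UNIV" by (auto intro: gt_ex)
  ultimately show ?thesis by simp
qed

lemma integral_translate:
  fixes f :: "real^2 \<Rightarrow> 'a::{banach, second_countable_topology}"
  assumes [measurable]: "f \<in> borel_measurable borel"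
  shows "(\<integral>x. f (x + c) \<partial>lborel) = (\<integral>x. f x \<partial>lborel)"
proof -
  have "(\<integral>x. f x \<partial>lborel) = (\<integral>x. f x \<partial>distr lborel borel ((+) c))" by (simp add: lborel_distr_plus)
  also have "\<dots> = (\<integral>x. f (c + x) \<partial>lborel)" by (rule integral_distr) auto
  finally show ?thesis by (simp add: add.commute)
qed

lemma torus_unique:
  assumes "k \<in> int_lattice" "l \<in> int_lattice" "x - k \<in> torus_domain" "x - l \<in> torus_domain" shows "k = l"
proof -
  have "k $ i = l $ i" for i
  proof -
    obtain m n where mn: "k $ i = of_int m" "l $ i = of_int n"
      using assms(1,2) unfolding int_lattice_def by (metis (mono_tags, lifting) Ints_cases mem_Collect_eq)
    have "0 \<le> x $ i - k $ i" "x $ i - k $ i < 1" "0 \<le> x $ i - l $ i" "x $ i - l $ i < 1"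
      using assms(3,4) by (auto simp: torus_domain_def)
    then have "real_of_int m < real_of_int n + 1" "real_of_int n < real_of_int m + 1" unfolding mn by linarith+
    then have "m = n" by linarith
    then show ?thesis using mn by simp
  qed
  then show ?thesis by (simp add: vec_eq_iff)
qed

lemma norm_torus: "x \<in> torus_domain \<Longrightarrow> norm x \<le> 2"
proof -
  assume x: "x \<in> torus_domain"
  have "norm x \<le> \<bar>x $ 1\<bar> + \<bar>x $ 2\<bar>" using norm_le_l1_cart[of x] by (simp add: sum_2)
  moreover have "\<bar>x $ i\<bar> \<le> 1" for i using x by (auto simp: torus_domain_def less_imp_le)
  from this[of 1] this[of 2] have "\<bar>x $ 1\<bar> + \<bar>x $ 2\<bar> \<le> 2" by linarith
  ultimately show ?thesis by linarith
qed

text \<open>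
  The translates of the fundamental domain tile the plane, and \<open>echar k\<close> has period 1 in both
  coordinates.
\<close>
lemma fourier_coefficient_lattice_sum:
  fixes f :: "real^2 \<Rightarrow> real"
  assumes supp: "\<And>x. M < norm x \<Longrightarrow> f x = 0" and cont: "continuous_on UNIV f" and k: "k \<in> int_lattice"
  shows "(\<integral>y. indicator torus_domain y *\<^sub>R (of_real (lattice_sum f y) * cnj (echar k y)) \<partial>lborel) =
    (\<integral>x. of_real (f x) * cnj (echar k x) \<partial>lborel)"
proof -
  define F where "F x = of_real (f x) * cnj (echar k x)" for x
  have [measurable]: "f \<in> borel_measurable borel" using cont by (rule borel_measurable_continuous_onI)
  have Fm [measurable]: "F \<in> borel_measurable borel" unfolding F_def[abs_def] by measurable
  define L where "L = {m\<in>int_lattice. norm m \<le> M + 2}"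
  have finL: "finite L" unfolding L_def by (rule finite_lattice_ball)
  have Fper: "of_real (f (m + y)) * cnj (echar k y) = F (y + m)" if "m \<in> L" for m y
    using that k by (simp add: F_def L_def echar_simps echar_lattice add.commute)
  have int: "integrable lborel (\<lambda>y. indicator torus_domain y *\<^sub>R F (y + m))" for m
  proof -
    have cF: "continuous_on UNIV F" unfolding F_def by (intro continuous_intros cont)
    have "compact ((\<lambda>y. F (y + m)) ` cbox 0 1)"
      by (intro compact_continuous_image continuous_on_compose2[OF cF] continuous_intros) auto
    then obtain B where "\<And>x. x \<in> cbox 0 1 \<Longrightarrow> norm (F (x + m)) \<le> B" by (meson bounded_iff compact_imp_bounded imageI)
    then show ?thesis using torus_domain_subset by (intro integrable_torus[where B=B]) (measurable, auto)
  qed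
  have "(\<integral>y. indicator torus_domain y *\<^sub>R (of_real (lattice_sum f y) * cnj (echar k y)) \<partial>lborel) =
     (\<integral>y. (\<Sum>m\<in>L. indicator torus_domain y *\<^sub>R F (y + m)) \<partial>lborel)"
  proof (rule Bochner_Integration.integral_cong[OF refl])
    fix y
    show "indicator torus_domain y *\<^sub>R (of_real (lattice_sum f y) * cnj (echar k y)) = (\<Sum>m\<in>L. indicator torus_domain y *\<^sub>R F (y + m))"
    proof (cases "y \<in> torus_domain")
      case True
      have "of_real (lattice_sum f y) * cnj (echar k y) = (\<Sum>m\<in>L. of_real (f (m + y)) * cnj (echar k y))"
        using lattice_sum_finite[of M f y 2, OF supp] norm_torus[OF True] by (simp add: L_def sum_distrib_right)
      also have "\<dots> = (\<Sum>m\<in>L. F (y + m))" by (rule sum.cong[OF refl Fper])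
      finally show ?thesis using True by simp
    qed simp
  qed
  also have "\<dots> = (\<Sum>m\<in>L. (\<integral>y. indicator torus_domain y *\<^sub>R F (y + m) \<partial>lborel))"
    by (rule Bochner_Integration.integral_sum) (rule int)
  also have "\<dots> = (\<Sum>m\<in>L. (\<integral>x. indicator torus_domain (x - m) *\<^sub>R F x \<partial>lborel))"
  proof (rule sum.cong[OF refl])
    fix m
    show "(\<integral>y. indicator torus_domain y *\<^sub>R F (y + m) \<partial>lborel) = (\<integral>x. indicator torus_domain (x - m) *\<^sub>R F x \<partial>lborel)"
      using integral_translate[of "\<lambda>x. indicator torus_domain (x - m) *\<^sub>R F x" m] by simp
  qed
  also have "\<dots> = (\<integral>x. (\<Sum>m\<in>L. indicator torus_domain (x - m) *\<^sub>R F x) \<partial>lborel)"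
  proof (rule Bochner_Integration.integral_sum[symmetric])
    fix m
    have "integrable (distr lborel borel ((+) (-m))) (\<lambda>y. indicator torus_domain y *\<^sub>R F (y + m))"
      using int[of m] by (simp add: lborel_distr_plus)
    then show "integrable lborel (\<lambda>x. indicator torus_domain (x - m) *\<^sub>R F x)"
      by (subst (asm) integrable_distr_eq) auto
  qed
  also have "\<dots> = (\<integral>x. F x \<partial>lborel)"
  proof (rule Bochner_Integration.integral_cong[OF refl])
    fix x
    show "(\<Sum>m\<in>L. indicator torus_domain (x - m) *\<^sub>R F x) = F x"
    proof (cases "M < norm x")
      case True then show ?thesis by (simp add: F_def supp)
    next
      case False
      obtain m where m: "m \<in> int_lattice" "x - m \<in> torus_domain" using lattice_floor by blast
      have "norm m \<le> norm x + norm (x - m)" using norm_triangle_ineq4[of x "x - m"] by simp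
      then have mL: "m \<in> L" using m norm_torus[OF m(2)] False by (simp add: L_def)
      have "(\<Sum>m\<in>L. indicator torus_domain (x - m) *\<^sub>R F x) = (\<Sum>l\<in>L. if l = m then F x else 0)"
      proof (rule sum.cong[OF refl])
        fix l assume "l \<in> L"
        then have "l \<in> int_lattice" by (simp add: L_def)
        then have "x - l \<in> torus_domain \<longleftrightarrow> l = m" using m torus_unique by blast
        then show "indicator torus_domain (x - l) *\<^sub>R F x = (if l = m then F x else 0)"
          by (cases "l = m") (simp_all add: indicator_def)
      qed
      then show ?thesis using mL finL by simp
    qed
  qed
  finally show ?thesis by (simp add: F_def)
qed

context ellipse begin

text \<open>
  The convolution of the indicator function of \<open>disc s\<close> with the normalized indicator function of
  \<open>disc \<delta>\<close>. Its Fourier transform decays like the cube of the inverse frequency, whereas the power of the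
  decay for \<open>disc s\<close> itself is only \<open>3/2\<close>, which is not summable over a plane lattice.
\<close>
definition overlap :: "real \<Rightarrow> real \<Rightarrow> real^2 \<Rightarrow> real" where
  "overlap s \<delta> y = measure lborel (disc \<delta> \<inter> (\<lambda>z. y + z) -` disc s) / measure lborel (disc \<delta>)"

lemma shift_disc_measurable [measurable]: "(\<lambda>z. y + z) -` disc s \<in> sets borel"
  by (intro borel_closed closed_vimage disc_closed continuous_intros)

lemma disc_fmeasurable: "A \<in> sets borel \<Longrightarrow> disc \<delta> \<inter> A \<in> fmeasurable lborel"
  using emeasure_disc_finite[of \<delta>] emeasure_mono[of "disc \<delta> \<inter> A" "disc \<delta>" lborel]
  by (intro fmeasurableI) (auto simp: order.strict_trans1)

lemma measure_disc_pos: "0 < s \<Longrightarrow> 0 < measure lborel (disc s)"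
  using ab semicircle_ft_0 by (simp add: measure_disc)

lemma overlap_bounds:
  assumes "0 < \<delta>"
  shows "0 \<le> overlap s \<delta> y" "overlap s \<delta> y \<le> 1" "s + \<delta> < q y \<Longrightarrow> overlap s \<delta> y = 0" "q y + \<delta> \<le> s \<Longrightarrow> overlap s \<delta> y = 1"
proof -
  note p = measure_disc_pos[OF assms]
  show "0 \<le> overlap s \<delta> y" by (simp add: overlap_def)
  have "measure lborel (disc \<delta> \<inter> (\<lambda>z. y + z) -` disc s) \<le> measure lborel (disc \<delta>)"
    using disc_fmeasurable[of "(\<lambda>z. y + z) -` disc s" \<delta>] disc_fmeasurable[of UNIV \<delta>] by (intro measure_mono_fmeasurable) auto
  then show "overlap s \<delta> y \<le> 1" using p by (simp add: overlap_def)
  show "overlap s \<delta> y = 0" if h: "s + \<delta> < q y"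
  proof -
    have "z \<notin> disc \<delta> \<or> y + z \<notin> disc s" for z
      using q_triangle[of "y + z" "- z"] h by (auto simp: disc_def q_minus)
    then have "disc \<delta> \<inter> (\<lambda>z. y + z) -` disc s = {}" by blast
    then show ?thesis by (simp add: overlap_def)
  qed
  show "overlap s \<delta> y = 1" if h: "q y + \<delta> \<le> s"
  proof -
    have "y + z \<in> disc s" if "z \<in> disc \<delta>" for z
      using q_triangle[of y z] h that by (auto simp: disc_def)
    then have "disc \<delta> \<inter> (\<lambda>z. y + z) -` disc s = disc \<delta>" by blast
    then show ?thesis using p by (simp add: overlap_def)
  qed
qed

text \<open>
  Moving the centre by a vector of \<open>q\<close>-length \<open>\<eta>\<close> keeps the moved disc inside \<open>disc (s + \<eta>)\<close> around the
  old centre, so the overlap grows by at most the area of a ring.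
\<close>
lemma overlap_diff:
  assumes "0 < \<delta>" "0 < s"
  shows "overlap s \<delta> y' \<le> overlap s \<delta> y + (measure lborel (disc (s + q (y - y'))) - measure lborel (disc s)) / measure lborel (disc \<delta>)"
proof -
  define \<eta> where "\<eta> = q (y - y')"
  have \<eta>: "0 \<le> \<eta>" by (simp add: \<eta>_def q_nonneg)
  define A where "A = disc \<delta> \<inter> (\<lambda>z. y + z) -` disc s"
  define A' where "A' = disc \<delta> \<inter> (\<lambda>z. y' + z) -` disc s"
  define B where "B = (\<lambda>z. y + z) -` (disc (s + \<eta>) - disc s)"
  have dsub: "disc s \<subseteq> disc (s + \<eta>)" using \<eta> by (auto simp: disc_def)
  have fm: "disc t \<in> fmeasurable lborel" for t using disc_fmeasurable[of UNIV t] by simp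
  have "A' \<subseteq> A \<union> B"
  proof
    fix z assume z: "z \<in> A'"
    have "q (y + z) \<le> q (y' + z) + \<eta>" proof -
      have e: "(y' + z) + (y - y') = y + z" by simp
      show ?thesis using q_triangle[of "y' + z" "y - y'"] unfolding e \<eta>_def .
    qed
    then show "z \<in> A \<union> B" using z by (auto simp: A_def A'_def B_def disc_def)
  qed
  have sB: "(\<lambda>z. z + y) ` B = disc (s + \<eta>) - disc s"
    unfolding B_def by (force simp: image_iff add.commute intro: bexI[of _ "_ - y"])
  have Bb: "B \<in> sets borel"
  proof -
    have "B = (\<lambda>z. y + z) -` disc (s + \<eta>) - (\<lambda>z. y + z) -` disc s" by (auto simp: B_def)
    then show ?thesis by (simp add: shift_disc_measurable)
  qed
  have eB: "emeasure lborel B = emeasure lborel (disc (s + \<eta>) - disc s)"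
  proof -
    have "emeasure lborel (disc (s + \<eta>) - disc s) = emeasure (distr lborel borel ((+) y)) (disc (s + \<eta>) - disc s)"
      by (simp add: lborel_distr_plus)
    also have "\<dots> = emeasure lborel B" by (subst emeasure_distr) (auto simp: B_def)
    finally show ?thesis ..
  qed
  have fd: "disc (s + \<eta>) - disc s \<in> fmeasurable lborel" using fm by (intro fmeasurable.Diff)
  have fB: "B \<in> fmeasurable lborel" using fmeasurableD2[OF fd] Bb eB by (intro fmeasurableI) (auto simp: top.not_eq_extremum)
  have "measure lborel A' \<le> measure lborel (A \<union> B)"
    using \<open>A' \<subseteq> A \<union> B\<close> disc_fmeasurable fB by (intro measure_mono_fmeasurable) (auto simp: A_def A'_def intro!: fmeasurable.Un)
  also have "\<dots> \<le> measure lborel A + measure lborel B"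
    using disc_fmeasurable fB by (intro measure_Un_le) (auto simp: A_def)
  also have "measure lborel B = measure lborel (disc (s + \<eta>)) - measure lborel (disc s)"
  proof -
    have "measure lborel B = measure lborel (disc (s + \<eta>) - disc s)" by (simp add: measure_def eB)
    also have "\<dots> = measure lborel (disc (s + \<eta>)) - measure lborel (disc s)"
      using dsub fm by (intro measure_Diff) (auto dest: fmeasurableD2)
    finally show ?thesis .
  qed
  finally have "measure lborel A' \<le> measure lborel A + (measure lborel (disc (s + \<eta>)) - measure lborel (disc s))" .
  then have "measure lborel A' / measure lborel (disc \<delta>) \<le> (measure lborel A + (measure lborel (disc (s + \<eta>)) - measure lborel (disc s))) / measure lborel (disc \<delta>)"
    by (rule divide_right_mono) simp
  then show ?thesis by (simp add: overlap_def A_def A'_def \<eta>_def add_divide_distrib)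
qed

lemma continuous_on_overlap:
  assumes "0 < \<delta>" "0 < s"
  shows "continuous_on UNIV (overlap s \<delta>)"
proof -
  define C where "C = 2 * a * b * semicircle_ft 0 / measure lborel (disc \<delta>)"
  define \<omega> where "\<omega> \<eta> = C * ((s + \<eta>)\<^sup>2 - s\<^sup>2)" for \<eta>
  have o: "(measure lborel (disc (s + q z)) - measure lborel (disc s)) / measure lborel (disc \<delta>) = \<omega> (q z)" for z
    using assms q_nonneg[of z] by (simp add: measure_disc \<omega>_def C_def add_pos_nonneg field_simps)
  have bd: "\<bar>overlap s \<delta> y' - overlap s \<delta> y\<bar> \<le> \<omega> (q (y' - y))" for y y'
    using overlap_diff[OF assms, of y' y] overlap_diff[OF assms, of y y'] q_minus[of "y - y'"] unfolding o by auto
  have "isCont (overlap s \<delta>) y" for y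
  proof -
    have c: "continuous_on UNIV (\<lambda>y'. \<omega> (q (y' - y)))" unfolding \<omega>_def by (intro continuous_intros)
    then have "isCont (\<lambda>y'. \<omega> (q (y' - y))) y" by (simp add: continuous_on_eq_continuous_at)
    then have "((\<lambda>y'. \<omega> (q (y' - y))) \<longlongrightarrow> \<omega> (q (y - y))) (at y)" unfolding isCont_def .
    moreover have "\<omega> (q (y - y)) = 0" by (simp add: \<omega>_def q_def complex_eq_iff cmod_def)
    ultimately have t: "((\<lambda>y'. \<omega> (q (y' - y))) \<longlongrightarrow> 0) (at y)" by simp
    have "((\<lambda>y'. overlap s \<delta> y' - overlap s \<delta> y) \<longlongrightarrow> 0) (at y)"
      by (rule Lim_null_comparison[OF _ t]) (use bd in \<open>auto intro!: always_eventually\<close>)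
    then show ?thesis unfolding isCont_def by (simp add: LIM_zero_iff)
  qed
  then show ?thesis by (simp add: continuous_on_eq_continuous_at)
qed

lemma overlap_support:
  assumes "0 < \<delta>" "(a + b) * (s + \<delta>) < norm x" shows "overlap s \<delta> x = 0"
proof (rule overlap_bounds(3)[OF assms(1)])
  have "(a + b) * (s + \<delta>) < (a + b) * q x" using assms(2) q_ge[of x] by linarith
  then show "s + \<delta> < q x" using ab by (simp add: mult_less_cancel_left)
qed

text \<open>
  The Fourier transform of a convolution is the product of the Fourier transforms.
\<close>
lemma overlap_transform:
  assumes "0 < \<delta>" "0 < s"
  shows "(\<integral>y. of_real (overlap s \<delta> y) * cnj (echar k y) \<partial>lborel) =
    of_real (s\<^sup>2 * (2 * a * b) * semicircle_ft (s * norm (freq k)) * semicircle_ft (\<delta> * norm (freq k)) / semicircle_ft 0)"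
proof -
  define V where "V = measure lborel (disc \<delta>)"
  have V: "V > 0" using measure_disc_pos[OF assms(1)] by (simp add: V_def)
  have [measurable]: "Measurable.pred (borel \<Otimes>\<^sub>M borel) (\<lambda>p. fst p + snd p \<in> disc s)"
    by measurable
  define F where "F p = (indicator (disc \<delta>) (snd p) * indicator (disc s) (fst p + snd p)) *\<^sub>R cnj (echar k (fst p))" for p :: "(real^2) \<times> (real^2)"
  have Fm: "F \<in> borel_measurable (lborel \<Otimes>\<^sub>M lborel)" unfolding F_def by measurable
  have intF: "integrable (lborel \<Otimes>\<^sub>M lborel) F"
  proof (rule integrableI_bounded_set[where A="disc (s + \<delta>) \<times> disc \<delta>" and B=1, OF _ Fm])
    show "disc (s + \<delta>) \<times> disc \<delta> \<in> sets (lborel \<Otimes>\<^sub>M lborel)" by measurable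
    show "emeasure (lborel \<Otimes>\<^sub>M lborel) (disc (s + \<delta>) \<times> disc \<delta>) < \<infinity>"
      using emeasure_disc_finite by (subst lborel.emeasure_pair_measure_Times) (auto simp: ennreal_mult_less_top)
    have "F p = 0" if "p \<notin> disc (s + \<delta>) \<times> disc \<delta>" for p
    proof -
      obtain y z where p: "p = (y, z)" by fastforce
      have "z \<notin> disc \<delta> \<or> y + z \<notin> disc s" using that q_triangle[of "y + z" "- z"] by (auto simp: p disc_def q_minus)
      then show ?thesis by (auto simp: F_def p)
    qed
    then show "AE p in lborel \<Otimes>\<^sub>M lborel. p \<notin> disc (s + \<delta>) \<times> disc \<delta> \<longrightarrow> F p = 0" by simp
    have "norm (F p) \<le> 1" for p by (auto simp: F_def echar_simps indicator_def)
    then show "AE p in lborel \<Otimes>\<^sub>M lborel. p \<in> disc (s + \<delta>) \<times> disc \<delta> \<longrightarrow> norm (F p) \<le> 1" by simp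
  qed
  have ov: "of_real (overlap s \<delta> y) * cnj (echar k y) = of_real (1 / V) * (\<integral>z. F (y, z) \<partial>lborel)" for y
  proof -
    have "(\<integral>z. F (y, z) \<partial>lborel) = (\<integral>z. indicator (disc \<delta> \<inter> (\<lambda>z. y + z) -` disc s) z *\<^sub>R cnj (echar k y) \<partial>lborel)"
      by (intro Bochner_Integration.integral_cong refl) (auto simp: F_def indicator_def)
    also have "\<dots> = measure lborel (disc \<delta> \<inter> (\<lambda>z. y + z) -` disc s) *\<^sub>R cnj (echar k y)"
      using disc_fmeasurable[of "(\<lambda>z. y + z) -` disc s" \<delta>]
      by (subst integral_scaleR_left) (auto simp: fmeasurable_def top.not_eq_extremum)
    finally show ?thesis using V by (simp add: overlap_def V_def scaleR_conv_of_real)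
  qed
  have ft: "(\<integral>y. indicator (disc s) (y + z) *\<^sub>R cnj (echar k y) \<partial>lborel) = of_real (s\<^sup>2 * (2 * a * b) * semicircle_ft (s * norm (freq k))) * echar k z" for z
  proof -
    have "(\<integral>y. indicator (disc s) (y + z) *\<^sub>R cnj (echar k y) \<partial>lborel) = (\<integral>y. indicator (disc s) y *\<^sub>R cnj (echar k (y - z)) \<partial>lborel)"
      using integral_translate[of "\<lambda>y. indicator (disc s) y *\<^sub>R cnj (echar k (y - z))" z]
      by (simp add: measurable_compose[OF _ measurable_cnj_echar])
    also have "\<dots> = (\<integral>y. cnj (indicator (disc s) y *\<^sub>R echar k y) * echar k z \<partial>lborel)"
      by (intro Bochner_Integration.integral_cong refl)
         (simp add: diff_conv_add_uminus echar_simps del: add_uminus_conv_diff)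
    also have "\<dots> = cnj (\<integral>y. indicator (disc s) y *\<^sub>R echar k y \<partial>lborel) * echar k z"
      by (simp only: integral_mult_left_zero Bochner_Integration.integral_cnj)
    finally show ?thesis unfolding integral_disc_echar[OF assms(2)] by simp
  qed
  have "(\<integral>y. of_real (overlap s \<delta> y) * cnj (echar k y) \<partial>lborel) = of_real (1 / V) * (\<integral>y. (\<integral>z. F (y, z) \<partial>lborel) \<partial>lborel)"
    unfolding ov by simp
  also have "(\<integral>y. (\<integral>z. F (y, z) \<partial>lborel) \<partial>lborel) = (\<integral>z. (\<integral>y. F (y, z) \<partial>lborel) \<partial>lborel)"
    using lborel_pair.Fubini_integral[of "\<lambda>y z. F (y, z)"] intF by simp
  also have "\<dots> = (\<integral>z. indicator (disc \<delta>) z *\<^sub>R (\<integral>y. indicator (disc s) (y + z) *\<^sub>R cnj (echar k y) \<partial>lborel) \<partial>lborel)"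
    by (intro Bochner_Integration.integral_cong refl) (simp add: F_def scaleR_scaleR[symmetric] del: scaleR_scaleR)
  also have "\<dots> = of_real (s\<^sup>2 * (2 * a * b) * semicircle_ft (s * norm (freq k))) * (\<integral>z. indicator (disc \<delta>) z *\<^sub>R echar k z \<partial>lborel)"
    unfolding ft by (subst integral_mult_right_zero[symmetric]) (simp add: scaleR_conv_of_real mult_ac)
  also have "(\<integral>z. indicator (disc \<delta>) z *\<^sub>R echar k z \<partial>lborel) = of_real (\<delta>\<^sup>2 * (2 * a * b) * semicircle_ft (\<delta> * norm (freq k)))"
    by (rule integral_disc_echar[OF assms(1)])
  also have "of_real (1 / V) * (of_real (s\<^sup>2 * (2 * a * b) * semicircle_ft (s * norm (freq k))) * of_real (\<delta>\<^sup>2 * (2 * a * b) * semicircle_ft (\<delta> * norm (freq k))))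
    = (of_real (1 / V * (s\<^sup>2 * (2 * a * b) * semicircle_ft (s * norm (freq k)) * (\<delta>\<^sup>2 * (2 * a * b) * semicircle_ft (\<delta> * norm (freq k))))) :: complex)"
    by (simp only: of_real_mult)
  also have "1 / V * (s\<^sup>2 * (2 * a * b) * semicircle_ft (s * norm (freq k)) * (\<delta>\<^sup>2 * (2 * a * b) * semicircle_ft (\<delta> * norm (freq k))))
    = s\<^sup>2 * (2 * a * b) * semicircle_ft (s * norm (freq k)) * semicircle_ft (\<delta> * norm (freq k)) / semicircle_ft 0"
    using assms ab semicircle_ft_0 unfolding V_def measure_disc[OF assms(1)] by (simp add: field_simps)
  finally show ?thesis .
qed

text \<open>
  The Fourier coefficient of the smoothed count, given by \<open>overlap_transform\<close>.
\<close>
definition smooth_coeff :: "real \<Rightarrow> real \<Rightarrow> real^2 \<Rightarrow> real" where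
  "smooth_coeff s \<delta> k = s\<^sup>2 * (2 * a * b) * semicircle_ft (s * norm (freq k)) * semicircle_ft (\<delta> * norm (freq k)) / semicircle_ft 0"

lemma smoothed_count_fourier:
  assumes "0 < \<delta>" "0 < s" and K: "finite K" "K \<subseteq> int_lattice"
    and B: "\<And>K'. finite K' \<Longrightarrow> K' \<subseteq> int_lattice - K \<Longrightarrow> (\<Sum>k\<in>K'. \<bar>smooth_coeff s \<delta> k\<bar>) \<le> B"
  shows "norm (of_real (lattice_sum (overlap s \<delta>) y) - (\<Sum>k\<in>K. of_real (smooth_coeff s \<delta> k) * echar k y)) \<le> B"
proof (rule fourier_partial_sum_bound[OF _ _ _ K])
  note supp = overlap_support[OF assms(1), of s] and cont = continuous_on_overlap[OF assms(1,2)]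
  show "continuous_on UNIV (\<lambda>x. complex_of_real (lattice_sum (overlap s \<delta>) x))"
    by (intro continuous_intros continuous_on_lattice_sum[OF supp cont])
  show "of_real (lattice_sum (overlap s \<delta>) (x + k)) = (of_real (lattice_sum (overlap s \<delta>) x) :: complex)" if "k \<in> int_lattice" for x k
    using lattice_sum_periodic[OF that] by simp
  show "of_real (smooth_coeff s \<delta> k) = (\<integral>x. indicator torus_domain x *\<^sub>R (of_real (lattice_sum (overlap s \<delta>) x) * cnj (echar k x)) \<partial>lborel)"
    if "k \<in> int_lattice" for k
    using fourier_coefficient_lattice_sum[OF supp cont that] overlap_transform[OF assms(1,2), of k]
    unfolding smooth_coeff_def by metis
qed (use B in simp)

text \<open>
  By the triangle inequality for \<open>q\<close>, averaging the indicator function of \<open>disc (r + \<delta>)\<close> over \<open>disc \<delta>\<close>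
  still gives 1 on \<open>disc r\<close>, and averaging that of \<open>disc (r - \<delta>)\<close> gives 0 outside \<open>disc r\<close>.
\<close>
lemma count_sandwich:
  assumes "0 < \<delta>"
  shows "lattice_sum (indicator (disc r)) y \<le> lattice_sum (overlap (r + \<delta>) \<delta>) y"
    and "lattice_sum (overlap (r - \<delta>) \<delta>) y \<le> lattice_sum (indicator (disc r)) y"
proof -
  have s1: "indicator (disc r) x = (0::real)" if "(a + b) * (r + \<delta> + \<delta>) < norm x" for x
  proof -
    have "(a + b) * (r + \<delta> + \<delta>) < (a + b) * q x" using that q_ge[of x] by linarith
    then have "r + \<delta> + \<delta> < q x" using ab by (simp add: mult_less_cancel_left)
    then show ?thesis using assms by (simp add: disc_def indicator_def)
  qed
  show "lattice_sum (indicator (disc r)) y \<le> lattice_sum (overlap (r + \<delta>) \<delta>) y"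
  proof (rule lattice_sum_mono[of "(a + b) * (r + \<delta> + \<delta>)", OF s1])
    show "indicator (disc r) x \<le> overlap (r + \<delta>) \<delta> x" for x
      using overlap_bounds[OF assms, where s="r + \<delta>" and y=x] by (auto simp: indicator_def disc_def)
  qed (auto intro: overlap_support assms)
  show "lattice_sum (overlap (r - \<delta>) \<delta>) y \<le> lattice_sum (indicator (disc r)) y"
  proof (rule lattice_sum_mono[of "(a + b) * (r + \<delta> + \<delta>)", OF _ s1])
    show "overlap (r - \<delta>) \<delta> x = 0" if "(a + b) * (r + \<delta> + \<delta>) < norm x" for x
    proof (rule overlap_support[OF assms])
      have "(a + b) * (r - \<delta> + \<delta>) \<le> (a + b) * (r + \<delta> + \<delta>)" using ab assms by (intro mult_left_mono) auto
      then show "(a + b) * (r - \<delta> + \<delta>) < norm x" using that by linarith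
    qed
    show "overlap (r - \<delta>) \<delta> x \<le> indicator (disc r) x" for x
      using overlap_bounds[OF assms, where s="r - \<delta>" and y=x] by (auto simp: indicator_def disc_def)
  qed
qed

end

section \<open>Dyadic shells and moments of wave packets\<close>

context ellipse begin

text \<open>
  A lower bound for the distance of two distinct points of the frequency lattice.
\<close>
definition gap :: real where "gap = 2 * pi * min a b"

lemma gap_pos: "0 < gap" using ab by (simp add: gap_def)

lemma freq_ge: "gap * norm k \<le> norm (freq k)"
proof (rule power2_le_imp_le)
  have "(norm k)\<^sup>2 = (k \<bullet> u)\<^sup>2 + (k \<bullet> v)\<^sup>2"
    unfolding power2_norm_eq_inner[of k] orthonormal[of k k] by (simp add: power2_eq_square)
  then have "(gap * norm k)\<^sup>2 = gap\<^sup>2 * (k \<bullet> u)\<^sup>2 + gap\<^sup>2 * (k \<bullet> v)\<^sup>2" by (simp add: power_mult_distrib distrib_left)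
  also have "\<dots> \<le> (2 * pi * a)\<^sup>2 * (k \<bullet> u)\<^sup>2 + (2 * pi * b)\<^sup>2 * (k \<bullet> v)\<^sup>2"
    using ab by (intro add_mono mult_right_mono power_mono) (auto simp: gap_def)
  also have "\<dots> = (norm (freq k))\<^sup>2" by (simp add: freq_def cmod_power2 power_mult_distrib)
  finally show "(gap * norm k)\<^sup>2 \<le> (norm (freq k))\<^sup>2" .
qed simp

lemma inj_freq: "inj freq"
proof (rule injI)
  fix x y assume "freq x = freq y"
  then have "gap * norm (x - y) \<le> 0" using freq_ge[of "x - y"] by (simp add: freq_diff)
  then show "x = y" using gap_pos by (simp add: mult_le_0_iff)
qed

lemma norm_lattice_ge_1: "k \<in> int_lattice \<Longrightarrow> k \<noteq> 0 \<Longrightarrow> 1 \<le> norm k"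
proof -
  assume k: "k \<in> int_lattice" "k \<noteq> 0"
  then obtain i where i: "k $ i \<noteq> 0" by (auto simp: vec_eq_iff)
  have "k $ i \<in> \<int>" using k by (simp add: int_lattice_def)
  then have "1 \<le> \<bar>k $ i\<bar>" using i by (rule Ints_nonzero_abs_ge1)
  also have "\<dots> \<le> norm k" by (rule component_le_norm_cart)
  finally show ?thesis .
qed

lemma separated_freq: "S \<subseteq> int_lattice \<Longrightarrow> separated gap (freq ` S)"
  unfolding separated_def
proof safe
  fix x y assume S: "S \<subseteq> int_lattice" "x \<in> S" "y \<in> S" and "freq x \<noteq> freq y"
  then have "1 \<le> norm (x - y)" by (intro norm_lattice_ge_1) (auto intro: int_lattice_group)
  then have "gap * 1 \<le> gap * norm (x - y)" using gap_pos by (intro mult_left_mono) auto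
  also have "\<dots> \<le> norm (freq x - freq y)" using freq_ge[of "x - y"] by (simp add: freq_diff)
  finally show "gap \<le> norm (freq x - freq y)" by simp
qed

definition shell :: "nat \<Rightarrow> (real^2) set" where
  "shell j = {k \<in> int_lattice. 2 ^ j * gap \<le> norm (freq k) \<and> norm (freq k) < 2 ^ Suc j * gap}"

definition low :: "nat \<Rightarrow> (real^2) set" where "low J = (\<Union>j<J. shell j)"

definition shell_const :: real where "shell_const = (2 / gap + 1)\<^sup>2 * (1 + 4 * gap)\<^sup>2"

lemma shell_const_pos: "0 < shell_const" unfolding shell_const_def using gap_pos
  by (intro mult_pos_pos zero_less_power add_pos_pos divide_pos_pos) auto

lemma finite_shell: "finite (shell j)"
proof (rule finite_subset[OF _ finite_lattice_ball])
  show "shell j \<subseteq> {k \<in> int_lattice. norm k \<le> 2 ^ Suc j}"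
  proof
    fix k assume k: "k \<in> shell j"
    then have "gap * norm k \<le> gap * 2 ^ Suc j" using freq_ge[of k] by (auto simp: shell_def mult.commute)
    then show "k \<in> {k \<in> int_lattice. norm k \<le> 2 ^ Suc j}" using gap_pos k by (simp add: shell_def)
  qed
qed

lemma finite_low: "finite (low J)" by (simp add: low_def finite_shell)

lemma shell_lattice: "shell j \<subseteq> int_lattice" by (auto simp: shell_def)
lemma low_lattice: "low J \<subseteq> int_lattice" by (auto simp: low_def shell_def)

text \<open>
  The shell is contained in a square of side \<open>4 * 2 ^ j * gap\<close>.
\<close>
lemma card_shell: "real (card (shell j)) \<le> shell_const * 4 ^ j"
proof -
  define X where "X = 2 ^ Suc j * gap"
  have X: "0 \<le> X" using gap_pos by (simp add: X_def)
  have b: "\<bar>Re z\<bar> \<le> X \<and> \<bar>Im z\<bar> \<le> X" if "z \<in> freq ` shell j" for z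
    using that abs_Re_le_cmod[of z] abs_Im_le_cmod[of z] by (auto simp: shell_def X_def)
  have "real (card (freq ` shell j)) \<le> (2 / gap + 1)\<^sup>2 * ((1 + 2 * X) * (1 + 2 * X))"
    by (rule card_separated_rectangle(2)[of gap "freq ` shell j" 1 "2 * X" "2 * X" "- X" "- X", OF gap_pos separated_freq[OF shell_lattice]])
       (use X b in \<open>force+\<close>)
  also have "card (freq ` shell j) = card (shell j)" by (rule card_image) (rule inj_on_subset[OF inj_freq], simp)
  also have "(2 / gap + 1)\<^sup>2 * ((1 + 2 * X) * (1 + 2 * X)) \<le> (2 / gap + 1)\<^sup>2 * ((2 ^ j * (1 + 4 * gap)) * (2 ^ j * (1 + 4 * gap)))"
  proof -
    have "(1::real) \<le> 2 ^ j" by simp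
    then have "1 + 2 * X \<le> 2 ^ j * (1 + 4 * gap)" by (simp add: X_def algebra_simps)
    then show ?thesis using X by (intro mult_left_mono mult_mono) auto
  qed
  also have "\<dots> = shell_const * 4 ^ j"
  proof -
    have "(2::real) ^ j * 2 ^ j = 4 ^ j" by (simp flip: power_mult_distrib)
    then show ?thesis by (simp add: shell_const_def power2_eq_square)
  qed
  finally show ?thesis .
qed

lemma shell_disjoint: "k \<in> shell i \<Longrightarrow> k \<in> shell j \<Longrightarrow> i = j"
proof -
  have aux: False if "k \<in> shell i" "k \<in> shell j" "i < j" for i j
  proof -
    have "(2::real) ^ Suc i \<le> 2 ^ j" using that by (intro power_increasing) auto
    then have "2 ^ Suc i * gap \<le> 2 ^ j * gap" using gap_pos by (intro mult_right_mono) auto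
    then show False using that by (auto simp: shell_def)
  qed
  show "k \<in> shell i \<Longrightarrow> k \<in> shell j \<Longrightarrow> i = j" using aux by (metis linorder_neqE_nat)
qed

lemma shell_exists: assumes "k \<in> int_lattice" "k \<noteq> 0" obtains j where "k \<in> shell j"
proof -
  define t where "t = norm (freq k) / gap"
  have "gap * 1 \<le> gap * norm k" using norm_lattice_ge_1[OF assms] gap_pos by (intro mult_left_mono) auto
  from order.trans[OF this freq_ge] have t: "1 \<le> t" using gap_pos by (simp add: t_def pos_le_divide_eq)
  obtain n where n: "t < 2 ^ n" using real_arch_pow[of 2 t] by auto
  define m where "m = (LEAST n. t < 2 ^ n)"
  have m: "t < 2 ^ m" unfolding m_def using n by (rule LeastI)
  have "m \<noteq> 0" using m t by (intro notI) simp
  then obtain j where j: "m = Suc j" using not0_implies_Suc by blast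
  have "\<not> t < 2 ^ j" using not_less_Least[of j "\<lambda>n. t < 2 ^ n"] j by (simp add: m_def)
  then have "k \<in> shell j" using m assms gap_pos unfolding j shell_def t_def by (auto simp: field_simps)
  then show ?thesis by (rule that)
qed

lemma shell_nonzero: assumes "k \<in> shell j" shows "0 < norm (freq k)"
proof -
  have "0 < 2 ^ j * gap" using gap_pos by simp
  also have "\<dots> \<le> norm (freq k)" using assms by (simp add: shell_def)
  finally show ?thesis .
qed

lemma low_nonzero: "k \<in> low J \<Longrightarrow> 0 < norm (freq k)"
  using shell_nonzero by (auto simp: low_def)

lemma sum_low: "(\<Sum>k\<in>low J. f k) = (\<Sum>j<J. \<Sum>k\<in>shell j. f k)"
  unfolding low_def using shell_disjoint finite_shell by (subst sum.UNION_disjoint) auto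

lemma shell_sum_le:
  fixes f :: "real^2 \<Rightarrow> real"
  assumes "\<And>k. k \<in> shell j \<Longrightarrow> f k \<le> B" "0 \<le> B" shows "(\<Sum>k\<in>shell j. f k) \<le> shell_const * 4 ^ j * B"
proof -
  have "(\<Sum>k\<in>shell j. f k) \<le> real (card (shell j)) * B" using assms(1) by (rule sum_bounded_above)
  also have "\<dots> \<le> shell_const * 4 ^ j * B" using card_shell assms(2) by (intro mult_right_mono)
  finally show ?thesis .
qed

lemma geometric_le: "0 \<le> t \<Longrightarrow> t < 1 \<Longrightarrow> (\<Sum>j<J. t ^ j) \<le> 1 / (1 - t)" for t :: real
  by (subst sum_gp_strict) (auto intro!: divide_right_mono)

text \<open>
  A shell has \<open>O(4 ^ j)\<close> points, so a cubic decay of the summand leaves a geometric series that starts at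
  \<open>2 powr (- J)\<close>.
\<close>
lemma tail_sum:
  fixes f :: "real^2 \<Rightarrow> real"
  assumes K: "finite K" "K \<subseteq> int_lattice - insert 0 (low J)"
    and f: "\<And>k. k \<in> int_lattice \<Longrightarrow> k \<noteq> 0 \<Longrightarrow> 0 \<le> f k" "\<And>j k. k \<in> shell j \<Longrightarrow> f k \<le> B / 8 ^ j" and B: "0 \<le> B"
  shows "(\<Sum>k\<in>K. f k) \<le> 2 * shell_const * B / 2 ^ J"
proof -
  have ex: "\<exists>j\<ge>J. k \<in> shell j" if "k \<in> K" for k
  proof -
    have k: "k \<in> int_lattice" "k \<noteq> 0" "k \<notin> low J" using that K by auto
    obtain j where j: "k \<in> shell j" using shell_exists[OF k(1,2)] .
    have "J \<le> j" by (rule ccontr) (use j k(3) in \<open>auto simp: low_def\<close>)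
    then show ?thesis using j by blast
  qed
  then obtain g where g: "\<And>k. k \<in> K \<Longrightarrow> J \<le> g k \<and> k \<in> shell (g k)" by metis
  obtain N where N: "\<And>k. k \<in> K \<Longrightarrow> g k < N" using finite_nat_set_iff_bounded[of "g ` K"] K(1) by auto
  have sub: "K \<subseteq> (\<Union>j\<in>{J..<N}. shell j)" using g N by fastforce
  have "(\<Sum>k\<in>K. f k) \<le> (\<Sum>k\<in>(\<Union>j\<in>{J..<N}. shell j). f k)"
  proof (rule sum_mono2[OF _ sub])
    fix k assume "k \<in> (\<Union>j\<in>{J..<N}. shell j) - K"
    then obtain j where j: "k \<in> shell j" by auto
    then have "freq k \<noteq> 0" using shell_nonzero[of k j] by auto
    then show "0 \<le> f k" using j by (intro f) (auto simp: shell_def freq_0)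
  qed (simp add: finite_shell)
  also have "\<dots> = (\<Sum>j\<in>{J..<N}. \<Sum>k\<in>shell j. f k)"
    using shell_disjoint finite_shell by (subst sum.UNION_disjoint) auto
  also have "\<dots> \<le> (\<Sum>j\<in>{J..<N}. shell_const * 4 ^ j * (B / 8 ^ j))"
    by (intro sum_mono shell_sum_le f) (use B in auto)
  also have "\<dots> = (\<Sum>j\<in>{J..<N}. shell_const * B * (1/2) ^ j)"
  proof (rule sum.cong[OF refl])
    fix j
    have "(8::real) ^ j = 4 ^ j * 2 ^ j" by (simp flip: power_mult_distrib)
    then show "shell_const * 4 ^ j * (B / 8 ^ j) = shell_const * B * (1/2) ^ j" by (simp add: power_divide)
  qed
  also have "\<dots> = shell_const * B * (\<Sum>j\<in>{J..<N}. (1/2) ^ j)" by (simp only: sum_distrib_left)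
  finally have le: "(\<Sum>k\<in>K. f k) \<le> shell_const * B * (\<Sum>j\<in>{J..<N}. (1/2) ^ j)" .
  have "(\<Sum>j\<in>{J..<N}. (1/2) ^ j) \<le> (2 / 2 ^ J :: real)"
  proof (cases "J \<le> N")
    case True
    have "(\<Sum>j\<in>{J..<N}. (1/2) ^ j) = (\<Sum>j<N-J. (1/2) ^ J * (1/2::real) ^ j)"
      by (rule sum.reindex_bij_witness[of _ "\<lambda>i. i + J" "\<lambda>i. i - J"]) (auto simp flip: power_add)
    also have "\<dots> = (1/2) ^ J * (\<Sum>j<N-J. (1/2::real) ^ j)" by (simp only: sum_distrib_left)
    also have "\<dots> \<le> (1/2) ^ J * (1 / (1 - 1/2))" by (intro mult_left_mono geometric_le) auto
    finally show ?thesis by (simp add: power_divide)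
  qed simp
  then have "shell_const * B * (\<Sum>j\<in>{J..<N}. (1/2) ^ j) \<le> shell_const * B * (2 / 2 ^ J)"
    using B shell_const_pos by (intro mult_left_mono) auto
  with le show ?thesis by (simp add: mult_ac)
qed

text \<open>
  A solution of the half-wave equation with time \<open>r\<close> and sign \<open>\<epsilon>\<close>, in a frame that moves with velocity
  \<open>c0\<close>: the centre of the dilated ellipse is \<open>r *\<^sub>R c0\<close>.
\<close>
definition packet :: "real^2 \<Rightarrow> real \<Rightarrow> (real^2) set \<Rightarrow> (real^2 \<Rightarrow> complex) \<Rightarrow> real \<Rightarrow> real^2 \<Rightarrow> complex" where
  "packet c0 \<epsilon> S c r x = (\<Sum>k\<in>S. c k * cis (r * (\<epsilon> * norm (freq k) - 2 * pi * (k \<bullet> c0))) * echar k x)"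

lemma packet_mean_2:
  fixes c0 :: "real^2" and \<epsilon> R :: real and c :: "real^2 \<Rightarrow> complex"
  assumes S: "finite S" "S \<subseteq> int_lattice"
  defines "G \<equiv> \<lambda>r. LINT x:torus_domain|lebesgue. (norm (packet c0 \<epsilon> S c r x))\<^sup>2"
  shows "continuous_on UNIV G" "(LINT r:{R..R+1}|lebesgue. G r) \<le> 22 * (\<Sum>k\<in>S. (norm (c k))\<^sup>2)"
proof -
  have lat: "\<And>i. i \<in> S \<Longrightarrow> i \<in> int_lattice" using S by auto
  note m = spacetime_mean_square(1)[where I=S and n="\<lambda>k. k" and C=c and \<Theta>="\<lambda>k. \<epsilon> * norm (freq k) - 2 * pi * (k \<bullet> c0)", OF S(1) lat, folded packet_def]
    spacetime_mean_square(2)[where I=S and n="\<lambda>k. k" and C=c and \<Theta>="\<lambda>k. \<epsilon> * norm (freq k) - 2 * pi * (k \<bullet> c0)" and R=R, OF S(1) lat, folded packet_def]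
  show "continuous_on UNIV G" unfolding G_def by (rule m(1))
  have "(\<Sum>i\<in>S. \<Sum>j\<in>{j \<in> S. j = i}. norm (c i) * norm (c j) / (1 + (\<epsilon> * norm (freq i) - 2 * pi * (i \<bullet> c0) - (\<epsilon> * norm (freq j) - 2 * pi * (j \<bullet> c0)))\<^sup>2))
     = (\<Sum>k\<in>S. (norm (c k))\<^sup>2)"
  proof (rule sum.cong[OF refl])
    fix i assume "i \<in> S"
    then have "{j \<in> S. j = i} = {i}" by auto
    then show "(\<Sum>j\<in>{j \<in> S. j = i}. norm (c i) * norm (c j) / (1 + (\<epsilon> * norm (freq i) - 2 * pi * (i \<bullet> c0) - (\<epsilon> * norm (freq j) - 2 * pi * (j \<bullet> c0)))\<^sup>2)) = (norm (c i))\<^sup>2"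
      by (simp add: power2_eq_square)
  qed
  then show "(LINT r:{R..R+1}|lebesgue. G r) \<le> 22 * (\<Sum>k\<in>S. (norm (c k))\<^sup>2)" unfolding G_def using m(2) by simp
qed

definition const6 :: real where "const6 = 22 * (600 * (3456 * (2 / gap + 1)\<^sup>2)\<^sup>2)"

text \<open>
  The sixth power is the squared modulus of the cube, a sum over triples. For two triples with the same
  sum the contributions of \<open>c0\<close> to the phases agree, so the phases differ by \<open>\<plusminus>1\<close> times the difference
  of the total lengths, and \<open>cone_sextuple_sum\<close> applies.
\<close>
lemma packet_mean_6:
  fixes c0 :: "real^2" and \<epsilon> R :: real and c :: "real^2 \<Rightarrow> complex"
  assumes S: "finite S" "S \<subseteq> int_lattice" and \<epsilon>: "\<epsilon>\<^sup>2 = 1"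
  defines "G \<equiv> \<lambda>r. LINT x:torus_domain|lebesgue. (norm (packet c0 \<epsilon> S c r x)) ^ 6"
  shows "continuous_on UNIV G"
    "(LINT r:{R..R+1}|lebesgue. G r) \<le> const6 * (\<Sum>k\<in>S. (norm (c k))\<^sup>2 * (1 + norm (freq k))) ^ 3"
proof -
  define X where "X = S \<times> S \<times> S"
  define n where "n = (\<lambda>(k::real^2, l::real^2, m::real^2). k + l + m)"
  define C where "C = (\<lambda>(k, l, m). c k * c l * c m)"
  define th where "th k = \<epsilon> * norm (freq k) - 2 * pi * (k \<bullet> c0)" for k
  define \<Theta> where "\<Theta> = (\<lambda>(k, l, m). th k + th l + th m)"
  define \<tau> where "\<tau> = (\<lambda>(k, l, m). norm (freq k) + norm (freq l) + norm (freq m))"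
  have X: "finite X" "\<And>i. i \<in> X \<Longrightarrow> n i \<in> int_lattice"
    using S by (auto simp: X_def n_def intro!: int_lattice_group)
  have cube: "(\<Sum>i\<in>X. C i * cis (r * \<Theta> i) * echar (n i) x) = packet c0 \<epsilon> S c r x ^ 3" for r x
  proof -
    define g where "g k = c k * cis (r * th k) * echar k x" for k
    have "(\<Sum>i\<in>X. C i * cis (r * \<Theta> i) * echar (n i) x) = (\<Sum>k\<in>S. \<Sum>l\<in>S. \<Sum>m\<in>S. g k * (g l * g m))"
      unfolding X_def sum.cartesian_product
      by (intro sum.cong) (auto simp: C_def \<Theta>_def n_def g_def echar_simps distrib_left cis_mult[symmetric] mult_ac)
    also have "\<dots> = (\<Sum>k\<in>S. g k) ^ 3"
      by (simp only: sum_distrib_left[symmetric] sum_distrib_right[symmetric] power3_eq_cube mult.assoc)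
    finally show ?thesis by (simp add: packet_def g_def th_def)
  qed
  have six: "(norm (packet c0 \<epsilon> S c r x ^ 3))\<^sup>2 = norm (packet c0 \<epsilon> S c r x) ^ 6" for r x
    by (simp add: norm_power flip: power_mult)
  note m = spacetime_mean_square(1)[where I=X and n=n and C=C and \<Theta>=\<Theta>, OF X, unfolded cube six]
    spacetime_mean_square(2)[where I=X and n=n and C=C and \<Theta>=\<Theta> and R=R, OF X, unfolded cube six]
  show "continuous_on UNIV G" unfolding G_def by (rule m(1))
  have "(\<Sum>i\<in>X. \<Sum>j\<in>{j\<in>X. n j = n i}. norm (C i) * norm (C j) / (1 + (\<Theta> i - \<Theta> j)\<^sup>2)) =
        (\<Sum>i\<in>X. \<Sum>j\<in>{j\<in>X. n j = n i}. norm (C i) * norm (C j) / (1 + (\<tau> i - \<tau> j)\<^sup>2))"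
  proof (intro sum.cong refl)
    fix i j assume j: "j \<in> {j\<in>X. n j = n i}"
    have e: "\<Theta> i = \<epsilon> * \<tau> i - 2 * pi * (n i \<bullet> c0)" for i
      by (cases i) (simp add: \<Theta>_def \<tau>_def n_def th_def inner_simps algebra_simps)
    have "\<Theta> i - \<Theta> j = \<epsilon> * (\<tau> i - \<tau> j)" unfolding e using j by (simp add: right_diff_distrib)
    then have "(\<Theta> i - \<Theta> j)\<^sup>2 = (\<tau> i - \<tau> j)\<^sup>2" using \<epsilon> by (simp add: power_mult_distrib)
    then show "norm (C i) * norm (C j) / (1 + (\<Theta> i - \<Theta> j)\<^sup>2) = norm (C i) * norm (C j) / (1 + (\<tau> i - \<tau> j)\<^sup>2)" by simp
  qed
  also have "\<dots> \<le> 600 * (3456 * (2 / gap + 1)\<^sup>2)\<^sup>2 * (\<Sum>k\<in>S. (norm (c k))\<^sup>2 * (1 + norm (freq k))) ^ 3"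
  proof -
    define c' where "c' z = norm (c (inv freq z))" for z
    define S' where "S' = freq ` S"
    define h where "h = map_prod freq (map_prod freq freq)"
    have cf: "c' (freq k) = norm (c k)" for k by (simp add: c'_def inv_f_f[OF inj_freq])
    have S': "finite S'" "separated gap S'" using S by (auto simp: S'_def separated_freq)
    have hX: "S' \<times> S' \<times> S' = h ` X" by (force simp: S'_def h_def X_def image_iff)
    have injh: "inj h" unfolding h_def by (intro prod.inj_map inj_freq)
    let ?s = "\<lambda>(k::complex, l::complex, m::complex). k + l + m"
    let ?t = "\<lambda>(k::complex, l::complex, m::complex). norm k + norm l + norm m"
    let ?b = "\<lambda>(k, l, m). c' k * c' l * c' m"
    have sh: "?s (h i) = freq (n i)" and bh: "?b (h i) = norm (C i)" and th: "?t (h i) = \<tau> i" for i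
      by (cases i; simp add: h_def n_def C_def \<tau>_def freq_add cf norm_mult)+
    have inner: "{\<mu> \<in> h ` X. ?s \<mu> = ?s (h i)} = h ` {j\<in>X. n j = n i}" for i
    proof -
      have gen: "{\<mu> \<in> h ` X. P \<mu>} = h ` {j\<in>X. P (h j)}" for P by blast
      show ?thesis unfolding gen sh inj_eq[OF inj_freq] ..
    qed
    have "(\<Sum>\<kappa>\<in>h ` X. \<Sum>\<mu>\<in>{\<mu> \<in> h ` X. ?s \<mu> = ?s \<kappa>}. ?b \<kappa> * ?b \<mu> / (1 + (?t \<kappa> - ?t \<mu>)\<^sup>2))
      = (\<Sum>i\<in>X. \<Sum>\<mu>\<in>{\<mu> \<in> h ` X. ?s \<mu> = ?s (h i)}. ?b (h i) * ?b \<mu> / (1 + (?t (h i) - ?t \<mu>)\<^sup>2))"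
      by (subst sum.reindex) (auto intro: inj_on_subset[OF injh])
    also have "\<dots> = (\<Sum>i\<in>X. \<Sum>j\<in>{j\<in>X. n j = n i}. norm (C i) * norm (C j) / (1 + (\<tau> i - \<tau> j)\<^sup>2))"
      unfolding inner
      by (intro sum.cong refl, subst sum.reindex) (auto intro: inj_on_subset[OF injh] simp only: o_def bh th)
    finally have eq: "(\<Sum>i\<in>X. \<Sum>j\<in>{j\<in>X. n j = n i}. norm (C i) * norm (C j) / (1 + (\<tau> i - \<tau> j)\<^sup>2)) =
      (\<Sum>\<kappa>\<in>S' \<times> S' \<times> S'. \<Sum>\<mu>\<in>{\<mu> \<in> S' \<times> S' \<times> S'. ?s \<mu> = ?s \<kappa>}. ?b \<kappa> * ?b \<mu> / (1 + (?t \<kappa> - ?t \<mu>)\<^sup>2))"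
      unfolding hX by (rule sym)
    have "(\<Sum>k\<in>S'. (c' k)\<^sup>2 * (1 + norm k)) = (\<Sum>k\<in>S. (norm (c k))\<^sup>2 * (1 + norm (freq k)))"
      unfolding S'_def by (subst sum.reindex) (auto intro: inj_on_subset[OF inj_freq] simp: cf)
    then show ?thesis unfolding eq using cone_sextuple_sum[OF S'(1) gap_pos S'(2), of c'] by (simp add: c'_def)
  qed
  finally have "22 * (\<Sum>i\<in>X. \<Sum>j\<in>{j\<in>X. n j = n i}. norm (C i) * norm (C j) / (1 + (\<Theta> i - \<Theta> j)\<^sup>2))
     \<le> const6 * (\<Sum>k\<in>S. (norm (c k))\<^sup>2 * (1 + norm (freq k))) ^ 3" by (simp add: const6_def)
  then show "(LINT r:{R..R+1}|lebesgue. G r) \<le> const6 * (\<Sum>k\<in>S. (norm (c k))\<^sup>2 * (1 + norm (freq k))) ^ 3"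
    unfolding G_def using m(2) by linarith
qed

end

section \<open>From the smoothed count to wave packets\<close>

text \<open>
  The first term suffices if \<open>y \<le> l\<close>, the second one otherwise.
\<close>
lemma powr_interpolate:
  fixes y l p :: real
  assumes "0 \<le> y" "0 < l" "2 \<le> p" "p \<le> 6"
  shows "y powr p \<le> l powr (p - 2) * y\<^sup>2 + l powr (p - 6) * y ^ 6"
proof (cases "y = 0")
  case True then show ?thesis by simp
next
  case False
  then have y: "0 < y" using assms by simp
  show ?thesis
  proof (cases "y \<le> l")
    case True
    have "y powr p = y powr (p - 2) * y powr 2" by (simp flip: powr_add)
    also have "\<dots> \<le> l powr (p - 2) * y powr 2" using True y assms by (intro mult_right_mono powr_mono2) auto
    also have "y powr 2 = y\<^sup>2" using y by (simp add: powr_numeral)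
    finally show ?thesis using y by (simp add: add_increasing2)
  next
    case False
    have "y powr p = y powr (p - 6) * y powr 6" by (simp flip: powr_add)
    also have "\<dots> \<le> l powr (p - 6) * y powr 6" using False y assms by (intro mult_right_mono powr_mono2') auto
    also have "y powr 6 = y ^ 6" using y by (simp add: powr_numeral)
    finally show ?thesis using y by (simp add: add_increasing)
  qed
qed

text \<open>
  Hoelder's inequality in a crude form: the sum is at most \<open>W\<close> times the largest of the numbers
  \<open>w i * y i\<close>.
\<close>
lemma sum_powr_weighted:
  fixes y w :: "'i \<Rightarrow> real"
  assumes I: "finite I" and y: "\<And>i. i \<in> I \<Longrightarrow> 0 \<le> y i" and w: "\<And>i. i \<in> I \<Longrightarrow> 0 < w i" "(\<Sum>i\<in>I. 1 / w i) \<le> W" and p: "0 < p"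
  shows "(\<Sum>i\<in>I. y i) powr p \<le> W powr p * (\<Sum>i\<in>I. (w i * y i) powr p)"
proof (cases "I = {}")
  case False
  define m where "m = Max ((\<lambda>i. w i * y i) ` I)"
  have m: "w i * y i \<le> m" if "i \<in> I" for i unfolding m_def using that I by (intro Max_ge) auto
  obtain i0 where i0: "i0 \<in> I" "m = w i0 * y i0"
  proof -
    have "m \<in> (\<lambda>i. w i * y i) ` I" unfolding m_def by (rule Max_in) (use I False in auto)
    then show ?thesis using that by blast
  qed
  have m0: "0 \<le> m" using i0 y w by (simp add: less_imp_le)
  have W: "0 \<le> W" using w by (intro order.trans[OF sum_nonneg w(2)]) (simp add: less_imp_le)
  have "(\<Sum>i\<in>I. y i) \<le> (\<Sum>i\<in>I. 1 / w i * m)"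
    using m w by (intro sum_mono) (simp add: field_simps)
  also have "\<dots> = (\<Sum>i\<in>I. 1 / w i) * m" by (simp only: sum_distrib_right)
  also have "\<dots> \<le> W * m" using w(2) m0 by (rule mult_right_mono)
  finally have "(\<Sum>i\<in>I. y i) powr p \<le> (W * m) powr p" using p y by (intro powr_mono2 sum_nonneg) auto
  also have "\<dots> = W powr p * m powr p" using W m0 by (simp add: powr_mult)
  also have "\<dots> \<le> W powr p * (\<Sum>i\<in>I. (w i * y i) powr p)"
    using member_le_sum[of i0 I "\<lambda>i. (w i * y i) powr p"] I i0 by (intro mult_left_mono) auto
  finally show ?thesis .
qed simp

context ellipse begin

definition lattice_count :: "real \<Rightarrow> real^2 \<Rightarrow> real" where "lattice_count r y = lattice_sum (indicator (disc r)) y"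

definition area :: real where "area = 2 * a * b * semicircle_ft 0"

lemma area_pos: "0 < area" using ab semicircle_ft_0 by (simp add: area_def)

text \<open>
  The lattice point \<open>k\<close> lies in the translated dilate exactly if \<open>k + (x - r *\<^sub>R c0)\<close> lies in \<open>disc r\<close>.
\<close>
lemma discrepancy_ellipse:
  assumes r: "0 < r"
  shows "discrepancy {x. (((x - c0) \<bullet> u) / a)\<^sup>2 + (((x - c0) \<bullet> v) / b)\<^sup>2 \<le> 1} r x = lattice_count r (x - r *\<^sub>R c0) - r\<^sup>2 * area"
proof -
  define E where "E = {x. (((x - c0) \<bullet> u) / a)\<^sup>2 + (((x - c0) \<bullet> v) / b)\<^sup>2 \<le> 1}"
  have q2: "(((x \<bullet> u) / a)\<^sup>2 + ((x \<bullet> v) / b)\<^sup>2 \<le> 1) = (q x \<le> 1)" for x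
    by (simp add: q_def cmod_def)
  have E: "E = (+) c0 ` disc 1"
  proof -
    have "x \<in> E \<longleftrightarrow> x - c0 \<in> disc 1" for x by (simp add: E_def disc_def q2)
    then show ?thesis by (force simp: image_iff intro: bexI[of _ "_ - c0"])
  qed
  have mE: "measure lebesgue E = area"
  proof -
    have "measure lebesgue E = measure lebesgue (disc 1)" unfolding E by (rule measure_translation)
    also have "\<dots> = measure lborel (disc 1)" by (simp add: measure_completion)
    finally show ?thesis by (simp add: measure_disc area_def)
  qed
  have qs: "q (t *\<^sub>R x) = \<bar>t\<bar> * q x" for t x
  proof -
    have "q (t *\<^sub>R x) = norm (t *\<^sub>R Complex ((x \<bullet> u) / a) ((x \<bullet> v) / b))"
      unfolding q_def by (rule arg_cong[where f=norm]) (simp add: complex_eq_iff)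
    then show ?thesis by (simp add: q_def)
  qed
  have "k \<in> (\<lambda>y. r *\<^sub>R y - x) ` E \<longleftrightarrow> k + (x - r *\<^sub>R c0) \<in> disc r" for k
  proof -
    have "k \<in> (\<lambda>y. r *\<^sub>R y - x) ` E \<longleftrightarrow> (\<exists>z\<in>disc 1. k = r *\<^sub>R (c0 + z) - x)" by (auto simp: E)
    also have "\<dots> \<longleftrightarrow> (1 / r) *\<^sub>R (k + (x - r *\<^sub>R c0)) \<in> disc 1"
    proof
      assume "\<exists>z\<in>disc 1. k = r *\<^sub>R (c0 + z) - x"
      then obtain z where z: "z \<in> disc 1" "k = r *\<^sub>R (c0 + z) - x" by blast
      have "k + (x - r *\<^sub>R c0) = r *\<^sub>R z" by (simp add: z(2) algebra_simps)
      then show "(1 / r) *\<^sub>R (k + (x - r *\<^sub>R c0)) \<in> disc 1" using z r by simp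
    next
      assume h: "(1 / r) *\<^sub>R (k + (x - r *\<^sub>R c0)) \<in> disc 1"
      have "k = r *\<^sub>R (c0 + (1 / r) *\<^sub>R (k + (x - r *\<^sub>R c0))) - x" using r by (simp add: algebra_simps)
      then show "\<exists>z\<in>disc 1. k = r *\<^sub>R (c0 + z) - x" using h by blast
    qed
    also have "\<dots> \<longleftrightarrow> k + (x - r *\<^sub>R c0) \<in> disc r"
    proof -
      have "(1 / r) *\<^sub>R w \<in> disc 1 \<longleftrightarrow> w \<in> disc r" for w using r by (simp only: disc_def mem_Collect_eq qs) (simp add: field_simps)
      then show ?thesis .
    qed
    finally show ?thesis .
  qed
  then show ?thesis unfolding E_def[symmetric] discrepancy_def mE lattice_count_def lattice_sum_def indicator_def by simp
qed

lemma smooth_coeff_0: "smooth_coeff s \<delta> 0 = s\<^sup>2 * area"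
  using semicircle_ft_0 by (simp add: smooth_coeff_def area_def freq_0)

text \<open>
  Each of the two Bessel factors decays with the power \<open>3/2\<close>.
\<close>
lemma smooth_coeff_tail:
  assumes C: "\<And>z. 0 < z \<Longrightarrow> \<bar>semicircle_ft z\<bar> * (z * sqrt z) \<le> C" and s: "0 < s" "0 < \<delta>" and k: "k \<in> shell j"
  shows "\<bar>smooth_coeff s \<delta> k\<bar> \<le> (2 * a * b * C\<^sup>2 / semicircle_ft 0 / gap ^ 3 * (sqrt s / (\<delta> * sqrt \<delta>))) / 8 ^ j"
proof -
  define \<rho> where "\<rho> = norm (freq k)"
  have \<rho>: "0 < \<rho>" "2 ^ j * gap \<le> \<rho>" using shell_nonzero[OF k] k by (auto simp: \<rho>_def shell_def)
  have g: "\<bar>semicircle_ft (t * \<rho>)\<bar> \<le> C / (t * sqrt t * (\<rho> * sqrt \<rho>))" if "0 < t" for t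
    using C[of "t * \<rho>"] that \<rho> by (simp add: real_sqrt_mult field_simps)
  have C0: "0 \<le> C" using C[of 1] by (simp add: order.trans[OF abs_ge_zero])
  have "\<bar>smooth_coeff s \<delta> k\<bar> = s\<^sup>2 * (2 * a * b) / semicircle_ft 0 * (\<bar>semicircle_ft (s * \<rho>)\<bar> * \<bar>semicircle_ft (\<delta> * \<rho>)\<bar>)"
    using ab semicircle_ft_0 by (simp add: smooth_coeff_def \<rho>_def abs_mult)
  also have "\<dots> \<le> s\<^sup>2 * (2 * a * b) / semicircle_ft 0 * ((C / (s * sqrt s * (\<rho> * sqrt \<rho>))) * (C / (\<delta> * sqrt \<delta> * (\<rho> * sqrt \<rho>))))"
    using ab semicircle_ft_0 C0 \<rho> s by (intro mult_left_mono mult_mono g) auto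
  also have "\<dots> = 2 * a * b * C\<^sup>2 / semicircle_ft 0 * (sqrt s / (\<delta> * sqrt \<delta>)) / \<rho> ^ 3"
  proof -
    define x y z where "x = sqrt s" and "y = sqrt \<delta>" and "z = sqrt \<rho>"
    have xyz: "s = x * x" "\<delta> = y * y" "\<rho> = z * z" "x > 0" "y > 0" "z > 0" using s \<rho> by (auto simp: x_def y_def z_def)
    have "s\<^sup>2 * (2 * a * b) / g0 * ((C / (s * x * (\<rho> * z))) * (C / (\<delta> * y * (\<rho> * z)))) = 2 * a * b * C\<^sup>2 / g0 * (x / (\<delta> * y)) / \<rho> ^ 3" if "g0 > 0" for g0
      unfolding xyz(1-3) using xyz(4-) that by (simp add: field_simps power2_eq_square power3_eq_cube)
    from this[OF semicircle_ft_0] show ?thesis by (simp add: x_def y_def z_def)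
  qed
  also have "\<dots> \<le> 2 * a * b * C\<^sup>2 / semicircle_ft 0 * (sqrt s / (\<delta> * sqrt \<delta>)) / (2 ^ j * gap) ^ 3"
    using ab semicircle_ft_0 s \<rho> gap_pos by (intro divide_left_mono power_mono) auto
  also have "(2 ^ j * gap) ^ 3 = 8 ^ j * gap ^ 3"
    by (simp add: power_mult_distrib flip: power_mult) (simp add: mult.commute[of j] power_mult)
  finally show ?thesis by (simp add: mult_ac)
qed

text \<open>
  The first Bessel factor is replaced by its asymptotic expansion, the second one is only bounded.
\<close>
lemma smooth_coeff_main:
  assumes AB: "\<And>z. 0 < z \<Longrightarrow> \<bar>z * sqrt z * semicircle_ft z - (A * cos z + B * sin z)\<bar> \<le> C / z" and s: "0 < s" "0 < \<delta>" and k: "0 < norm (freq k)"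
  defines "\<rho> \<equiv> norm (freq k)"
  defines "h \<equiv> 2 * a * b * semicircle_ft (\<delta> * \<rho>) / semicircle_ft 0 / (\<rho> * sqrt \<rho>)"
  shows "\<bar>smooth_coeff s \<delta> k - sqrt s * (h * (A * cos (s * \<rho>) + B * sin (s * \<rho>)))\<bar> \<le> 4 * a * b * C / semicircle_ft 0 / sqrt s / (\<rho>\<^sup>2 * sqrt \<rho>)"
    and "\<bar>h\<bar> \<le> 4 * a * b / semicircle_ft 0 / (\<rho> * sqrt \<rho>)"
proof -
  have \<rho>: "0 < \<rho>" using k by (simp add: \<rho>_def)
  have C0: "0 \<le> C" using AB[of 1] by (simp add: order.trans[OF abs_ge_zero])
  define z where "z = s * \<rho>"
  have z: "0 < z" using s \<rho> by (simp add: z_def)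
  show hb: "\<bar>h\<bar> \<le> 4 * a * b / semicircle_ft 0 / (\<rho> * sqrt \<rho>)"
  proof -
    have "\<bar>h\<bar> = 2 * a * b * \<bar>semicircle_ft (\<delta> * \<rho>)\<bar> / semicircle_ft 0 / (\<rho> * sqrt \<rho>)"
      using ab semicircle_ft_0 \<rho> by (simp add: h_def abs_mult)
    also have "\<dots> \<le> 2 * a * b * 2 / semicircle_ft 0 / (\<rho> * sqrt \<rho>)"
      using ab semicircle_ft_0 \<rho> abs_semicircle_ft_le by (intro divide_right_mono mult_left_mono) auto
    finally show ?thesis by simp
  qed
  have "smooth_coeff s \<delta> k = sqrt s * (h * (z * sqrt z * semicircle_ft z))"
  proof -
    define x y where "x = sqrt s" and "y = sqrt \<rho>"
    have xy: "s = x * x" "\<rho> = y * y" "x > 0" "y > 0" using s \<rho> by (auto simp: x_def y_def)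
    have "s\<^sup>2 * (2 * a * b) * gz * gd / g0 = x * (2 * a * b * gd / g0 / (\<rho> * y) * (s * \<rho> * (x * y) * gz))" if "g0 > 0" for g0 gd gz
      unfolding xy(1,2) using xy(3-) that by (simp add: field_simps power2_eq_square)
    from this[OF semicircle_ft_0, of "semicircle_ft z" "semicircle_ft (\<delta> * \<rho>)"] show ?thesis
      by (simp add: smooth_coeff_def h_def x_def y_def z_def real_sqrt_mult \<rho>_def[symmetric])
  qed
  then have "smooth_coeff s \<delta> k - sqrt s * (h * (A * cos z + B * sin z)) = sqrt s * (h * (z * sqrt z * semicircle_ft z - (A * cos z + B * sin z)))"
    by (simp add: algebra_simps)
  also have "\<bar>\<dots>\<bar> \<le> sqrt s * ((4 * a * b / semicircle_ft 0 / (\<rho> * sqrt \<rho>)) * (C / z))"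
    unfolding abs_mult using s hb AB[OF z] C0 z ab semicircle_ft_0 \<rho> by (intro mult_mono) auto
  also have "\<dots> = 4 * a * b * C / semicircle_ft 0 / sqrt s / (\<rho>\<^sup>2 * sqrt \<rho>)"
  proof -
    define x where "x = sqrt s"
    have x: "s = x * x" "x > 0" using s by (auto simp: x_def)
    show ?thesis unfolding z_def x_def[symmetric] unfolding x(1) using x(2) \<rho> by (simp add: field_simps power2_eq_square)
  qed
  finally show "\<bar>smooth_coeff s \<delta> k - sqrt s * (h * (A * cos (s * \<rho>) + B * sin (s * \<rho>)))\<bar> \<le> 4 * a * b * C / semicircle_ft 0 / sqrt s / (\<rho>\<^sup>2 * sqrt \<rho>)"
    by (simp add: z_def)
qed

lemma sum_low_error: "(\<Sum>k\<in>low J. 1 / ((norm (freq k))\<^sup>2 * sqrt (norm (freq k)))) \<le> 4 * shell_const / (gap\<^sup>2 * sqrt gap)"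
proof -
  define D where "D = shell_const / (gap\<^sup>2 * sqrt gap)"
  have D: "0 \<le> D" using shell_const_pos gap_pos by (simp add: D_def)
  have "(\<Sum>k\<in>low J. 1 / ((norm (freq k))\<^sup>2 * sqrt (norm (freq k)))) \<le> (\<Sum>j<J. shell_const * 4 ^ j * (1 / ((2 ^ j * gap)\<^sup>2 * sqrt (2 ^ j * gap))))"
    unfolding sum_low
  proof (intro sum_mono shell_sum_le)
    fix j k assume k: "k \<in> shell j"
    have p: "0 < 2 ^ j * gap" using gap_pos by simp
    have "2 ^ j * gap \<le> norm (freq k)" using k by (simp add: shell_def)
    then show "1 / ((norm (freq k))\<^sup>2 * sqrt (norm (freq k))) \<le> 1 / ((2 ^ j * gap)\<^sup>2 * sqrt (2 ^ j * gap))"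
      using p by (intro divide_left_mono mult_mono power_mono real_sqrt_le_mono mult_pos_pos) auto
  qed (use gap_pos in auto)
  also have "\<dots> = (\<Sum>j<J. D * (1 / sqrt 2) ^ j)"
  proof (rule sum.cong[OF refl])
    fix j
    have "(2 ^ j * gap)\<^sup>2 = 4 ^ j * gap\<^sup>2" by (simp add: power_mult_distrib flip: power_mult) (simp add: mult.commute[of j] power_mult)
    then show "shell_const * 4 ^ j * (1 / ((2 ^ j * gap)\<^sup>2 * sqrt (2 ^ j * gap))) = D * (1 / sqrt 2) ^ j"
      using gap_pos by (simp add: D_def real_sqrt_mult real_sqrt_power power_divide field_simps)
  qed
  also have "\<dots> = D * (\<Sum>j<J. (1 / sqrt 2) ^ j)" by (simp only: sum_distrib_left)
  also have "\<dots> \<le> D * 4"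
  proof (rule mult_left_mono[OF _ D])
    have s2: "4 / 3 \<le> sqrt (2::real)" by (rule real_le_rsqrt) (simp add: power2_eq_square)
    have "1 / sqrt 2 \<le> (3 / 4 :: real)" using s2 by (simp add: field_simps)
    then have "(\<Sum>j<J. (1 / sqrt 2) ^ j) \<le> (\<Sum>j<J. (3 / 4 :: real) ^ j)" by (intro sum_mono power_mono) auto
    also have "\<dots> \<le> 1 / (1 - 3 / 4)" by (rule geometric_le) auto
    finally show "(\<Sum>j<J. (1 / sqrt 2) ^ j) \<le> (4::real)" by simp
  qed
  finally show ?thesis by (simp add: D_def mult_ac)
qed

text \<open>
  The zero frequency gives the area term. The other frequencies of \<open>low J\<close> are split by
  \<open>smooth_coeff_main\<close> into the two exponentials that make up \<open>A cos + B sin\<close> and an error summable over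
  the lattice. The frequencies beyond \<open>2 ^ J \<ge> R\<close> are estimated by \<open>smooth_coeff_tail\<close>; with
  \<open>\<delta> = R powr (-1/2)\<close> their sum \<open>O(sqrt s * \<delta> powr (-3/2) / R)\<close> is \<open>O(sqrt s)\<close>.
\<close>
lemma smoothed_count_packets:
  obtains M C where "0 \<le> M" "0 \<le> C"
    "\<And>R J \<sigma>. 2 \<le> R \<Longrightarrow> R \<le> 2 ^ J \<Longrightarrow> \<bar>\<sigma>\<bar> = 1 \<Longrightarrow> \<exists>c c'. (\<forall>k\<in>low J. norm (c k) \<le> M / (norm (freq k) * sqrt (norm (freq k))) \<and> norm (c' k) \<le> M / (norm (freq k) * sqrt (norm (freq k)))) \<and>
      (\<forall>r\<in>{R..R+1}. \<forall>y. \<bar>lattice_sum (overlap (r + \<sigma> / sqrt R) (1 / sqrt R)) y - (r + \<sigma> / sqrt R)\<^sup>2 * area\<bar>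
        \<le> 2 * sqrt r * (C + norm (packet 0 1 (low J) c r y) + norm (packet 0 (-1) (low J) c' r y)))"
proof -
  obtain A B C1 where AB: "\<And>z. 0 < z \<Longrightarrow> \<bar>z * sqrt z * semicircle_ft z - (A * cos z + B * sin z)\<bar> \<le> C1 / z"
    using semicircle_ft_asymptotics by blast
  obtain C2 where C2: "\<And>z. 0 < z \<Longrightarrow> \<bar>semicircle_ft z\<bar> * (z * sqrt z) \<le> C2"
    using semicircle_ft_decay by blast
  have C10: "0 \<le> C1" using AB[of 1] by (simp add: order.trans[OF abs_ge_zero])
  \<comment> \<open>With this \<open>z\<close>, \<open>A * cos \<theta> + B * sin \<theta>\<close> is \<open>z * cis \<theta>\<close> plus its complex conjugate.\<close>
  define z where "z = Complex (A / 2) (- B / 2)"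
  define M where "M = 4 * a * b / semicircle_ft 0 * norm z"
  define CT where "CT = 2 * shell_const * (2 * a * b * C2\<^sup>2 / semicircle_ft 0 / gap ^ 3)"
  define CE where "CE = 4 * a * b * C1 / semicircle_ft 0 * (4 * shell_const / (gap\<^sup>2 * sqrt gap))"
  have M0: "0 \<le> M" using ab semicircle_ft_0 by (simp add: M_def)
  have CT0: "0 \<le> CT" using ab semicircle_ft_0 shell_const_pos gap_pos by (simp add: CT_def)
  have CE0: "0 \<le> CE" using ab semicircle_ft_0 shell_const_pos gap_pos C10 by (simp add: CE_def)
  show ?thesis
  proof (rule that[of M "CT + CE"])
    fix R :: real and J :: nat and \<sigma> :: real
    assume R: "2 \<le> R" and J: "R \<le> 2 ^ J" and \<sigma>: "\<bar>\<sigma>\<bar> = 1"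
    define \<delta> where "\<delta> = 1 / sqrt R"
    have sR: "1 \<le> sqrt R" using R by simp
    have \<delta>: "0 < \<delta>" "\<delta> \<le> 1" using sR R by (auto simp: \<delta>_def)
    define \<rho> where "\<rho> k = norm (freq k)" for k
    define h where "h k = 2 * a * b * semicircle_ft (\<delta> * \<rho> k) / semicircle_ft 0 / (\<rho> k * sqrt (\<rho> k))" for k
    define c where "c k = of_real (h k) * z * cis (\<sigma> * \<delta> * \<rho> k)" for k
    define c' where "c' k = of_real (h k) * cnj z * cis (- (\<sigma> * \<delta> * \<rho> k))" for k
    have hb: "\<bar>h k\<bar> \<le> 4 * a * b / semicircle_ft 0 / (\<rho> k * sqrt (\<rho> k))" if "k \<in> low J" for k
      using smooth_coeff_main(2)[OF AB zero_less_one \<delta>(1) low_nonzero[OF that]] by (simp add: h_def \<rho>_def)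
    have cb: "norm (c k) \<le> M / (\<rho> k * sqrt (\<rho> k))" "norm (c' k) \<le> M / (\<rho> k * sqrt (\<rho> k))" if "k \<in> low J" for k
      using mult_right_mono[OF hb[OF that], of "norm z"] by (simp_all add: c_def c'_def norm_mult M_def)
    have main: "\<bar>lattice_sum (overlap s \<delta>) y - s\<^sup>2 * area\<bar> \<le> 2 * sqrt r * (CT + CE + norm (packet 0 1 (low J) c r y) + norm (packet 0 (-1) (low J) c' r y))"
      if r: "r \<in> {R..R+1}" and s_def: "s = r + \<sigma> * \<delta>" for r y s
    proof -
      have "\<bar>\<sigma> * \<delta>\<bar> \<le> 1" using \<sigma> \<delta> by (simp add: abs_mult)
      then have s: "1 \<le> s" "s \<le> 2 * r" using r R by (auto simp: s_def abs_le_iff)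
      have s0: "0 < s" using s by simp
      define X where "X = sqrt s * (norm (packet 0 1 (low J) c r y) + norm (packet 0 (-1) (low J) c' r y))"
      have zero: "0 \<notin> low J" using low_nonzero[of 0 J] by (auto simp: freq_0)
      define K where "K = insert 0 (low J)"
      have K: "finite K" "K \<subseteq> int_lattice" using finite_low low_lattice by (auto simp: K_def int_lattice_group)
      have tail: "norm (of_real (lattice_sum (overlap s \<delta>) y) - (\<Sum>k\<in>K. of_real (smooth_coeff s \<delta> k) * echar k y)) \<le> CT * sqrt s"
      proof (rule smoothed_count_fourier[OF \<delta>(1) s0 K])
        fix K' assume K': "finite K'" "K' \<subseteq> int_lattice - K"
        define B' where "B' = 2 * a * b * C2\<^sup>2 / semicircle_ft 0 / gap ^ 3 * (sqrt s / (\<delta> * sqrt \<delta>))"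
        have B'0: "0 \<le> B'" using ab semicircle_ft_0 gap_pos s0 \<delta> by (simp add: B'_def)
        have "(\<Sum>k\<in>K'. \<bar>smooth_coeff s \<delta> k\<bar>) \<le> 2 * shell_const * B' / 2 ^ J"
          using K' smooth_coeff_tail[OF C2 s0 \<delta>(1)] B'0 by (intro tail_sum) (auto simp: K_def B'_def)
        also have "\<dots> = CT * sqrt s * (1 / (\<delta> * sqrt \<delta> * 2 ^ J))" by (simp add: CT_def B'_def)
        also have "\<dots> \<le> CT * sqrt s * 1"
        proof (rule mult_left_mono)
          define t where "t = sqrt \<delta>"
          have t: "0 < t" "t \<le> 1" "t * t = \<delta>" using \<delta> by (auto simp: t_def)
          have "\<delta> * \<delta> * R = 1" using R by (simp add: \<delta>_def)
          then have "1 \<le> \<delta> * \<delta> * 2 ^ J" using J mult_left_mono[of R "2 ^ J" "\<delta> * \<delta>"] by simp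
          also have "\<dots> \<le> \<delta> * t * 2 ^ J"
          proof -
            have "t * t \<le> t * 1" using t by (intro mult_left_mono) auto
            then show ?thesis using t(3) \<delta> by (intro mult_right_mono mult_left_mono) auto
          qed
          finally show "1 / (\<delta> * sqrt \<delta> * 2 ^ J) \<le> 1" by (simp add: t_def divide_le_eq_1)
        qed (use CT0 s0 in simp)
        finally show "(\<Sum>k\<in>K'. \<bar>smooth_coeff s \<delta> k\<bar>) \<le> CT * sqrt s" by simp
      qed
      have tri: "of_real (h k * (A * cos (s * \<rho> k) + B * sin (s * \<rho> k))) = c k * cis (r * \<rho> k) + c' k * cis (- (r * \<rho> k))" for k
      proof -
        have "c k * cis (r * \<rho> k) = of_real (h k) * (z * cis (s * \<rho> k))"
          by (simp add: c_def s_def cis_mult algebra_simps)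
        moreover have "c' k * cis (- (r * \<rho> k)) = of_real (h k) * cnj (z * cis (s * \<rho> k))"
          by (simp add: c'_def s_def cis_mult cis_cnj algebra_simps)
        ultimately show ?thesis by (simp add: complex_eq_iff z_def algebra_simps)
      qed
      have "(\<Sum>k\<in>K. of_real (smooth_coeff s \<delta> k) * echar k y) = of_real (s\<^sup>2 * area) + (\<Sum>k\<in>low J. of_real (smooth_coeff s \<delta> k) * echar k y)"
        unfolding K_def using zero finite_low by (simp add: smooth_coeff_0 echar_simps)
      moreover have "norm ((\<Sum>k\<in>low J. of_real (smooth_coeff s \<delta> k) * echar k y) - of_real (sqrt s) * (packet 0 1 (low J) c r y + packet 0 (-1) (low J) c' r y)) \<le> CE * sqrt s"
      proof -
        have pk: "packet 0 1 (low J) c r y + packet 0 (-1) (low J) c' r y = (\<Sum>k\<in>low J. of_real (h k * (A * cos (s * \<rho> k) + B * sin (s * \<rho> k))) * echar k y)"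
          unfolding tri by (simp add: packet_def \<rho>_def sum.distrib distrib_right)
        define e where "e k = 1 / ((\<rho> k)\<^sup>2 * sqrt (\<rho> k))" for k
        define Kc where "Kc = 4 * a * b * C1 / semicircle_ft 0 / sqrt s"
        have Kc0: "0 \<le> Kc" using ab C10 semicircle_ft_0 s0 by (simp add: Kc_def)
        have eq: "(\<Sum>k\<in>low J. of_real (smooth_coeff s \<delta> k) * echar k y) - of_real (sqrt s) * (packet 0 1 (low J) c r y + packet 0 (-1) (low J) c' r y) =
          (\<Sum>k\<in>low J. of_real (smooth_coeff s \<delta> k - sqrt s * (h k * (A * cos (s * \<rho> k) + B * sin (s * \<rho> k)))) * echar k y)"
          unfolding pk by (simp add: sum_distrib_left sum_subtractf[symmetric] algebra_simps)
        have "norm (\<Sum>k\<in>low J. of_real (smooth_coeff s \<delta> k - sqrt s * (h k * (A * cos (s * \<rho> k) + B * sin (s * \<rho> k)))) * echar k y) \<le> (\<Sum>k\<in>low J. Kc * e k)"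
        proof (rule sum_norm_le)
          fix k assume "k \<in> low J"
          from smooth_coeff_main(1)[OF AB s0 \<delta>(1) low_nonzero[OF this]]
          show "norm (of_real (smooth_coeff s \<delta> k - sqrt s * (h k * (A * cos (s * \<rho> k) + B * sin (s * \<rho> k)))) * echar k y) \<le> Kc * e k"
            unfolding norm_mult norm_of_real echar_simps(1) by (simp add: h_def \<rho>_def Kc_def e_def)
        qed
        also have "(\<Sum>k\<in>low J. Kc * e k) = Kc * (\<Sum>k\<in>low J. e k)" by (simp only: sum_distrib_left)
        also have "\<dots> \<le> Kc * (4 * shell_const / (gap\<^sup>2 * sqrt gap))"
          unfolding e_def \<rho>_def by (intro mult_left_mono sum_low_error Kc0)
        also have "\<dots> = CE * (1 / sqrt s)" by (simp add: CE_def Kc_def)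
        also have "\<dots> \<le> CE * sqrt s"
        proof (rule mult_left_mono[OF _ CE0])
          have "1 \<le> sqrt s" using s by simp
          then have "1 / sqrt s \<le> 1" by simp
          then show "1 / sqrt s \<le> sqrt s" using \<open>1 \<le> sqrt s\<close> by linarith
        qed
        finally show ?thesis unfolding eq .
      qed
      moreover have "norm (of_real (sqrt s) * (packet 0 1 (low J) c r y + packet 0 (-1) (low J) c' r y)) \<le> X"
        unfolding X_def norm_mult using s0 by (intro mult_mono norm_triangle_ineq) auto
      ultimately have "norm (of_real (lattice_sum (overlap s \<delta>) y) - of_real (s\<^sup>2 * area) :: complex) \<le> CT * sqrt s + (CE * sqrt s + X)"
      proof -
        assume 1: "(\<Sum>k\<in>K. of_real (smooth_coeff s \<delta> k) * echar k y) = of_real (s\<^sup>2 * area) + (\<Sum>k\<in>low J. of_real (smooth_coeff s \<delta> k) * echar k y)"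
          and 2: "norm ((\<Sum>k\<in>low J. of_real (smooth_coeff s \<delta> k) * echar k y) - of_real (sqrt s) * (packet 0 1 (low J) c r y + packet 0 (-1) (low J) c' r y)) \<le> CE * sqrt s"
          and 3: "norm (of_real (sqrt s) * (packet 0 1 (low J) c r y + packet 0 (-1) (low J) c' r y)) \<le> X"
        define a1 where "a1 = (\<Sum>k\<in>low J. of_real (smooth_coeff s \<delta> k) * echar k y)"
        define a2 where "a2 = of_real (sqrt s) * (packet 0 1 (low J) c r y + packet 0 (-1) (low J) c' r y)"
        define a0 where "a0 = (of_real (lattice_sum (overlap s \<delta>) y) :: complex)"
        have "norm (a0 - of_real (s\<^sup>2 * area)) \<le> norm (a0 - (of_real (s\<^sup>2 * area) + a1)) + norm (a1 - a2) + norm a2"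
        proof -
          have e: "a0 - of_real (s\<^sup>2 * area) = (a0 - (of_real (s\<^sup>2 * area) + a1)) + ((a1 - a2) + a2)" by simp
          show ?thesis by (subst e) (intro order.trans[OF norm_triangle_ineq] order.trans[OF add_left_mono[OF norm_triangle_ineq]], simp)
        qed
        then show ?thesis using tail 2 3 unfolding 1 a1_def[symmetric] a2_def[symmetric] a0_def[symmetric] by linarith
      qed
      then have "\<bar>lattice_sum (overlap s \<delta>) y - s\<^sup>2 * area\<bar> \<le> CT * sqrt s + (CE * sqrt s + X)"
        by (simp only: of_real_diff[symmetric] norm_of_real)
      also have "\<dots> = sqrt s * (CT + CE + norm (packet 0 1 (low J) c r y) + norm (packet 0 (-1) (low J) c' r y))"
        by (simp add: X_def algebra_simps)
      also have "\<dots> \<le> (2 * sqrt r) * (CT + CE + norm (packet 0 1 (low J) c r y) + norm (packet 0 (-1) (low J) c' r y))"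
      proof (rule mult_right_mono)
        have "sqrt s \<le> sqrt (4 * r)" using s r R by (intro real_sqrt_le_mono) auto
        then show "sqrt s \<le> 2 * sqrt r" by (simp add: real_sqrt_mult)
      qed (use CT0 CE0 in simp)
      finally show ?thesis .
    qed
    have "\<forall>r\<in>{R..R+1}. \<forall>y. \<bar>lattice_sum (overlap (r + \<sigma> / sqrt R) (1 / sqrt R)) y - (r + \<sigma> / sqrt R)\<^sup>2 * area\<bar>
        \<le> 2 * sqrt r * (CT + CE + norm (packet 0 1 (low J) c r y) + norm (packet 0 (-1) (low J) c' r y))"
      using main[OF _ refl] by (simp add: \<delta>_def)
    then show "\<exists>c c'. (\<forall>k\<in>low J. norm (c k) \<le> M / (norm (freq k) * sqrt (norm (freq k))) \<and> norm (c' k) \<le> M / (norm (freq k) * sqrt (norm (freq k)))) \<and>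
      (\<forall>r\<in>{R..R+1}. \<forall>y. \<bar>lattice_sum (overlap (r + \<sigma> / sqrt R) (1 / sqrt R)) y - (r + \<sigma> / sqrt R)\<^sup>2 * area\<bar>
        \<le> 2 * sqrt r * (CT + CE + norm (packet 0 1 (low J) c r y) + norm (packet 0 (-1) (low J) c' r y)))"
      using cb unfolding \<rho>_def by blast
  qed (use M0 CT0 CE0 in auto)
qed

end

section \<open>Domination of the discrepancy\<close>

lemma set_integral_linear_combination:
  fixes f g :: "'l \<Rightarrow> 'a \<Rightarrow> real"
  assumes L: "finite L" and T: "integrable M (indicat_real T)"
    and f: "\<And>l. l \<in> L \<Longrightarrow> set_integrable M T (f l)" and g: "\<And>l. l \<in> L \<Longrightarrow> set_integrable M T (g l)"
  shows "set_integrable M T (\<lambda>x. A + (\<Sum>l\<in>L. \<alpha> l * f l x + \<beta> l * g l x))"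
    and "(LINT x:T|M. A + (\<Sum>l\<in>L. \<alpha> l * f l x + \<beta> l * g l x)) = A * (\<integral>x. indicat_real T x \<partial>M) + (\<Sum>l\<in>L. \<alpha> l * (LINT x:T|M. f l x) + \<beta> l * (LINT x:T|M. g l x))"
proof -
  have e: "indicat_real T x *\<^sub>R (A + (\<Sum>l\<in>L. \<alpha> l * f l x + \<beta> l * g l x)) =
    A * indicat_real T x + (\<Sum>l\<in>L. \<alpha> l * (indicat_real T x *\<^sub>R f l x) + \<beta> l * (indicat_real T x *\<^sub>R g l x))" for x
    by (simp add: distrib_left sum_distrib_left mult_ac)
  have i: "integrable M (\<lambda>x. A * indicat_real T x)" using T by (rule integrable_mult_right)
  have j: "integrable M (\<lambda>x. \<Sum>l\<in>L. \<alpha> l * (indicat_real T x *\<^sub>R f l x) + \<beta> l * (indicat_real T x *\<^sub>R g l x))"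
    using f g unfolding set_integrable_def
    by (intro Bochner_Integration.integrable_sum Bochner_Integration.integrable_add integrable_mult_right) auto
  show "set_integrable M T (\<lambda>x. A + (\<Sum>l\<in>L. \<alpha> l * f l x + \<beta> l * g l x))"
    unfolding set_integrable_def e using i j by (rule Bochner_Integration.integrable_add)
  have "(\<integral>x. (\<Sum>l\<in>L. \<alpha> l * (indicat_real T x *\<^sub>R f l x) + \<beta> l * (indicat_real T x *\<^sub>R g l x)) \<partial>M) =
     (\<Sum>l\<in>L. (\<integral>x. \<alpha> l * (indicat_real T x *\<^sub>R f l x) + \<beta> l * (indicat_real T x *\<^sub>R g l x) \<partial>M))"
    using f g unfolding set_integrable_def
    by (intro Bochner_Integration.integral_sum Bochner_Integration.integrable_add integrable_mult_right) auto
  also have "\<dots> = (\<Sum>l\<in>L. \<alpha> l * (\<integral>x. indicat_real T x *\<^sub>R f l x \<partial>M) + \<beta> l * (\<integral>x. indicat_real T x *\<^sub>R g l x \<partial>M))"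
  proof (rule sum.cong[OF refl])
    fix l assume l: "l \<in> L"
    note fl = f[OF l, unfolded set_integrable_def] and gl = g[OF l, unfolded set_integrable_def]
    show "(\<integral>x. \<alpha> l * (indicat_real T x *\<^sub>R f l x) + \<beta> l * (indicat_real T x *\<^sub>R g l x) \<partial>M) =
      \<alpha> l * (\<integral>x. indicat_real T x *\<^sub>R f l x \<partial>M) + \<beta> l * (\<integral>x. indicat_real T x *\<^sub>R g l x \<partial>M)"
      unfolding Bochner_Integration.integral_add[OF integrable_mult_right[OF fl] integrable_mult_right[OF gl]]
      by (simp only: integral_mult_right_zero)
  qed
  finally show "(LINT x:T|M. A + (\<Sum>l\<in>L. \<alpha> l * f l x + \<beta> l * g l x)) = A * (\<integral>x. indicat_real T x \<partial>M) + (\<Sum>l\<in>L. \<alpha> l * (LINT x:T|M. f l x) + \<beta> l * (LINT x:T|M. g l x))"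
    unfolding set_lebesgue_integral_def e Bochner_Integration.integral_add[OF i j] by (simp only: integral_mult_right_zero)
qed

lemma set_integral_mono_dominated:
  fixes f g :: "'a \<Rightarrow> real"
  assumes "set_integrable M T g" "\<And>x. x \<in> T \<Longrightarrow> f x \<le> g x" "\<And>x. x \<in> T \<Longrightarrow> 0 \<le> g x"
  shows "(LINT x:T|M. f x) \<le> (LINT x:T|M. g x)"
  unfolding set_lebesgue_integral_def
  by (rule integral_mono'[OF assms(1)[unfolded set_integrable_def]]) (use assms(2,3) in \<open>auto simp: indicator_def\<close>)

lemma set_integrable_continuous_lebesgue:
  fixes f :: "real^2 \<Rightarrow> real"
  assumes "continuous_on UNIV f" shows "set_integrable lebesgue torus_domain f"
proof -
  have m [measurable]: "f \<in> borel_measurable borel" using assms by (rule borel_measurable_continuous_onI)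
  have "compact (f ` cbox 0 1)" by (intro compact_continuous_image continuous_on_subset[OF assms]) auto
  then obtain B where "\<And>x. x \<in> cbox 0 1 \<Longrightarrow> norm (f x) \<le> B" by (meson bounded_iff compact_imp_bounded imageI)
  then have "integrable lborel (\<lambda>x. indicator torus_domain x *\<^sub>R f x)"
    using torus_domain_subset by (intro integrable_torus[where B=B]) auto
  then show ?thesis unfolding set_integrable_def by (subst integrable_completion) auto
qed

lemma lebesgue_torus: "integrable lebesgue (indicat_real torus_domain)" "(\<integral>x. indicat_real torus_domain x \<partial>lebesgue) = 1"
proof -
  show "integrable lebesgue (indicat_real torus_domain)"
    using set_integrable_continuous_lebesgue[of "\<lambda>_. 1"] by (simp add: set_integrable_def)
  have "complex_of_real (\<integral>x. indicat_real torus_domain x \<partial>lborel) = 1"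
    using integral_torus_echar[of 0] by (simp add: int_lattice_group echar_simps scaleR_conv_of_real)
  then show "(\<integral>x. indicat_real torus_domain x \<partial>lebesgue) = 1"
    by (subst integral_completion) auto
qed

lemma lebesgue_unit_interval:
  "integrable lebesgue (indicat_real {R..R+1})" "(\<integral>x. indicat_real {R..R+1} x \<partial>lebesgue) = 1" for R :: real
  by (simp_all add: integrable_completion integral_completion)

lemma set_integrable_interval_lebesgue:
  fixes f :: "real \<Rightarrow> real"
  assumes "continuous_on UNIV f" shows "set_integrable lebesgue {R..R+1} f"
proof -
  have [measurable]: "f \<in> borel_measurable borel" using assms by (rule borel_measurable_continuous_onI)
  have "integrable lborel (\<lambda>x. indicator {R..R+1} x *\<^sub>R f x)"
    by (rule borel_integrable_compact) (auto intro: continuous_on_subset[OF assms])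
  then show ?thesis unfolding set_integrable_def by (subst integrable_completion) auto
qed

lemma five_powr:
  fixes Y :: "nat \<Rightarrow> real"
  assumes "\<And>i. 0 \<le> Y i" "0 < p"
  shows "(1 + (\<Sum>i<4. Y i)) powr p \<le> 5 powr p * (1 + (\<Sum>i<4. Y i powr p))"
proof -
  define y where "y i = (if i = 4 then 1 else Y i)" for i :: nat
  have "(\<Sum>i<5. y i) powr p \<le> 5 powr p * (\<Sum>i<5. (1 * y i) powr p)"
    by (rule sum_powr_weighted) (use assms in \<open>auto simp: y_def\<close>)
  then show ?thesis by (simp add: eval_nat_numeral y_def algebra_simps)
qed

lemma dyadic_scale:
  fixes R :: real assumes "2 \<le> R"
  obtains J :: nat where "R \<le> 2 ^ J" "real J \<le> 4 * ln R"
proof -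
  define J where "J = nat \<lceil>log 2 R\<rceil>"
  have l: "1 \<le> log 2 R" using assms by simp
  have "log 2 R \<le> real J" unfolding J_def by (rule real_nat_ceiling_ge)
  then have "2 powr (log 2 R) \<le> 2 powr real J" by (rule powr_mono) simp
  then have 1: "R \<le> 2 ^ J" using assms by (simp add: powr_realpow)
  have "real J \<le> log 2 R + 1" using l unfolding J_def by linarith
  also have "\<dots> \<le> 2 * log 2 R" using l by linarith
  also have "log 2 R = ln R / ln 2" by (simp add: log_def)
  also have "ln R / ln 2 \<le> ln R / (1/2)" using assms ln2_ge_two_thirds by (intro divide_left_mono) auto
  finally have "real J \<le> 4 * ln R" by simp
  with 1 show ?thesis by (rule that)
qed

context ellipse begin

lemma packet_shift: "packet 0 \<epsilon> S c r (x - r *\<^sub>R c0) = packet c0 \<epsilon> S c r x"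
  unfolding packet_def
proof (rule sum.cong[OF refl])
  fix k
  have "cis (r * (\<epsilon> * norm (freq k) - 2 * pi * (k \<bullet> 0))) * echar k (x - r *\<^sub>R c0) = cis (r * (\<epsilon> * norm (freq k) - 2 * pi * (k \<bullet> c0))) * echar k x"
    unfolding echar_def cis_mult by (rule arg_cong[where f=cis]) (simp add: inner_diff_right algebra_simps)
  then show "c k * cis (r * (\<epsilon> * norm (freq k) - 2 * pi * (k \<bullet> 0))) * echar k (x - r *\<^sub>R c0) = c k * cis (r * (\<epsilon> * norm (freq k) - 2 * pi * (k \<bullet> c0))) * echar k x"
    by (simp only: mult.assoc)
qed

text \<open>
  Replacing the radius \<open>r\<close> by \<open>r \<plusminus> R powr (-1/2)\<close> changes the area by \<open>O(sqrt r)\<close>, so by \<open>count_sandwich\<close>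
  the smoothed counts with these two radii control the discrepancy. Each of them contributes two packets.
\<close>
lemma discrepancy_packets:
  fixes c0 :: "real^2"
  defines "E \<equiv> {x. (((x - c0) \<bullet> u) / a)\<^sup>2 + (((x - c0) \<bullet> v) / b)\<^sup>2 \<le> 1}"
  obtains M C where "0 \<le> M" "0 \<le> C"
    "\<And>R J. 2 \<le> R \<Longrightarrow> R \<le> 2 ^ J \<Longrightarrow> \<exists>c :: nat \<Rightarrow> real^2 \<Rightarrow> complex. (\<forall>i. \<forall>k\<in>low J. norm (c i k) \<le> M / (norm (freq k) * sqrt (norm (freq k)))) \<and>
      (\<forall>r\<in>{R..R+1}. \<forall>x. \<bar>r powr (- 1 / 2) * discrepancy E r x\<bar> \<le> C * (1 + (\<Sum>i<4. norm (packet c0 ((-1) ^ i) (low J) (c i) r x))))"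
proof -
  obtain M C where M: "0 \<le> M" and C: "0 \<le> C" and *:
    "\<And>R J \<sigma>. 2 \<le> R \<Longrightarrow> R \<le> 2 ^ J \<Longrightarrow> \<bar>\<sigma>\<bar> = 1 \<Longrightarrow> \<exists>c c'. (\<forall>k\<in>low J. norm (c k) \<le> M / (norm (freq k) * sqrt (norm (freq k))) \<and> norm (c' k) \<le> M / (norm (freq k) * sqrt (norm (freq k)))) \<and>
      (\<forall>r\<in>{R..R+1}. \<forall>y. \<bar>lattice_sum (overlap (r + \<sigma> / sqrt R) (1 / sqrt R)) y - (r + \<sigma> / sqrt R)\<^sup>2 * area\<bar>
        \<le> 2 * sqrt r * (C + norm (packet 0 1 (low J) c r y) + norm (packet 0 (-1) (low J) c' r y)))"
    using smoothed_count_packets by metis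
  show ?thesis
  proof (rule that[of M "2 * (2 * C + 3 * area + 1)"])
    fix R :: real and J :: nat assume R: "2 \<le> R" and J: "R \<le> 2 ^ J"
    obtain c1 c1' where c1: "\<forall>k\<in>low J. norm (c1 k) \<le> M / (norm (freq k) * sqrt (norm (freq k))) \<and> norm (c1' k) \<le> M / (norm (freq k) * sqrt (norm (freq k)))"
      and H1: "\<forall>r\<in>{R..R+1}. \<forall>y. \<bar>lattice_sum (overlap (r + 1 / sqrt R) (1 / sqrt R)) y - (r + 1 / sqrt R)\<^sup>2 * area\<bar>
        \<le> 2 * sqrt r * (C + norm (packet 0 1 (low J) c1 r y) + norm (packet 0 (-1) (low J) c1' r y))"
      using *[OF R J, of 1] by auto
    obtain c2 c2' where c2: "\<forall>k\<in>low J. norm (c2 k) \<le> M / (norm (freq k) * sqrt (norm (freq k))) \<and> norm (c2' k) \<le> M / (norm (freq k) * sqrt (norm (freq k)))"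
      and H2: "\<forall>r\<in>{R..R+1}. \<forall>y. \<bar>lattice_sum (overlap (r + (-1) / sqrt R) (1 / sqrt R)) y - (r + (-1) / sqrt R)\<^sup>2 * area\<bar>
        \<le> 2 * sqrt r * (C + norm (packet 0 1 (low J) c2 r y) + norm (packet 0 (-1) (low J) c2' r y))"
      using *[OF R J, of "-1"] by auto
    define c where "c i = (if i = 0 then c1 else if i = 1 then c1' else if i = 2 then c2 else c2')" for i :: nat
    have cb: "\<forall>i. \<forall>k\<in>low J. norm (c i k) \<le> M / (norm (freq k) * sqrt (norm (freq k)))"
      using c1 c2 by (auto simp: c_def)
    have main: "\<bar>r powr (- 1 / 2) * discrepancy E r x\<bar> \<le> 2 * (2 * C + 3 * area + 1) * (1 + (\<Sum>i<4. norm (packet c0 ((-1) ^ i) (low J) (c i) r x)))"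
      if r: "r \<in> {R..R+1}" for r x
    proof -
      define y where "y = x - r *\<^sub>R c0"
      define \<delta> where "\<delta> = 1 / sqrt R"
      have r0: "0 < r" "1 \<le> r" "r \<le> 4 * R" using r R by auto
      have sR: "1 \<le> sqrt R" using R by simp
      have \<delta>: "0 < \<delta>" "\<delta> \<le> 1" using sR R by (auto simp: \<delta>_def)
      define P1 where "P1 = norm (packet 0 1 (low J) c1 r y) + norm (packet 0 (-1) (low J) c1' r y)"
      define P2 where "P2 = norm (packet 0 1 (low J) c2 r y) + norm (packet 0 (-1) (low J) c2' r y)"
      have P0: "0 \<le> P1" "0 \<le> P2" by (auto simp: P1_def P2_def)
      have PS: "P1 + P2 = (\<Sum>i<4. norm (packet c0 ((-1) ^ i) (low J) (c i) r x))"
        unfolding P1_def P2_def y_def packet_shift by (simp add: eval_nat_numeral c_def)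
      have h1: "\<bar>lattice_sum (overlap (r + \<delta>) \<delta>) y - (r + \<delta>)\<^sup>2 * area\<bar> \<le> 2 * sqrt r * (C + P1)"
        using H1 r by (simp add: \<delta>_def P1_def add.assoc)
      have h2: "\<bar>lattice_sum (overlap (r - \<delta>) \<delta>) y - (r - \<delta>)\<^sup>2 * area\<bar> \<le> 2 * sqrt r * (C + P2)"
        using H2 r by (simp add: \<delta>_def P2_def add.assoc)
      have s1: "lattice_count r y \<le> lattice_sum (overlap (r + \<delta>) \<delta>) y" and s2: "lattice_sum (overlap (r - \<delta>) \<delta>) y \<le> lattice_count r y"
        unfolding lattice_count_def by (rule count_sandwich[OF \<delta>(1)])+
      have rd: "r * \<delta> \<le> 2 * sqrt r"
      proof -
        have "sqrt r \<le> sqrt (4 * R)" using r0 by (intro real_sqrt_le_mono)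
        then have "sqrt r \<le> 2 * sqrt R" by (simp add: real_sqrt_mult)
        then have "sqrt r * \<delta> \<le> 2" using sR by (simp add: \<delta>_def divide_le_eq)
        then have "sqrt r * (sqrt r * \<delta>) \<le> sqrt r * 2" using r0 by (intro mult_left_mono) auto
        moreover have "sqrt r * (sqrt r * \<delta>) = r * \<delta>" using r0 by (simp add: mult.assoc[symmetric])
        ultimately show ?thesis by simp
      qed
      have sq: "(r + \<delta>)\<^sup>2 * area - r\<^sup>2 * area \<le> 6 * sqrt r * area" "r\<^sup>2 * area - (r - \<delta>)\<^sup>2 * area \<le> 6 * sqrt r * area"
      proof -
        have dd: "\<delta> * \<delta> \<le> r * \<delta>" using \<delta> r0 by (intro mult_right_mono) auto
        have "(r + \<delta>)\<^sup>2 - r\<^sup>2 \<le> 6 * sqrt r" using dd rd by (simp add: power2_eq_square algebra_simps)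
        from mult_right_mono[OF this, of area] area_pos show "(r + \<delta>)\<^sup>2 * area - r\<^sup>2 * area \<le> 6 * sqrt r * area" by (simp add: left_diff_distrib)
        have "0 \<le> \<delta> * \<delta>" "0 \<le> sqrt r" using r0 by auto
        moreover have "r\<^sup>2 - (r - \<delta>)\<^sup>2 = 2 * (r * \<delta>) - \<delta> * \<delta>" by (simp add: power2_eq_square algebra_simps)
        ultimately have "r\<^sup>2 - (r - \<delta>)\<^sup>2 \<le> 6 * sqrt r" using rd by linarith
        from mult_right_mono[OF this, of area] area_pos show "r\<^sup>2 * area - (r - \<delta>)\<^sup>2 * area \<le> 6 * sqrt r * area" by (simp add: left_diff_distrib)
      qed
      have mono: "2 * sqrt r * (C + P1) \<le> 2 * sqrt r * (C + (P1 + P2))" "2 * sqrt r * (C + P2) \<le> 2 * sqrt r * (C + (P1 + P2))"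
        using P0 r0 by (auto intro!: mult_left_mono)
      have "\<bar>lattice_count r y - r\<^sup>2 * area\<bar> \<le> 2 * sqrt r * (C + (P1 + P2)) + 6 * sqrt r * area"
        using h1 h2 s1 s2 sq mono by (simp only: abs_le_iff) linarith
      also have "\<dots> = sqrt r * (2 * (C + (P1 + P2) + 3 * area))" by (simp add: algebra_simps)
      also have "\<dots> \<le> sqrt r * (2 * (2 * C + 3 * area + 1) * (1 + (P1 + P2)))"
      proof (rule mult_left_mono)
        have "0 \<le> (2 * C + 3 * area) * (P1 + P2)" using C area_pos P0 by (intro mult_nonneg_nonneg) auto
        then show "2 * (C + (P1 + P2) + 3 * area) \<le> 2 * (2 * C + 3 * area + 1) * (1 + (P1 + P2))"
          using C by (simp add: algebra_simps)
      qed (use r0 in simp)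
      finally have b: "\<bar>lattice_count r y - r\<^sup>2 * area\<bar> \<le> sqrt r * (2 * (2 * C + 3 * area + 1) * (1 + (P1 + P2)))" .
      have pw: "r powr (- 1 / 2) = 1 / sqrt r" using r0 by (simp add: powr_minus_divide powr_half_sqrt)
      have "\<bar>r powr (- 1 / 2) * discrepancy E r x\<bar> = \<bar>lattice_count r y - r\<^sup>2 * area\<bar> / sqrt r"
        unfolding pw E_def discrepancy_ellipse[OF r0(1)] y_def using r0 by (simp add: abs_mult)
      also have "\<dots> \<le> 2 * (2 * C + 3 * area + 1) * (1 + (P1 + P2))"
        using b r0 by (simp add: divide_le_eq mult.commute)
      finally show ?thesis unfolding PS .
    qed
    show "\<exists>c. (\<forall>i. \<forall>k\<in>low J. norm (c i k) \<le> M / (norm (freq k) * sqrt (norm (freq k)))) \<and>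
      (\<forall>r\<in>{R..R+1}. \<forall>x. \<bar>r powr (- 1 / 2) * discrepancy E r x\<bar> \<le> 2 * (2 * C + 3 * area + 1) * (1 + (\<Sum>i<4. norm (packet c0 ((-1) ^ i) (low J) (c i) r x))))"
      using cb main by blast
  qed (use M C area_pos in auto)
qed

lemma continuous_on_packet: "continuous_on A (packet c0 \<epsilon> S c r)"
  unfolding packet_def by (intro continuous_intros)

text \<open>
  The dominating function is a linear combination of powers of packets. Its mean over the torus is a
  continuous function of \<open>r\<close>, and integration preserves the domination at both stages.
\<close>
lemma dominated_mean:
  fixes f :: "real \<Rightarrow> real^2 \<Rightarrow> real" and c :: "'l \<Rightarrow> real^2 \<Rightarrow> complex"
  assumes L: "finite L" and S: "\<And>l. l \<in> L \<Longrightarrow> finite (S l) \<and> S l \<subseteq> int_lattice" and \<epsilon>: "\<And>l. l \<in> L \<Longrightarrow> (\<epsilon> l)\<^sup>2 = 1"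
    and nn: "0 \<le> A" "\<And>l. 0 \<le> \<alpha> l" "\<And>l. 0 \<le> \<beta> l"
    and dom: "\<And>r x. r \<in> {R..R+1} \<Longrightarrow> f r x \<le> A + (\<Sum>l\<in>L. \<alpha> l * (norm (packet c0 (\<epsilon> l) (S l) (c l) r x))\<^sup>2 + \<beta> l * norm (packet c0 (\<epsilon> l) (S l) (c l) r x) ^ 6)"
  shows "(LINT r:{R..R+1}|lebesgue. LINT x:torus_domain|lebesgue. f r x) \<le>
     A + (\<Sum>l\<in>L. \<alpha> l * (22 * (\<Sum>k\<in>S l. (norm (c l k))\<^sup>2)) + \<beta> l * (const6 * (\<Sum>k\<in>S l. (norm (c l k))\<^sup>2 * (1 + norm (freq k))) ^ 3))"
proof -
  define p where "p l r x = norm (packet c0 (\<epsilon> l) (S l) (c l) r x)" for l r x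
  define G2 where "G2 l r = (LINT x:torus_domain|lebesgue. (p l r x)\<^sup>2)" for l r
  define G6 where "G6 l r = (LINT x:torus_domain|lebesgue. p l r x ^ 6)" for l r
  have G0: "0 \<le> G2 l r" "0 \<le> G6 l r" for l r
    unfolding G2_def G6_def set_lebesgue_integral_def by (auto intro!: Bochner_Integration.integral_nonneg simp: p_def)
  define H where "H r = A + (\<Sum>l\<in>L. \<alpha> l * G2 l r + \<beta> l * G6 l r)" for r
  have inner: "(LINT x:torus_domain|lebesgue. f r x) \<le> H r" if r: "r \<in> {R..R+1}" for r
  proof -
    have ip: "set_integrable lebesgue torus_domain (\<lambda>x. (p l r x)\<^sup>2)" "set_integrable lebesgue torus_domain (\<lambda>x. p l r x ^ 6)" for l
      unfolding p_def by (intro set_integrable_continuous_lebesgue continuous_intros continuous_on_packet)+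
    note lin = set_integral_linear_combination[OF L lebesgue_torus(1), of "\<lambda>l x. (p l r x)\<^sup>2" "\<lambda>l x. p l r x ^ 6", OF ip]
    have "(LINT x:torus_domain|lebesgue. f r x) \<le> (LINT x:torus_domain|lebesgue. A + (\<Sum>l\<in>L. \<alpha> l * (p l r x)\<^sup>2 + \<beta> l * p l r x ^ 6))"
      by (rule set_integral_mono_dominated[OF lin(1)])
         (use dom[OF r] nn in \<open>auto simp: p_def intro!: add_nonneg_nonneg sum_nonneg mult_nonneg_nonneg\<close>)
    also have "\<dots> = H r" unfolding lin(2) lebesgue_torus(2) H_def G2_def G6_def by simp
    finally show ?thesis .
  qed
  have cG: "continuous_on UNIV (G2 l)" "continuous_on UNIV (G6 l)" if "l \<in> L" for l
    unfolding G2_def G6_def p_def using packet_mean_2(1) packet_mean_6(1) S[OF that] \<epsilon>[OF that] by blast+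
  have iG: "set_integrable lebesgue {R..R+1} (G2 l)" "set_integrable lebesgue {R..R+1} (G6 l)" if "l \<in> L" for l
    using cG[OF that] by (auto intro: set_integrable_interval_lebesgue)
  note lin = set_integral_linear_combination[OF L lebesgue_unit_interval(1)[of R], of G2 G6, OF iG]
  have "(LINT r:{R..R+1}|lebesgue. LINT x:torus_domain|lebesgue. f r x) \<le> (LINT r:{R..R+1}|lebesgue. H r)"
    unfolding H_def
    by (rule set_integral_mono_dominated[OF lin(1)])
       (use inner G0 nn in \<open>auto simp: H_def intro!: add_nonneg_nonneg sum_nonneg mult_nonneg_nonneg\<close>)
  also have "\<dots> = A + (\<Sum>l\<in>L. \<alpha> l * (LINT r:{R..R+1}|lebesgue. G2 l r) + \<beta> l * (LINT r:{R..R+1}|lebesgue. G6 l r))"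
    unfolding H_def using lin(2)[of A \<alpha> \<beta>] lebesgue_unit_interval(2)[of R] by simp
  also have "\<dots> \<le> A + (\<Sum>l\<in>L. \<alpha> l * (22 * (\<Sum>k\<in>S l. (norm (c l k))\<^sup>2)) + \<beta> l * (const6 * (\<Sum>k\<in>S l. (norm (c l k))\<^sup>2 * (1 + norm (freq k))) ^ 3))"
    unfolding G2_def G6_def p_def using S \<epsilon> nn
    by (intro add_left_mono sum_mono add_mono mult_left_mono packet_mean_2(2) packet_mean_6(2)) auto
  finally show ?thesis .
qed

text \<open>
  A shell has \<open>O(4 ^ j)\<close> points, and \<open>\<bar>c k\<bar>\<^sup>2\<close> is \<open>O(8 powr (- j))\<close> there. The additional weight in the second
  sum makes it scale invariant, which is the source of the logarithm at the critical exponent.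
\<close>
lemma shell_energy:
  assumes M: "0 \<le> M" and c: "\<And>k. k \<in> shell j \<Longrightarrow> norm (c k) \<le> M / (norm (freq k) * sqrt (norm (freq k)))"
  shows "(\<Sum>k\<in>shell j. (norm (c k))\<^sup>2) \<le> shell_const * M\<^sup>2 / gap ^ 3 / 2 ^ j"
    and "(\<Sum>k\<in>shell j. (norm (c k))\<^sup>2 * (1 + norm (freq k))) \<le> shell_const * M\<^sup>2 * (1 / gap + 1) / gap\<^sup>2"
proof -
  have p: "0 < 2 ^ j * gap" using gap_pos by simp
  have cube: "(2 ^ j * gap) ^ 3 = 8 ^ j * gap ^ 3"
    by (simp add: power_mult_distrib flip: power_mult) (simp add: mult.commute[of j] power_mult)
  have square: "(2 ^ j * gap)\<^sup>2 = 4 ^ j * gap\<^sup>2" by (simp add: power_mult_distrib flip: power_mult) (simp add: mult.commute[of j] power_mult)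
  have c2: "(norm (c k))\<^sup>2 \<le> M\<^sup>2 / norm (freq k) ^ 3" if k: "k \<in> shell j" for k
  proof -
    have r: "0 < norm (freq k)" by (rule shell_nonzero[OF k])
    have "(norm (c k))\<^sup>2 \<le> (M / (norm (freq k) * sqrt (norm (freq k))))\<^sup>2" using c[OF k] by (intro power_mono) auto
    also have "\<dots> = M\<^sup>2 / norm (freq k) ^ 3" using r by (simp add: power_divide power_mult_distrib power2_eq_square power3_eq_cube)
    finally show ?thesis .
  qed
  have "(\<Sum>k\<in>shell j. (norm (c k))\<^sup>2) \<le> shell_const * 4 ^ j * (M\<^sup>2 / (8 ^ j * gap ^ 3))"
  proof (rule shell_sum_le)
    fix k assume k: "k \<in> shell j"
    have "M\<^sup>2 / norm (freq k) ^ 3 \<le> M\<^sup>2 / (2 ^ j * gap) ^ 3"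
    proof (intro divide_left_mono power_mono mult_pos_pos[OF zero_less_power zero_less_power])
      show "2 ^ j * gap \<le> norm (freq k)" using k by (simp add: shell_def)
    qed (use p shell_nonzero[OF k] in auto)
    then show "(norm (c k))\<^sup>2 \<le> M\<^sup>2 / (8 ^ j * gap ^ 3)" using c2[OF k] by (simp add: cube)
  qed (use gap_pos in simp)
  also have "\<dots> = shell_const * M\<^sup>2 / gap ^ 3 / 2 ^ j"
  proof -
    have "(8::real) ^ j = 4 ^ j * 2 ^ j" by (simp flip: power_mult_distrib)
    then show ?thesis using gap_pos by (simp add: field_simps)
  qed
  finally show "(\<Sum>k\<in>shell j. (norm (c k))\<^sup>2) \<le> shell_const * M\<^sup>2 / gap ^ 3 / 2 ^ j" .
  have "(\<Sum>k\<in>shell j. (norm (c k))\<^sup>2 * (1 + norm (freq k))) \<le> shell_const * 4 ^ j * (M\<^sup>2 * (1 / gap + 1) / (4 ^ j * gap\<^sup>2))"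
  proof (rule shell_sum_le)
    fix k assume k: "k \<in> shell j"
    define r where "r = norm (freq k)"
    have r: "0 < r" "2 ^ j * gap \<le> r" using shell_nonzero[OF k] k by (auto simp: r_def shell_def)
    have "1 * gap \<le> 2 ^ j * gap" using gap_pos by (intro mult_right_mono) auto
    then have "gap \<le> r" using r by simp
    then have "1 + r \<le> (1 / gap + 1) * r" using gap_pos by (simp add: field_simps)
    then have "(norm (c k))\<^sup>2 * (1 + r) \<le> M\<^sup>2 / r ^ 3 * ((1 / gap + 1) * r)"
      using c2[OF k] r by (intro mult_mono) (auto simp: r_def)
    also have "\<dots> = M\<^sup>2 * (1 / gap + 1) / r\<^sup>2" using r by (simp add: power2_eq_square power3_eq_cube)
    also have "\<dots> \<le> M\<^sup>2 * (1 / gap + 1) / (2 ^ j * gap)\<^sup>2"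
    proof (rule divide_left_mono)
      show "(2 ^ j * gap)\<^sup>2 \<le> r\<^sup>2" using r(2) p by (intro power_mono) auto
      show "0 < r\<^sup>2 * (2 ^ j * gap)\<^sup>2" by (rule mult_pos_pos[OF zero_less_power[OF r(1)] zero_less_power[OF p]])
    qed (use gap_pos in simp)
    finally show "(norm (c k))\<^sup>2 * (1 + norm (freq k)) \<le> M\<^sup>2 * (1 / gap + 1) / (4 ^ j * gap\<^sup>2)" by (simp add: r_def square)
  qed (use gap_pos in simp)
  also have "\<dots> = shell_const * M\<^sup>2 * (1 / gap + 1) / gap\<^sup>2" by simp
  finally show "(\<Sum>k\<in>shell j. (norm (c k))\<^sup>2 * (1 + norm (freq k))) \<le> shell_const * M\<^sup>2 * (1 / gap + 1) / gap\<^sup>2" .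
qed

lemma packet_low: "packet c0 \<epsilon> (low J) c r x = (\<Sum>j<J. packet c0 \<epsilon> (shell j) c r x)"
  unfolding packet_def by (rule sum_low)

lemma const6_pos: "0 \<le> const6" by (simp add: const6_def)

end

section \<open>The mean bounds\<close>

context ellipse begin

text \<open>
  The energy of \<open>low J\<close> is at most a constant times the number \<open>J\<close> of shells, which is \<open>O(ln R)\<close>, and it
  enters with the third power.
\<close>
lemma mean_bound_endpoint:
  fixes c0 :: "real^2"
  defines "E \<equiv> {x. (((x - c0) \<bullet> u) / a)\<^sup>2 + (((x - c0) \<bullet> v) / b)\<^sup>2 \<le> 1}"
  shows "\<exists>K\<ge>0. \<forall>R\<ge>2. (LINT r:{R..R+1}|lebesgue. LINT x:torus_domain|lebesgue. \<bar>r powr (- 1 / 2) * discrepancy E r x\<bar> powr 6) \<le> K * ln R ^ 3"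
proof -
  obtain M C where M: "0 \<le> M" and C: "0 \<le> C" and pk: "\<And>R J. 2 \<le> R \<Longrightarrow> R \<le> 2 ^ J \<Longrightarrow> \<exists>c :: nat \<Rightarrow> real^2 \<Rightarrow> complex. (\<forall>i. \<forall>k\<in>low J. norm (c i k) \<le> M / (norm (freq k) * sqrt (norm (freq k)))) \<and>
      (\<forall>r\<in>{R..R+1}. \<forall>x. \<bar>r powr (- 1 / 2) * discrepancy E r x\<bar> \<le> C * (1 + (\<Sum>i<4. norm (packet c0 ((-1) ^ i) (low J) (c i) r x))))"
    by (rule discrepancy_packets[of c0, folded E_def]) (rule that, assumption+)
  define B where "B = C powr 6 * 5 powr 6"
  define K6 where "K6 = shell_const * M\<^sup>2 * (1 / gap + 1) / gap\<^sup>2"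
  have K60: "0 \<le> K6" using shell_const_pos gap_pos by (simp add: K6_def)
  have B0: "0 \<le> B" by (simp add: B_def)
  define K where "K = B * 8 + 4 * (B * (const6 * (4 * K6) ^ 3))"
  have K0: "0 \<le> K" unfolding K_def using B0 const6_pos K60 by (intro add_nonneg_nonneg mult_nonneg_nonneg) auto
  have "(LINT r:{R..R+1}|lebesgue. LINT x:torus_domain|lebesgue. \<bar>r powr (- 1 / 2) * discrepancy E r x\<bar> powr 6) \<le> K * ln R ^ 3"
    if R: "2 \<le> R" for R
  proof -
    obtain J where J: "R \<le> 2 ^ J" "real J \<le> 4 * ln R" using dyadic_scale[OF R] .
    obtain c where c: "\<And>i k. k \<in> low J \<Longrightarrow> norm (c i k) \<le> M / (norm (freq k) * sqrt (norm (freq k)))"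
      and D: "\<And>r x. r \<in> {R..R+1} \<Longrightarrow> \<bar>r powr (- 1 / 2) * discrepancy E r x\<bar> \<le> C * (1 + (\<Sum>i<4. norm (packet c0 ((-1) ^ i) (low J) (c i) r x)))"
      using pk[OF R J(1)] by blast
    have lnR: "1 / 2 \<le> ln R" using R ln2_ge_two_thirds ln_mono[of 2 R] by linarith
    have energy: "(\<Sum>k\<in>low J. (norm (c i k))\<^sup>2 * (1 + norm (freq k))) \<le> 4 * K6 * ln R" for i
    proof -
      have "(\<Sum>k\<in>low J. (norm (c i k))\<^sup>2 * (1 + norm (freq k))) \<le> (\<Sum>j<J. K6)"
        unfolding sum_low K6_def
      proof (intro sum_mono shell_energy(2)[OF M])
        fix j k assume "j \<in> {..<J}" "k \<in> shell j"
        then show "norm (c i k) \<le> M / (norm (freq k) * sqrt (norm (freq k)))" by (intro c) (auto simp: low_def)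
      qed
      also have "\<dots> \<le> 4 * K6 * ln R" using mult_right_mono[OF J(2) K60] by (simp add: mult_ac)
      finally show ?thesis .
    qed
    have "(LINT r:{R..R+1}|lebesgue. LINT x:torus_domain|lebesgue. \<bar>r powr (- 1 / 2) * discrepancy E r x\<bar> powr 6) \<le>
      B + (\<Sum>i\<in>{..<4::nat}. 0 * (22 * (\<Sum>k\<in>low J. (norm (c i k))\<^sup>2)) + B * (const6 * (\<Sum>k\<in>low J. (norm (c i k))\<^sup>2 * (1 + norm (freq k))) ^ 3))"
    proof (rule dominated_mean[where \<epsilon> = "\<lambda>i. (-1) ^ i"])
      fix r x assume r: "r \<in> {R..R+1}"
      define Y where "Y i = norm (packet c0 ((-1) ^ i) (low J) (c i) r x)" for i
      have "\<bar>r powr (- 1 / 2) * discrepancy E r x\<bar> powr 6 \<le> (C * (1 + (\<Sum>i<4. Y i))) powr 6"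
        using D[OF r, of x] by (intro powr_mono2) (auto simp: Y_def)
      also have "\<dots> = C powr 6 * (1 + (\<Sum>i<4. Y i)) powr 6"
        by (rule powr_mult)
      also have "\<dots> \<le> C powr 6 * (5 powr 6 * (1 + (\<Sum>i<4. Y i powr 6)))"
        by (intro mult_left_mono five_powr) (auto simp: Y_def)
      also have "(\<Sum>i<4. Y i powr 6) = (\<Sum>i<4. Y i ^ 6)" by (intro sum.cong refl) (simp add: Y_def)
      also have "C powr 6 * (5 powr 6 * (1 + (\<Sum>i<4. Y i ^ 6))) = B + (\<Sum>i<4. 0 * (Y i)\<^sup>2 + B * Y i ^ 6)"
      proof -
        have "(\<Sum>i<4. 0 * (Y i)\<^sup>2 + B * Y i ^ 6) = B * (\<Sum>i<4. Y i ^ 6)" by (simp add: sum_distrib_left)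
        then show ?thesis by (simp add: B_def algebra_simps)
      qed
      finally show "\<bar>r powr (- 1 / 2) * discrepancy E r x\<bar> powr 6 \<le> B + (\<Sum>i\<in>{..<4}. 0 * (norm (packet c0 ((-1) ^ i) (low J) (c i) r x))\<^sup>2 + B * norm (packet c0 ((-1) ^ i) (low J) (c i) r x) ^ 6)"
        by (simp add: Y_def)
    qed (use B0 finite_low low_lattice in \<open>auto simp flip: power_mult simp: mult.commute[of _ 2]\<close>)
    also have "\<dots> \<le> B + (\<Sum>i\<in>{..<4::nat}. B * (const6 * (4 * K6 * ln R) ^ 3))"
      using B0 const6_pos energy
      by (intro add_left_mono sum_mono) (auto intro!: mult_left_mono power_mono sum_nonneg mult_nonneg_nonneg add_nonneg_nonneg)
    also have "\<dots> = B + 4 * (B * (const6 * (4 * K6) ^ 3)) * ln R ^ 3" by (simp add: power_mult_distrib)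
    finally have main: "(LINT r:{R..R+1}|lebesgue. LINT x:torus_domain|lebesgue. \<bar>r powr (- 1 / 2) * discrepancy E r x\<bar> powr 6) \<le>
      B + 4 * (B * (const6 * (4 * K6) ^ 3)) * ln R ^ 3" .
    have "B \<le> B * 8 * ln R ^ 3"
    proof -
      have "(1 / 2) ^ 3 \<le> ln R ^ 3" using lnR by (intro power_mono) auto
      then have "1 \<le> 8 * ln R ^ 3" by (simp add: power3_eq_cube)
      from mult_left_mono[OF this B0] show ?thesis by simp
    qed
    with main show ?thesis unfolding K_def distrib_right by linarith
  qed
  then show ?thesis using K0 by blast
qed

text \<open>
  Let \<open>q' \<in> {2..<6}\<close> be at least \<open>p\<close> and \<open>\<gamma> = (6 - q') / 8\<close>. On the shell \<open>j\<close> apply \<open>powr_interpolate\<close> with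
  \<open>l = 2 powr (j / 4)\<close>. The factors \<open>l powr (q' - 2) = 2 powr (j * (1 - 2 * \<gamma>))\<close> and
  \<open>l powr (q' - 6) = 2 powr (- 2 * \<gamma> * j)\<close> meet a second moment \<open>O(2 powr (- j))\<close> and a bounded sixth
  moment, so both parts are \<open>O(2 powr (- 2 * \<gamma> * j))\<close>. The weights \<open>2 powr (\<gamma> * j)\<close> lost in separating the
  shells by \<open>sum_powr_weighted\<close> leave the convergent series of the \<open>2 powr (- \<gamma> * j)\<close>.
\<close>
lemma mean_bound_subcritical:
  fixes c0 :: "real^2" and p :: real
  assumes p: "1 \<le> p" "p < 6"
  defines "E \<equiv> {x. (((x - c0) \<bullet> u) / a)\<^sup>2 + (((x - c0) \<bullet> v) / b)\<^sup>2 \<le> 1}"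
  shows "\<exists>K\<ge>0. \<forall>R\<ge>2. (LINT r:{R..R+1}|lebesgue. LINT x:torus_domain|lebesgue. \<bar>r powr (- 1 / 2) * discrepancy E r x\<bar> powr p) \<le> K"
proof -
  define q' where "q' = max p 2"
  \<comment> \<open>The exponent is raised to at least 2, where interpolation between the second and the sixth moment is possible.\<close>
  define \<gamma> where "\<gamma> = (6 - q') / 8"
  have q': "2 \<le> q'" "q' < 6" "p \<le> q'" using p by (auto simp: q'_def)
  have \<gamma>: "0 < \<gamma>" "\<gamma> \<le> 1 / 2" using q' by (auto simp: \<gamma>_def)
  obtain M C where M: "0 \<le> M" and C: "0 \<le> C" and pk: "\<And>R J. 2 \<le> R \<Longrightarrow> R \<le> 2 ^ J \<Longrightarrow> \<exists>c :: nat \<Rightarrow> real^2 \<Rightarrow> complex. (\<forall>i. \<forall>k\<in>low J. norm (c i k) \<le> M / (norm (freq k) * sqrt (norm (freq k)))) \<and>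
      (\<forall>r\<in>{R..R+1}. \<forall>x. \<bar>r powr (- 1 / 2) * discrepancy E r x\<bar> \<le> C * (1 + (\<Sum>i<4. norm (packet c0 ((-1) ^ i) (low J) (c i) r x))))"
    by (rule discrepancy_packets[of c0, folded E_def]) (rule that, assumption+)
  define t where "t = 2 powr (\<gamma> / q')"
  have "2 powr 0 < t" unfolding t_def using \<gamma> q' by (intro powr_less_mono) auto
  then have t: "1 < t" by simp
  define W where "W = 1 / (1 - 1 / t)"
  define A where "A = 1 + C powr q' * 5 powr q'"
  define B where "B = C powr q' * 5 powr q' * W powr q'"
  define K2 where "K2 = shell_const * M\<^sup>2 / gap ^ 3"
  define K6 where "K6 = shell_const * M\<^sup>2 * (1 / gap + 1) / gap\<^sup>2"
  have K60: "0 \<le> K6" and K20: "0 \<le> K2" using shell_const_pos gap_pos by (auto simp: K6_def K2_def)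
  have B0: "0 \<le> B" "1 \<le> A" by (auto simp: B_def A_def)
  define \<theta> where "\<theta> = 2 powr (- \<gamma>)"
  have \<theta>: "0 < \<theta>" "\<theta> < 1" using \<gamma> powr_less_mono[of "- \<gamma>" 0 2] by (simp_all add: \<theta>_def)
  define K where "K = A + 4 * (B * (22 * K2 + const6 * K6 ^ 3) * (1 / (1 - \<theta>)))"
  have K0: "0 \<le> K" unfolding K_def using B0 const6_pos K60 K20 \<theta>
    by (intro add_nonneg_nonneg mult_nonneg_nonneg) auto
  have "(LINT r:{R..R+1}|lebesgue. LINT x:torus_domain|lebesgue. \<bar>r powr (- 1 / 2) * discrepancy E r x\<bar> powr p) \<le> K"
    if R: "2 \<le> R" for R
  proof -
    obtain J where J: "R \<le> 2 ^ J" using dyadic_scale[OF R] by blast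
    obtain c where c: "\<And>i k. k \<in> low J \<Longrightarrow> norm (c i k) \<le> M / (norm (freq k) * sqrt (norm (freq k)))"
      and D: "\<And>r x. r \<in> {R..R+1} \<Longrightarrow> \<bar>r powr (- 1 / 2) * discrepancy E r x\<bar> \<le> C * (1 + (\<Sum>i<4. norm (packet c0 ((-1) ^ i) (low J) (c i) r x)))"
      using pk[OF R J(1)] by blast
    define L where "L = {..<4::nat} \<times> {..<J}"
    define \<alpha> where "\<alpha> l = B * 2 powr (real (snd l) * (1 - \<gamma>))" for l :: "nat \<times> nat"
    define \<beta> where "\<beta> l = B * 2 powr (- \<gamma> * real (snd l))" for l :: "nat \<times> nat"
    have "(LINT r:{R..R+1}|lebesgue. LINT x:torus_domain|lebesgue. \<bar>r powr (- 1 / 2) * discrepancy E r x\<bar> powr p) \<le>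
      A + (\<Sum>l\<in>L. \<alpha> l * (22 * (\<Sum>k\<in>shell (snd l). (norm (c (fst l) k))\<^sup>2)) + \<beta> l * (const6 * (\<Sum>k\<in>shell (snd l). (norm (c (fst l) k))\<^sup>2 * (1 + norm (freq k))) ^ 3))"
    proof (rule dominated_mean[where \<epsilon> = "\<lambda>l. (-1) ^ fst l"])
      fix r x assume r: "r \<in> {R..R+1}"
      define X where "X = \<bar>r powr (- 1 / 2) * discrepancy E r x\<bar>"
      define Y where "Y i = norm (packet c0 ((-1) ^ i) (low J) (c i) r x)" for i
      define y where "y i j = norm (packet c0 ((-1) ^ i) (shell j) (c i) r x)" for i j
      have X0: "0 \<le> X" by (simp add: X_def)
      have one: "X powr p \<le> 1 + X powr q'"
      proof (cases "X \<le> 1")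
        case True
        then have "X powr p \<le> 1" using X0 p by (intro powr_le1) auto
        then show ?thesis by (simp add: add_increasing2)
      next
        case False
        then have "X powr p \<le> X powr q'" using q' by (intro powr_mono) auto
        then show ?thesis by simp
      qed
      have "X powr q' \<le> (C * (1 + (\<Sum>i<4. Y i))) powr q'"
        using D[OF r, of x] q' X0 by (intro powr_mono2) (auto simp: Y_def X_def)
      also have "\<dots> = C powr q' * (1 + (\<Sum>i<4. Y i)) powr q'"
        by (rule powr_mult)
      also have "\<dots> \<le> C powr q' * (5 powr q' * (1 + (\<Sum>i<4. Y i powr q')))"
        using q' by (intro mult_left_mono five_powr) (auto simp: Y_def)
      finally have two: "X powr q' \<le> C powr q' * (5 powr q' * (1 + (\<Sum>i<4. Y i powr q')))" .
      have three: "Y i powr q' \<le> W powr q' * (\<Sum>j<J. 2 powr (real j * (1 - \<gamma>)) * (y i j)\<^sup>2 + 2 powr (- \<gamma> * real j) * y i j ^ 6)" for i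
      proof -
        have "Y i \<le> (\<Sum>j<J. y i j)" unfolding Y_def y_def packet_low by (rule norm_sum)
        then have "Y i powr q' \<le> (\<Sum>j<J. y i j) powr q'" using q' by (intro powr_mono2) (auto simp: Y_def)
        also have "\<dots> \<le> W powr q' * (\<Sum>j<J. (t ^ j * y i j) powr q')"
        proof (rule sum_powr_weighted)
          have "(\<Sum>j<J. 1 / t ^ j) = (\<Sum>j<J. (1 / t) ^ j)" by (simp add: power_divide)
          also have "\<dots> \<le> W" unfolding W_def using t by (intro geometric_le) auto
          finally show "(\<Sum>j<J. 1 / t ^ j) \<le> W" .
        qed (use t q' in \<open>auto simp: y_def\<close>)
        also have "\<dots> \<le> W powr q' * (\<Sum>j<J. 2 powr (real j * (1 - \<gamma>)) * (y i j)\<^sup>2 + 2 powr (- \<gamma> * real j) * y i j ^ 6)"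
        proof (intro mult_left_mono sum_mono)
          fix j
          define l where "l = 2 powr (real j / 4)"
          have tj: "(t ^ j) powr q' = 2 powr (\<gamma> * real j)"
            using t q' by (simp add: t_def powr_powr flip: powr_realpow)
          have l2: "l powr (q' - 2) = 2 powr (real j * (1 - 2 * \<gamma>))" unfolding l_def powr_powr by (rule arg_cong[where f = "\<lambda>x. 2 powr x"]) (simp add: \<gamma>_def field_simps)
          have l6: "l powr (q' - 6) = 2 powr (- 2 * \<gamma> * real j)" unfolding l_def powr_powr by (rule arg_cong[where f = "\<lambda>x. 2 powr x"]) (simp add: \<gamma>_def field_simps)
          have y0: "0 \<le> y i j" by (simp add: y_def)
          have "(t ^ j * y i j) powr q' = 2 powr (\<gamma> * real j) * y i j powr q'"
            using t y0 by (simp add: powr_mult tj)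
          also have "\<dots> \<le> 2 powr (\<gamma> * real j) * (l powr (q' - 2) * (y i j)\<^sup>2 + l powr (q' - 6) * y i j ^ 6)"
            using q' y0 by (intro mult_left_mono powr_interpolate) (auto simp: l_def)
          also have "\<dots> = 2 powr (\<gamma> * real j + real j * (1 - 2 * \<gamma>)) * (y i j)\<^sup>2 + 2 powr (\<gamma> * real j + - 2 * \<gamma> * real j) * y i j ^ 6"
            unfolding l2 l6 powr_add by (simp add: distrib_left mult_ac)
          also have "\<gamma> * real j + real j * (1 - 2 * \<gamma>) = real j * (1 - \<gamma>)" by (simp add: algebra_simps)
          also have "\<gamma> * real j + - 2 * \<gamma> * real j = - \<gamma> * real j" by simp
          finally show "(t ^ j * y i j) powr q' \<le> 2 powr (real j * (1 - \<gamma>)) * (y i j)\<^sup>2 + 2 powr (- \<gamma> * real j) * y i j ^ 6" .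
        qed simp
        finally show ?thesis .
      qed
      have "X powr p \<le> 1 + C powr q' * (5 powr q' * (1 + (\<Sum>i<4. Y i powr q')))" using one two by linarith
      also have "\<dots> \<le> 1 + C powr q' * (5 powr q' * (1 + (\<Sum>i<4. W powr q' * (\<Sum>j<J. 2 powr (real j * (1 - \<gamma>)) * (y i j)\<^sup>2 + 2 powr (- \<gamma> * real j) * y i j ^ 6))))"
        by (intro add_left_mono mult_left_mono sum_mono three) auto
      also have "\<dots> = A + (\<Sum>i<4. \<Sum>j<J. B * 2 powr (real j * (1 - \<gamma>)) * (y i j)\<^sup>2 + B * 2 powr (- \<gamma> * real j) * y i j ^ 6)"
        by (simp add: A_def B_def sum_distrib_left distrib_left mult_ac)
      also have "(\<Sum>i<4. \<Sum>j<J. B * 2 powr (real j * (1 - \<gamma>)) * (y i j)\<^sup>2 + B * 2 powr (- \<gamma> * real j) * y i j ^ 6) =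
         (\<Sum>l\<in>L. \<alpha> l * (y (fst l) (snd l))\<^sup>2 + \<beta> l * y (fst l) (snd l) ^ 6)"
        unfolding L_def sum.cartesian_product by (simp add: \<alpha>_def \<beta>_def case_prod_beta)
      finally show "\<bar>r powr (- 1 / 2) * discrepancy E r x\<bar> powr p \<le> A + (\<Sum>l\<in>L. \<alpha> l * (norm (packet c0 ((-1) ^ fst l) (shell (snd l)) (c (fst l)) r x))\<^sup>2 + \<beta> l * norm (packet c0 ((-1) ^ fst l) (shell (snd l)) (c (fst l)) r x) ^ 6)"
        by (simp add: X_def y_def)
    next
      show "0 \<le> \<alpha> l" "0 \<le> \<beta> l" for l using B0 by (auto simp: \<alpha>_def \<beta>_def)
      show "((-1) ^ fst l)\<^sup>2 = (1::real)" for l :: "nat \<times> nat" by (simp add: mult.commute[of _ 2] flip: power_mult)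
    qed (use B0 finite_shell shell_lattice in \<open>auto simp: L_def\<close>)
    also have "\<dots> \<le> A + (\<Sum>l\<in>L. B * (22 * K2 + const6 * K6 ^ 3) * \<theta> ^ snd l)"
    proof (intro add_left_mono sum_mono)
      fix l assume l: "l \<in> L"
      define i j where "i = fst l" and "j = snd l"
      have ij: "j < J" using l by (auto simp: L_def j_def)
      have cs: "norm (c i k) \<le> M / (norm (freq k) * sqrt (norm (freq k)))" if "k \<in> shell j" for k
        using that ij by (intro c) (auto simp: low_def)
      have th: "\<theta> ^ j = 2 powr (- \<gamma> * real j)" by (simp add: \<theta>_def powr_powr flip: powr_realpow)
      have "\<alpha> l * (22 * (\<Sum>k\<in>shell j. (norm (c i k))\<^sup>2)) \<le> \<alpha> l * (22 * (K2 / 2 ^ j))"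
        unfolding K2_def using B0 by (intro mult_left_mono shell_energy(1)[OF M cs]) (auto simp: \<alpha>_def)
      also have "\<dots> = B * (22 * K2) * \<theta> ^ j"
      proof -
        have "2 powr (real j * (1 - \<gamma>)) = 2 ^ j * 2 powr (- \<gamma> * real j)"
          by (simp add: powr_realpow[symmetric] algebra_simps flip: powr_add)
        then show ?thesis unfolding th by (simp add: \<alpha>_def j_def)
      qed
      finally have 1: "\<alpha> l * (22 * (\<Sum>k\<in>shell j. (norm (c i k))\<^sup>2)) \<le> B * (22 * K2) * \<theta> ^ j" .
      have "\<beta> l * (const6 * (\<Sum>k\<in>shell j. (norm (c i k))\<^sup>2 * (1 + norm (freq k))) ^ 3) \<le> \<beta> l * (const6 * K6 ^ 3)"
        unfolding K6_def using B0 const6_pos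
        by (intro mult_left_mono power_mono shell_energy(2)[OF M cs] sum_nonneg) (auto simp: \<beta>_def)
      also have "\<dots> = B * (const6 * K6 ^ 3) * \<theta> ^ j" unfolding th by (simp add: \<beta>_def j_def)
      finally have "\<beta> l * (const6 * (\<Sum>k\<in>shell j. (norm (c i k))\<^sup>2 * (1 + norm (freq k))) ^ 3) \<le> B * (const6 * K6 ^ 3) * \<theta> ^ j" .
      with 1 show "\<alpha> l * (22 * (\<Sum>k\<in>shell (snd l). (norm (c (fst l) k))\<^sup>2)) + \<beta> l * (const6 * (\<Sum>k\<in>shell (snd l). (norm (c (fst l) k))\<^sup>2 * (1 + norm (freq k))) ^ 3)
        \<le> B * (22 * K2 + const6 * K6 ^ 3) * \<theta> ^ snd l"
        by (simp add: i_def j_def algebra_simps)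
    qed
    also have "(\<Sum>l\<in>L. B * (22 * K2 + const6 * K6 ^ 3) * \<theta> ^ snd l) = (\<Sum>i<4::nat. \<Sum>j<J. B * (22 * K2 + const6 * K6 ^ 3) * \<theta> ^ j)"
      unfolding L_def sum.cartesian_product by (simp add: case_prod_beta)
    also have "\<dots> = 4 * (B * (22 * K2 + const6 * K6 ^ 3) * (\<Sum>j<J. \<theta> ^ j))"
      by (simp add: sum_distrib_left)
    also have "A + 4 * (B * (22 * K2 + const6 * K6 ^ 3) * (\<Sum>j<J. \<theta> ^ j)) \<le> K"
      unfolding K_def using B0 const6_pos K60 K20 \<theta>
      by (intro add_left_mono mult_left_mono geometric_le) auto
    finally show ?thesis .
  qed
  then show ?thesis using K0 by blast
qed

end

theorem corollary1p6:
  fixes E :: "(real^2) set" and p :: real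
  assumes "is_ellipse E" and "0 \<in> interior E" and "1 \<le> p"
  shows "\<exists>C::real. \<forall>R\<ge>2.
           (p < 6 \<longrightarrow> discrepancy_mean E p R \<le> C) \<and>
           (p = 6 \<longrightarrow> discrepancy_mean E p R \<le> C * ln R powr (2 / 3))"
proof -
  obtain c u v a b where frame: "norm u = 1" "norm v = 1" "u \<bullet> v = 0" "0 < a" "0 < b"
    and E: "E = {x. (((x - c) \<bullet> u) / a)\<^sup>2 + (((x - c) \<bullet> v) / b)\<^sup>2 \<le> 1}"
    using assms(1) unfolding is_ellipse_def by blast
  interpret ellipse u v a b by unfold_locales (rule frame)+
  define I where "I R = (LINT r:{R..R+1}|lebesgue. LINT x:torus_domain|lebesgue. \<bar>r powr (- 1 / 2) * discrepancy E r x\<bar> powr p)" for R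
  have mean: "discrepancy_mean E p R = I R powr (1 / p)" for R by (simp add: discrepancy_mean_def I_def)
  have I0: "0 \<le> I R" for R
    unfolding I_def set_lebesgue_integral_def by (auto intro!: Bochner_Integration.integral_nonneg mult_nonneg_nonneg)
  consider "p < 6" | "p = 6" | "6 < p" by linarith
  then show ?thesis
  proof cases
    case 1
    obtain K where K: "0 \<le> K" "\<And>R. 2 \<le> R \<Longrightarrow> I R \<le> K"
      using mean_bound_subcritical[OF assms(3) 1, of c] unfolding I_def E by blast
    have "discrepancy_mean E p R \<le> K powr (1 / p)" if "2 \<le> R" for R
      unfolding mean using K(2)[OF that] I0 assms(3) by (intro powr_mono2) auto
    then show ?thesis using 1 by (intro exI[of _ "K powr (1 / p)"]) auto
  next
    case 2
    obtain K where K: "0 \<le> K" "\<And>R. 2 \<le> R \<Longrightarrow> I R \<le> K * ln R ^ 3"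
      using mean_bound_endpoint[of c] unfolding I_def E 2 by blast
    have "discrepancy_mean E p R \<le> 2 * K powr (1 / 6) * ln R powr (2 / 3)" if R: "2 \<le> R" for R
    proof -
      have lnR: "1 / 2 \<le> ln R" using R ln2_ge_two_thirds ln_mono[of 2 R] by linarith
      have "discrepancy_mean E p R \<le> (K * ln R ^ 3) powr (1 / 6)"
        unfolding mean using K(2)[OF R] I0 unfolding 2 by (intro powr_mono2) auto
      also have "\<dots> = K powr (1 / 6) * (ln R ^ 3) powr (1 / 6)" by (rule powr_mult)
      also have "(ln R ^ 3) powr (1 / 6) = ln R powr (1 / 2)"
      proof -
        have "ln R ^ 3 = ln R powr 3" using lnR by (simp add: powr_numeral)
        then show ?thesis by (simp add: powr_powr)
      qed
      finally have 1: "discrepancy_mean E p R \<le> K powr (1 / 6) * ln R powr (1 / 2)" .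
      have "ln R powr (1 / 2) \<le> 2 * ln R powr (2 / 3)"
      proof -
        have "ln R powr (1 / 2) = ln R powr (- 1 / 6) * ln R powr (2 / 3)" by (simp flip: powr_add)
        also have "\<dots> \<le> (1 / 2) powr (- 1 / 6) * ln R powr (2 / 3)"
          using lnR by (intro mult_right_mono powr_mono2') auto
        also have "(1 / 2) powr (- 1 / 6) \<le> (2::real)"
        proof -
          have "(1 / 2) powr (- 1 / 6) = (2::real) powr (1 / 6)" by (simp add: powr_divide powr_minus_divide)
          also have "\<dots> \<le> 2 powr 1" by (rule powr_mono) auto
          finally show ?thesis by simp
        qed
        finally show ?thesis by (simp add: mult_right_mono)
      qed
      then have "K powr (1 / 6) * ln R powr (1 / 2) \<le> K powr (1 / 6) * (2 * ln R powr (2 / 3))"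
        by (intro mult_left_mono) auto
      with 1 show ?thesis by (simp add: mult_ac)
    qed
    then show ?thesis using 2 by (intro exI[of _ "2 * K powr (1 / 6)"]) auto
  next
    case 3
    then show ?thesis by auto
  qed
qed

end
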